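(* There is a constant $c>0$ such that for all integers $d\geq 1$ and $n\geq 0$ with $n\geq c\,e^{d/2}$, the Jensen polynomial $J^{d,n}(X)$ (attached to the Riemann xi-function) is hyperbolic.
   Context: Let $\zeta(s)$ be the Riemann zeta function and let $\xi(s):=\frac12 s(s-1)\pi^{-s/2}\Gamma(\frac s2)\zeta(s)$, an entire function. Define real numbers $\gamma(j)$, $j\ge 0$, by $\xi\big(\tfrac12+z\big)=\sum_{j=0}^{\infty}\frac{\gamma(j)}{j!}z^{2j}$; it is known that $\gamma(j)>0$ for all $j\ge 0$. For integers $d,n\ge 0$ define $J^{d,n}(X):=\sum_{j=0}^{d}\binom dj\gamma(n+j)X^j$. A polynomial with real coefficients is hyperbolic if all of its complex zeros are real. *)

theory Defs
  imports
    "HOL-Complex_Analysis.Complex_Analysis"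
    "HOL-Computational_Algebra.Polynomial"
begin

text \<open>
  The meromorphic continuation of \<open>\<Sum>n\<ge>1. n\<^sup>-\<^sup>s\<close> to the punctured plane. The value at the
  pole \<open>s = 1\<close> is set to 0; this convention only serves to make the function unique.
\<close>
definition riemann_zeta :: "complex \<Rightarrow> complex" where
  "riemann_zeta = (THE f. f holomorphic_on (- {1}) \<and>
     (\<forall>s. Re s > 1 \<longrightarrow> (\<lambda>n. 1 / of_nat (Suc n) powr s) sums f s) \<and> f 1 = 0)"

text \<open>
  The defining product has removable singularities at \<open>s = 1\<close> (pole of \<open>\<zeta>\<close>) and at
  \<open>s = 0, -2, -4, \<dots>\<close> (poles of \<open>\<Gamma>(s/2)\<close>, where \<^const>\<open>Gamma\<close> takes the value 0), so the
  entire function is obtained by filling these points with the limits.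
\<close>
definition riemann_xi :: "complex \<Rightarrow> complex" where
  "riemann_xi = remove_sings (\<lambda>s. 1 / 2 * s * (s - 1) * of_real pi powr (- s / 2) *
     Gamma (s / 2) * riemann_zeta s)"

definition xi_coeff :: "nat \<Rightarrow> real" where
  "xi_coeff = (THE g. \<forall>z::complex.
     (\<lambda>j. of_real (g j) / fact j * z ^ (2 * j)) sums riemann_xi (1 / 2 + z))"

definition jensen_poly :: "nat \<Rightarrow> nat \<Rightarrow> real poly" where
  "jensen_poly d n = (\<Sum>j=0..d. monom (of_nat (d choose j) * xi_coeff (n + j)) j)"

definition hyperbolic :: "real poly \<Rightarrow> bool" where
  "hyperbolic p \<longleftrightarrow> (\<forall>z::complex. poly (map_poly of_real p) z = 0 \<longrightarrow> z \<in> \<real>)"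

end

(*
  Write xi(1/2 + z) = F(z^2). The zeros w of the entire function F lie in the convex parabolic region
  |w| + Re w <= 1/2, since those of xi(1/2 + z) lie in the strip |Re z| <= 1/2. The coefficient-reversed
  Jensen polynomial J^{d,n} is F^(n)(D) X^d with D = d/dX. A pair of conjugate zeros w of F^(n)
  contributes a factor |w|^2 - 2 Re(w) D + D^2, and this operator preserves hyperbolicity in degree <= d
  as soon as (d - 1) |w|^2 <= d (Re w)^2. In the region above this holds when |w| >= d. By Gauss-Lucas
  the zeros of F^(n) stay in the region, where Re(-1/w) > 0, so each of them satisfies
  Re(-1/w) <= gamma(n+1)/gamma(n). These ratios decrease, and as F has order 1/2 they tend to 0 like a
  power of n; hence n >= c d^A, and in particular n >= c exp(d/2), suffices. The zeros are handled
  through real polynomials P_N tending to F whose zeros are zeros of F.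
*)
theory Submission
  imports
    Defs
    "HOL-Complex_Analysis.Complex_Analysis"
    "HOL-Computational_Algebra.Computational_Algebra"
    "HOL-Real_Asymp.Real_Asymp"
begin

section \<open>Operators preserving hyperbolicity\<close>

text \<open>\<open>riemann_zeta\<close>, \<open>riemann_xi\<close> and \<open>xi_coeff\<close> are
  specified by unique existence or by limits, so the continuation itself has to be built. It is
  obtained in the variable w = (s - 1/2)^2 as a power series with positive coefficients
  \<open>c\<close>, from the theta transformation. Positivity of \<open>c\<close> is used twice: for
  real s > 1 sums and integrals may be exchanged without estimates, and the series is largest at
  positive real points, where Gamma and zeta values express it. This gives the order 1/2, and at s =
  2 a disc free of zeros. The disc matters because the decrease of the ratios is derived from Re
  (1/w^2) >= 0 at the zeros, which holds within 45 degrees of the negative axis; the parabola alone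
  does not ensure this near its vertex. The Taylor coefficients of F are differences of positive
  numbers, so their positivity, too, is deduced from the zeros. The hypothesis n >= c exp(d/2)
  enters as d <= 2 ln n, against ratios bounded by about n^(-1/2).\<close>

abbreviation cpoly :: "real poly \<Rightarrow> complex poly" where
  "cpoly \<equiv> map_poly of_real"

lemma cpoly_add: "cpoly (p + q) = cpoly p + cpoly q"
  by (intro poly_eqI) (simp add: coeff_map_poly)

lemma cpoly_mult: "cpoly (p * q) = cpoly p * cpoly q"
  by (intro poly_eqI) (simp add: coeff_map_poly coeff_mult)

lemma cpoly_pderiv: "cpoly (pderiv p) = pderiv (cpoly p)"
  by (intro poly_eqI) (simp add: coeff_map_poly coeff_pderiv)

lemma poly_cpoly_cnj: "poly (cpoly p) (cnj z) = cnj (poly (cpoly p) z)"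
  by (simp add: poly_altdef coeff_map_poly degree_map_poly)

text \<open>\<open>S\<close> is P'/P, and the second formula is P''/P = S^2 + S'. Induction on the
  number of factors keeps both identities polynomial, so no quotient is differentiated.\<close>

lemma poly_pderiv_prod_linear:
  fixes r :: "nat \<Rightarrow> 'a :: field"
  assumes "\<And>i. i < n \<Longrightarrow> z \<noteq> r i"
  defines "P \<equiv> (\<Prod>i<n. [:- r i, 1:])"
  defines "S \<equiv> (\<Sum>i<n. 1 / (z - r i))"
  shows "poly (pderiv P) z = poly P z * S"
    and "poly (pderiv (pderiv P)) z = poly P z * (S^2 - (\<Sum>i<n. (1 / (z - r i))^2))"
proof -
  have "poly (pderiv (\<Prod>i<m. [:- r i, 1:])) z = poly (\<Prod>i<m. [:- r i, 1:]) z * (\<Sum>i<m. 1 / (z - r i))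
      \<and> poly (pderiv (pderiv (\<Prod>i<m. [:- r i, 1:]))) z =
          poly (\<Prod>i<m. [:- r i, 1:]) z * ((\<Sum>i<m. 1 / (z - r i))^2 - (\<Sum>i<m. (1 / (z - r i))^2))"
    if "m \<le> n" for m
    using that
  proof (induction m)
    case (Suc m)
    define A where "A = (\<Prod>i<m. [:- r i, 1:])"
    define T where "T = (\<Sum>i<m. 1 / (z - r i))"
    define U where "U = (\<Sum>i<m. (1 / (z - r i))^2)"
    have IH: "poly (pderiv A) z = poly A z * T" "poly (pderiv (pderiv A)) z = poly A z * (T^2 - U)"
      using Suc by (simp_all add: A_def T_def U_def)
    have nz: "z - r m \<noteq> 0" using assms(1)[of m] Suc.prems by simp
    have lin: "pderiv [:- r m, 1:] = 1" by (simp add: pderiv_pCons)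
    define Q where "Q = (\<Prod>i<Suc m. [:- r i, 1:])"
    have Q: "poly Q z = poly A z * (z - r m)" by (simp add: Q_def A_def algebra_simps)
    have dQ: "pderiv Q = A + [:- r m, 1:] * pderiv A"
      unfolding Q_def prod.lessThan_Suc A_def[symmetric] pderiv_mult lin by simp
    have ddQ: "pderiv (pderiv Q) = smult 2 (pderiv A) + [:- r m, 1:] * pderiv (pderiv A)"
      unfolding dQ by (simp only: pderiv_add pderiv_mult lin) (simp add: numeral_poly)
    define v where "v = 1 / (z - r m)"
    have v: "(z - r m) * v = 1" using nz by (simp add: v_def)
    have "poly (pderiv Q) z = poly A z + (z - r m) * (poly A z * T)"
      unfolding dQ by (simp add: IH algebra_simps)
    also have "\<dots> = poly Q z * (T + v)" unfolding Q using v by algebra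
    finally have 1: "poly (pderiv Q) z = poly Q z * (T + v)" .
    have "poly (pderiv (pderiv Q)) z = 2 * (poly A z * T) + (z - r m) * (poly A z * (T^2 - U))"
      unfolding ddQ by (simp add: IH(2)) (simp add: IH(1) algebra_simps)
    also have "\<dots> = poly Q z * ((T + v)^2 - (U + v^2))" unfolding Q using v by algebra
    finally have 2: "poly (pderiv (pderiv Q)) z = poly Q z * ((T + v)^2 - (U + v^2))" .
    show ?case
      using 1 2 by (simp only: Q_def[symmetric]) (simp add: T_def U_def v_def)
  qed (simp_all add: pderiv_1)
  from this[of n] show "poly (pderiv P) z = poly P z * S"
    and "poly (pderiv (pderiv P)) z = poly P z * (S^2 - (\<Sum>i<n. (1 / (z - r i))^2))"
    by (simp_all add: P_def S_def)
qed

lemma complex_poly_derivs_at_nonroot: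
  fixes p :: "complex poly"
  obtains r :: "nat \<Rightarrow> complex" where
    "\<And>z. poly p z = lead_coeff p * (\<Prod>i<degree p. z - r i)"
    "\<And>i. i < degree p \<Longrightarrow> poly p (r i) = 0"
    "\<And>z. poly p z \<noteq> 0 \<Longrightarrow> poly (pderiv p) z = poly p z * (\<Sum>i<degree p. 1 / (z - r i))"
    "\<And>z. poly p z \<noteq> 0 \<Longrightarrow> poly (pderiv (pderiv p)) z =
        poly p z * ((\<Sum>i<degree p. 1 / (z - r i))^2 - (\<Sum>i<degree p. (1 / (z - r i))^2))"
proof -
  obtain r where r: "smult (lead_coeff p) (\<Prod>i<degree p. [:-r i, 1:]) = p"
    using complex_poly_decompose' by blast
  define P where "P = (\<Prod>i<degree p. [:-r i, 1:])"
  have p: "p = smult (lead_coeff p) P" using r by (simp add: P_def)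
  have ev: "poly p z = lead_coeff p * (\<Prod>i<degree p. z - r i)" for z
    by (subst r[symmetric]) (simp add: poly_prod)
  have root: "poly p (r i) = 0" if "i < degree p" for i
    using that by (auto simp: ev)
  have ne: "z \<noteq> r i" if "poly p z \<noteq> 0" "i < degree p" for z i
    using that root by auto
  show thesis
  proof (rule that[OF ev root])
    fix z assume z: "poly p z \<noteq> 0"
    have pz: "poly p z = lead_coeff p * poly P z" 
      by (metis p poly_smult)
    have "pderiv p = smult (lead_coeff p) (pderiv P)" 
      by (metis p pderiv_smult)
    thus "poly (pderiv p) z = poly p z * (\<Sum>i<degree p. 1 / (z - r i))"
      using poly_pderiv_prod_linear(1)[of "degree p" z r, OF ne[OF z]] pz by (simp add: P_def)
    have "pderiv (pderiv p) = smult (lead_coeff p) (pderiv (pderiv P))" 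
      by (metis p pderiv_smult)
    thus "poly (pderiv (pderiv p)) z =
        poly p z * ((\<Sum>i<degree p. 1 / (z - r i))^2 - (\<Sum>i<degree p. (1 / (z - r i))^2))"
      using poly_pderiv_prod_linear(2)[of "degree p" z r, OF ne[OF z]] pz by (simp add: P_def)
  qed
qed

text \<open>
  The inequality behind the invariance of hyperbolicity: \<open>\<alpha> - \<i>\<beta>\<close> are the logarithmic-derivative
  terms \<open>1/(z - x\<^sub>i)\<close>. The deviations \<open>\<delta>\<close> of \<open>\<alpha>\<close> from its \<open>\<beta>\<close>-weighted mean \<open>\<mu>\<close> are orthogonal to \<open>\<beta>\<close>, so
  Cauchy--Schwarz against \<open>1 - t\<beta>\<close> with the optimal \<open>t\<close> gains the factor \<open>n - 1\<close> over \<open>n\<close>.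
\<close>
lemma weighted_mean_inequality:
  fixes \<alpha> \<beta> :: "nat \<Rightarrow> real"
  assumes n: "n \<ge> 2" and \<beta>: "\<And>i. i < n \<Longrightarrow> \<beta> i > 0"
    and \<mu>: "(\<Sum>i<n. \<alpha> i * \<beta> i) = \<mu> * (\<Sum>i<n. \<beta> i)"
  defines "A \<equiv> (\<Sum>i<n. \<alpha> i)" and "B \<equiv> (\<Sum>i<n. \<beta> i)"
  shows "(\<mu> - A)^2 * real n <
         real (n - 1) * ((\<Sum>i<n. (\<alpha> i)^2) + A^2 - 2 * \<mu> * A + B^2 - (\<Sum>i<n. (\<beta> i)^2))"
proof -
  define \<delta> where "\<delta> i = \<alpha> i - \<mu>" for i
  define D where "D = (\<Sum>i<n. \<delta> i)"
  define E where "E = (\<Sum>i<n. (\<delta> i)^2)"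
  define C where "C = (\<Sum>i<n. (\<beta> i)^2)"
  have "C > 0" unfolding C_def using n \<beta> by (intro sum_pos zero_less_power) (auto simp: lessThan_empty_iff)
  have "B > 0" unfolding B_def using n \<beta> by (intro sum_pos) (auto simp: lessThan_empty_iff)
  \<comment> \<open>Two positive weights make this strict, and the strictness of the conclusion
    comes from here.\<close>
  have BC: "C < B^2"
  proof -
    have "(\<beta> i)^2 < \<beta> i * B" if "i < n" for i
    proof -
      obtain j where j: "j < n" "j \<noteq> i" using n
        by (metis Suc_1 less_le_trans lessI zero_neq_one not_less_eq One_nat_def zero_less_Suc)
      have "\<beta> i + \<beta> j = (\<Sum>k\<in>{i,j}. \<beta> k)" using j by simp
      also have "\<dots> \<le> B" unfolding B_def using j that \<beta> by (intro sum_mono2) (auto intro: less_imp_le)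
      finally have "\<beta> i < B" using \<beta>[OF j(1)] by linarith
      thus ?thesis using \<beta>[OF that] by (simp add: power2_eq_square)
    qed
    hence "C < (\<Sum>i<n. \<beta> i * B)" unfolding C_def using n by (intro sum_strict_mono) (auto simp: lessThan_empty_iff)
    also have "\<dots> = B^2" by (simp add: B_def power2_eq_square sum_distrib_right)
    finally show ?thesis .
  qed
  have orth: "(\<Sum>i<n. \<delta> i * \<beta> i) = 0"
    using \<mu> by (simp add: \<delta>_def algebra_simps sum_subtractf sum_distrib_left)
  define t where "t = B / C"
  have "D = (\<Sum>i<n. \<delta> i * (1 - t * \<beta> i))"
  proof -
    have "(\<Sum>i<n. \<delta> i * (1 - t * \<beta> i)) = D - t * (\<Sum>i<n. \<delta> i * \<beta> i)"
      by (simp add: D_def algebra_simps sum_subtractf sum_distrib_left)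
    thus ?thesis using orth by simp
  qed
  hence "D^2 \<le> E * (\<Sum>i<n. (1 - t * \<beta> i)^2)"
    unfolding E_def using Cauchy_Schwarz_ineq_sum[of \<delta> "\<lambda>i. 1 - t * \<beta> i" "{..<n}"] by simp
  also have "(\<Sum>i<n. (1 - t * \<beta> i)^2) = real n - 2 * t * B + t^2 * C"
    by (simp add: power2_diff sum.distrib sum_subtractf B_def C_def sum_distrib_left power_mult_distrib algebra_simps)
  also have "\<dots> = real n - B^2 / C" using \<open>C > 0\<close> by (simp add: t_def power2_eq_square field_simps)
  finally have D1: "D^2 \<le> E * (real n - B^2 / C)" .
  have "E \<ge> 0" by (simp add: E_def sum_nonneg)
  have "B^2 / C \<ge> 1" using BC \<open>C > 0\<close> by (simp add: field_simps)
  hence "E * (real n - B^2 / C) \<le> E * (real n - 1)" using \<open>E \<ge> 0\<close> by (intro mult_left_mono) auto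
  hence D2: "D^2 \<le> E * (real n - 1)" using D1 by linarith
  have AD: "A = real n * \<mu> + D"
    by (simp add: A_def D_def \<delta>_def sum_subtractf)
  have SE: "(\<Sum>i<n. (\<alpha> i)^2) = real n * \<mu>^2 + 2 * \<mu> * D + E"
  proof -
    have "(\<Sum>i<n. (\<alpha> i)^2) = (\<Sum>i<n. \<mu>^2 + 2 * \<mu> * \<delta> i + (\<delta> i)^2)"
      by (intro sum.cong) (auto simp: \<delta>_def power2_eq_square algebra_simps)
    thus ?thesis by (simp add: sum.distrib D_def E_def sum_distrib_left)
  qed
  have rn: "real (n - 1) = real n - 1" using n by simp
  have "real (n - 1) * (B^2 - C) > 0" using BC n by simp
  \<comment> \<open>After expanding about \<mu> every term containing \<mu> cancels; of the two
    differences left, the first is nonnegative and the second positive.\<close>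
  moreover have "real (n - 1) * ((\<Sum>i<n. (\<alpha> i)^2) + A^2 - 2 * \<mu> * A + B^2 - C) - (\<mu> - A)^2 * real n
     = (E * (real n - 1) - D^2) + real (n - 1) * (B^2 - C)"
    unfolding rn SE AD by (simp add: power2_eq_square algebra_simps)
  ultimately show ?thesis using D2 unfolding C_def by linarith
qed

lemma hyperbolic_linear_factors:
  assumes "hyperbolic p"
  obtains x :: "nat \<Rightarrow> real" where
    "\<And>z. poly (cpoly p) z = of_real (lead_coeff p) * (\<Prod>i<degree p. z - of_real (x i))"
    "\<And>z. poly (cpoly p) z \<noteq> 0 \<Longrightarrow> poly (pderiv (cpoly p)) z =
        poly (cpoly p) z * (\<Sum>i<degree p. 1 / (z - of_real (x i)))"
    "\<And>z. poly (cpoly p) z \<noteq> 0 \<Longrightarrow> poly (pderiv (pderiv (cpoly p))) z =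
        poly (cpoly p) z * ((\<Sum>i<degree p. 1 / (z - of_real (x i)))^2 - (\<Sum>i<degree p. (1 / (z - of_real (x i)))^2))"
proof -
  have deg: "degree (cpoly p) = degree p" by (simp add: degree_map_poly)
  have lc: "coeff (cpoly p) (degree p) = of_real (lead_coeff p)" by (simp add: coeff_map_poly)
  obtain r where r:
    "\<And>z. poly (cpoly p) z = of_real (lead_coeff p) * (\<Prod>i<degree p. z - r i)"
    "\<And>i. i < degree p \<Longrightarrow> poly (cpoly p) (r i) = 0"
    "\<And>z. poly (cpoly p) z \<noteq> 0 \<Longrightarrow> poly (pderiv (cpoly p)) z = poly (cpoly p) z * (\<Sum>i<degree p. 1 / (z - r i))"
    "\<And>z. poly (cpoly p) z \<noteq> 0 \<Longrightarrow> poly (pderiv (pderiv (cpoly p))) z =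
        poly (cpoly p) z * ((\<Sum>i<degree p. 1 / (z - r i))^2 - (\<Sum>i<degree p. (1 / (z - r i))^2))"
    by (rule complex_poly_derivs_at_nonroot[of "cpoly p", unfolded deg lc]) (rule that, assumption+)
  have re: "r i = of_real (Re (r i))" if "i < degree p" for i
    using r(2)[OF that] assms unfolding hyperbolic_def by (metis Reals_cases Re_complex_of_real)
  have "(\<Prod>i<degree p. z - r i) = (\<Prod>i<degree p. z - of_real (Re (r i)))" for z
    by (intro prod.cong refl) (subst re, auto)
  moreover have "(\<Sum>i<degree p. 1 / (z - r i)) = (\<Sum>i<degree p. 1 / (z - of_real (Re (r i))))" for z
    by (intro sum.cong refl) (subst re, auto)
  moreover have "(\<Sum>i<degree p. (1 / (z - r i))^2) = (\<Sum>i<degree p. (1 / (z - of_real (Re (r i))))^2)" for z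
    by (intro sum.cong refl) (subst re, auto)
  ultimately show thesis using that[of "\<lambda>i. Re (r i)"] r by simp
qed

text \<open>For b <= a^2 the symbol 1 + 2 a D + b D^2 has real zeros and this is classical; degree
  at most d leaves room up to b (d - 1) <= a^2 d. At a zero of the image in the upper half plane,
  division by p gives one complex equation in the terms 1/(w - x_i). Its imaginary part determines
  a, its real part gives \<open>b * W = 1\<close>, and \<open>weighted_mean_inequality\<close> then
  contradicts the hypothesis on a and b.\<close>

lemma hyperbolic_quadratic_operator:
  fixes p :: "real poly" and a b :: real
  assumes hyp: "hyperbolic p" and nz: "p \<noteq> 0" and deg: "degree p \<le> d"
    and b: "b \<ge> 0" and ab: "b * (real d - 1) \<le> a^2 * real d"
  shows "hyperbolic (p + smult (2 * a) (pderiv p) + smult b (pderiv (pderiv p)))"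
  unfolding hyperbolic_def
proof safe
  fix z :: complex
  let ?q = "p + smult (2 * a) (pderiv p) + smult b (pderiv (pderiv p))"
  assume root: "poly (cpoly ?q) z = 0"
  show "z \<in> \<real>"
  proof (rule ccontr)
    assume "z \<notin> \<real>"
    define w where "w = (if Im z > 0 then z else cnj z)"
    have Imw: "Im w > 0" using \<open>z \<notin> \<real>\<close> by (auto simp: w_def complex_is_Real_iff)
    have rootw: "poly (cpoly ?q) w = 0"
      using root by (simp add: w_def poly_cpoly_cnj)
    obtain x :: "nat \<Rightarrow> real" where
      "\<And>z. poly (cpoly p) z = of_real (lead_coeff p) * (\<Prod>i<degree p. z - of_real (x i))"
      and x': "\<And>z. poly (cpoly p) z \<noteq> 0 \<Longrightarrow> poly (pderiv (cpoly p)) z =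
        poly (cpoly p) z * (\<Sum>i<degree p. 1 / (z - of_real (x i)))"
      "\<And>z. poly (cpoly p) z \<noteq> 0 \<Longrightarrow> poly (pderiv (pderiv (cpoly p))) z =
        poly (cpoly p) z * ((\<Sum>i<degree p. 1 / (z - of_real (x i)))^2 - (\<Sum>i<degree p. (1 / (z - of_real (x i)))^2))"
      by (rule hyperbolic_linear_factors[OF hyp]) (rule that, assumption+)
    define n where "n = degree p"
    note x = x'[folded n_def]
    have pw: "poly (cpoly p) w \<noteq> 0"
    proof
      assume "poly (cpoly p) w = 0"
      hence "w \<in> \<real>" using hyp by (auto simp: hyperbolic_def)
      thus False using Imw by (simp add: complex_is_Real_iff)
    qed
    define u where "u i = 1 / (w - of_real (x i))" for i
    define \<alpha> where "\<alpha> i = Re (u i)" for i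
    define \<beta> where "\<beta> i = - Im (u i)" for i
    have \<beta>: "\<beta> i > 0" for i
    proof -
      have "\<beta> i = Im w / ((Re w - x i)^2 + (Im w)^2)"
        by (simp add: \<beta>_def u_def Im_divide)
      moreover have "(Re w - x i)^2 + (Im w)^2 > 0" using Imw by (intro add_nonneg_pos) auto
      ultimately show ?thesis using Imw by simp
    qed
    define A where "A = (\<Sum>i<n. \<alpha> i)"
    define B where "B = (\<Sum>i<n. \<beta> i)"
    define S where "S = (\<Sum>i<n. u i)"
    define T where "T = (\<Sum>i<n. (u i)^2)"
    have S: "S = Complex A (- B)"
      by (simp add: S_def A_def B_def \<alpha>_def \<beta>_def complex_eq_iff sum_negf)
    have T: "Re T = (\<Sum>i<n. (\<alpha> i)^2) - (\<Sum>i<n. (\<beta> i)^2)" "Im T = - 2 * (\<Sum>i<n. \<alpha> i * \<beta> i)"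
      by (simp_all add: T_def \<alpha>_def \<beta>_def power2_eq_square sum_subtractf sum_distrib_left sum_negf mult_ac)
    have "poly (cpoly ?q) w = poly (cpoly p) w * (1 + 2 * of_real a * S + of_real b * (S^2 - T))"
      using x(1)[OF pw, folded u_def, folded S_def] x(2)[OF pw, folded u_def, folded S_def T_def]
      by (simp only: cpoly_add cpoly_pderiv map_poly_smult poly_add poly_smult of_real_0 of_real_mult)
         (simp add: algebra_simps)
    hence eq: "1 + 2 * of_real a * S + of_real b * (S^2 - T) = 0" using rootw pw by simp
    from arg_cong[OF eq, of Re] have
      eq1: "1 + 2 * a * A + b * (A^2 - B^2 - (\<Sum>i<n. (\<alpha> i)^2) + (\<Sum>i<n. (\<beta> i)^2)) = 0"
      by (simp add: S T power2_eq_square algebra_simps)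
    from arg_cong[OF eq, of Im] have
      eq2: "- 2 * a * B + b * (- 2 * A * B + 2 * (\<Sum>i<n. \<alpha> i * \<beta> i)) = 0"
      by (simp add: S T power2_eq_square algebra_simps)
    show False
    proof (cases "n \<ge> 2")
      case True
      have "B > 0" unfolding B_def using True \<beta> by (intro sum_pos) (auto simp: lessThan_empty_iff)
      define \<mu> where "\<mu> = (\<Sum>i<n. \<alpha> i * \<beta> i) / B"
      have \<mu>: "(\<Sum>i<n. \<alpha> i * \<beta> i) = \<mu> * B" using \<open>B > 0\<close> by (simp add: \<mu>_def)
      have "2 * B * (b * (\<mu> - A) - a) = 0" using eq2 unfolding \<mu> by (simp add: algebra_simps)
      hence a: "a = b * (\<mu> - A)" using \<open>B > 0\<close> by simp
      define W where "W = (\<Sum>i<n. (\<alpha> i)^2) + A^2 - 2 * \<mu> * A + B^2 - (\<Sum>i<n. (\<beta> i)^2)"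
      have "b * W = 1" using eq1 unfolding a W_def by (simp add: power2_eq_square algebra_simps)
      hence "b > 0" using b by (cases "b = 0") auto
      have key: "(\<mu> - A)^2 * real n < real (n - 1) * W"
        unfolding W_def A_def B_def by (rule weighted_mean_inequality[OF True \<beta>]) (use \<mu> in \<open>simp add: B_def\<close>)
      have "n \<le> d" using deg by (simp add: n_def)
      \<comment> \<open>The bound assumed for \<open>d\<close> implies the one for the actual degree
        \<open>n\<close>, because 1 - 1/n increases with n.\<close>
      have dn: "a^2 * real n \<ge> b * (real n - 1)"
      proof -
        have "real d * (b * (real n - 1)) = b * (real n * (real d - 1)) - b * (real d - real n)"
          by (simp add: algebra_simps)
        also have "\<dots> \<le> real n * (b * (real d - 1))" using \<open>n \<le> d\<close> \<open>b > 0\<close> by (simp add: algebra_simps)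
        also have "\<dots> \<le> real n * (a^2 * real d)" using ab by (intro mult_left_mono) auto
        finally have "real d * (b * (real n - 1)) \<le> real d * (a^2 * real n)" by (simp add: mult_ac)
        thus ?thesis using True \<open>n \<le> d\<close> by simp
      qed
      have "a^2 * real n = b^2 * ((\<mu> - A)^2 * real n)" by (simp add: a power_mult_distrib)
      also have "\<dots> < b^2 * (real (n - 1) * W)" using key \<open>b > 0\<close> by (intro mult_strict_left_mono) auto
      also have "\<dots> = b * (real n - 1) * (b * W)" using True by (simp add: power2_eq_square mult_ac)
      also have "\<dots> = b * (real n - 1)" using \<open>b * W = 1\<close> by simp
      finally show False using dn by linarith
    next
      case False
      \<comment> \<open>With at most one root S^2 = T, so \<open>b\<close> drops out; n = 0 gives 1
        = 0 at once, and n = 1 forces a = 0 first.\<close>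
      then consider "n = 0" | "n = 1" by linarith
      thus False
      proof cases
        case 1
        thus False using eq1 by (simp add: A_def B_def)
      next
        case 2
        hence "a = 0" using eq2 \<beta>[of 0] by (simp add: A_def B_def)
        thus False using eq1 2 by (simp add: A_def B_def)
      qed
    qed
  qed
qed

section \<open>Factorization over the reals and the operators Q(D)\<close>

lemma poly_conjugate_pair_root: "poly (cpoly [:(cmod w)^2, - 2 * Re w, 1:]) w = 0"
  using cmod_power2[of w] by (simp add: map_poly_pCons complex_eq_iff power2_eq_square algebra_simps)

text \<open>Factorization over the reals as an induction principle. The quadratic factor is (X -
  w)(X - cnj w), parametrized by w so that hypotheses on zeros apply to it directly.\<close>

lemma real_poly_factor_induct [consumes 1, case_names const linear quadratic]:
  fixes Q :: "real poly"
  assumes "Q \<noteq> 0"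
    and const: "\<And>c. c \<noteq> 0 \<Longrightarrow> R [:c:]"
    and linear: "\<And>r Q. Q \<noteq> 0 \<Longrightarrow> R Q \<Longrightarrow> R ([:- r, 1:] * Q)"
    and quadratic: "\<And>w Q. Q \<noteq> 0 \<Longrightarrow> R Q \<Longrightarrow> R ([:(cmod w)^2, - 2 * Re w, 1:] * Q)"
  shows "R Q"
  using \<open>Q \<noteq> 0\<close>
proof (induction "degree Q" arbitrary: Q rule: less_induct)
  case less
  show ?case
  proof (cases "degree Q = 0")
    case True
    then obtain c where "Q = [:c:]" by (metis degree_eq_zeroE)
    thus ?thesis using const less.prems by auto
  next
    case False
    hence "\<not> constant (poly (cpoly Q))" by (simp add: constant_degree degree_map_poly)
    then obtain w where w: "poly (cpoly Q) w = 0" using fundamental_theorem_of_algebra by blast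
    \<comment> \<open>The minimal polynomial of w over the reals: a remainder of smaller degree
      vanishing at w must be zero.\<close>
    define D where "D = (if Im w = 0 then [:- Re w, 1:] else [:(cmod w)^2, - 2 * Re w, 1:])"
    have D0: "D \<noteq> 0" and degD: "degree D > 0" by (auto simp: D_def)
    have Dw: "poly (cpoly D) w = 0"
      unfolding D_def
      by (simp only: poly_conjugate_pair_root split: if_split) (simp add: map_poly_pCons complex_eq_iff)
    have "Q mod D = 0"
    proof (rule ccontr)
      assume nz: "Q mod D \<noteq> 0"
      have "Q = D * (Q div D) + Q mod D" by simp
      hence "cpoly Q = cpoly D * cpoly (Q div D) + cpoly (Q mod D)" by (metis cpoly_add cpoly_mult)
      hence m: "poly (cpoly (Q mod D)) w = 0" using w Dw by simp
      have dm: "degree (Q mod D) < degree D" using degree_mod_less'[OF D0 nz] .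
      hence "degree (Q mod D) < 2" by (auto simp: D_def split: if_splits)
      hence "Q mod D = [:coeff (Q mod D) 0, coeff (Q mod D) 1:]"
        by (intro poly_eqI) (auto simp: coeff_pCons coeff_eq_0 split: nat.split)
      then obtain a b where ab: "Q mod D = [:a, b:]" by blast
      have "a + b * Re w = 0" "b * Im w = 0"
        using m by (auto simp: ab map_poly_pCons complex_eq_iff algebra_simps)
      moreover have "b = 0" if "Im w = 0" using dm ab that by (auto simp: D_def split: if_splits)
      ultimately have "a = 0" "b = 0" by auto
      thus False using nz ab by simp
    qed
    then obtain S where S: "Q = D * S" by (metis dvdE mod_eq_0_iff_dvd)
    have "S \<noteq> 0" using S less.prems by auto
    moreover have "degree S < degree Q" using S \<open>S \<noteq> 0\<close> D0 degD by (simp add: degree_mult_eq)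
    ultimately have "R S" by (rule less.hyps[rotated])
    thus ?thesis using linear[OF \<open>S \<noteq> 0\<close>, of "Re w"] quadratic[OF \<open>S \<noteq> 0\<close>, of w] S
      by (auto simp: D_def split: if_splits)
  qed
qed

text \<open>This is Q(D) p with D = d/dX, evaluated by Horner's rule on the coefficients of
  Q.\<close>

definition diff_op :: "real poly \<Rightarrow> real poly \<Rightarrow> real poly" where
  "diff_op Q p = fold_coeffs (\<lambda>c q. smult c p + pderiv q) Q 0"

lemma diff_op_0 [simp]: "diff_op 0 p = 0"
  by (simp add: diff_op_def)

lemma diff_op_pCons [simp]: "diff_op (pCons c Q) p = smult c p + pderiv (diff_op Q p)"
  by (cases "c = 0 \<and> Q = 0") (auto simp: diff_op_def)

lemma diff_op_add: "diff_op (Q + S) p = diff_op Q p + diff_op S p"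
proof (induction Q arbitrary: S)
  case (pCons c Q)
  show ?case by (cases S) (simp add: pCons.IH smult_add_left pderiv_add)
qed simp

lemma diff_op_smult: "diff_op (smult c Q) p = smult c (diff_op Q p)"
  by (induction Q) (simp_all add: pderiv_smult smult_add_right)

lemma diff_op_quadratic_mult:
  "diff_op ([:a, b, c:] * Q) p =
     smult a (diff_op Q p) + smult b (pderiv (diff_op Q p)) + smult c (pderiv (pderiv (diff_op Q p)))"
  by (simp add: diff_op_add diff_op_smult pderiv_add pderiv_smult)

lemma degree_diff_op_le: "degree (diff_op Q p) \<le> degree p"
proof (induction Q)
  case (pCons c Q)
  have "degree (pderiv (diff_op Q p)) \<le> degree p" using pCons.IH by (simp add: degree_pderiv)
  thus ?case by (simp add: degree_add_le)
qed simp

text \<open>If Q has a nonzero constant term, Q(D) keeps the degree. So the induction over factors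
  never meets the zero polynomial, which is not hyperbolic.\<close>

lemma coeff_diff_op_degree: "coeff (diff_op Q p) (degree p) = coeff Q 0 * lead_coeff p"
proof (cases Q)
  case (pCons c S)
  have "coeff (diff_op S p) (Suc (degree p)) = 0"
    using degree_diff_op_le[of S p] by (intro coeff_eq_0) simp
  thus ?thesis by (simp add: pCons coeff_pderiv)
qed

text \<open>For \<open>coeff Q j = g j / fact j\<close> the value is
  \<open>(d choose k) * g (d - k)\<close>, a Jensen polynomial read backwards.\<close>

lemma coeff_diff_op_monom:
  "coeff (diff_op Q (monom 1 d)) k = (if k \<le> d then coeff Q (d - k) * fact d / fact k else 0)"
proof (induction Q arbitrary: k)
  case (pCons c Q)
  consider "k < d" | "k = d" | "k > d" by linarith
  thus ?case
  proof cases
    case 1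
    hence "d - k = Suc (d - Suc k)" by simp
    thus ?thesis using 1 by (simp add: coeff_pderiv pCons.IH)
  qed (simp_all add: coeff_pderiv pCons.IH)
qed simp

lemma hyperbolic_smult: "hyperbolic p \<Longrightarrow> c \<noteq> 0 \<Longrightarrow> hyperbolic (smult c p)"
  by (simp add: hyperbolic_def map_poly_smult)

text \<open>One factor of Q is applied at a time, each scaled to constant term 1. A pair w, cnj w
  then has a = -Re w / |w|^2 and b = 1 / |w|^2, and b (d - 1) <= a^2 d becomes the condition on w. A
  real zero r has a = -1/(2r) and b = 0.\<close>

lemma hyperbolic_diff_op:
  assumes "coeff Q 0 \<noteq> 0"
    and "\<And>w. poly (cpoly Q) w = 0 \<Longrightarrow> (real d - 1) * (cmod w)^2 \<le> real d * (Re w)^2"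
    and p: "hyperbolic p" "p \<noteq> 0" "degree p \<le> d"
  shows "hyperbolic (diff_op Q p)"
proof -
  have "Q \<noteq> 0" using assms(1) by auto
  thus ?thesis using assms(1,2)
  proof (induction Q rule: real_poly_factor_induct)
    case (const c)
    thus ?case using p by (simp add: hyperbolic_smult)
  next
    case (linear r Q)
    let ?X = "diff_op Q p"
    have r: "r \<noteq> 0" and Q0: "coeff Q 0 \<noteq> 0" using linear.prems(1) by auto
    have "hyperbolic ?X" 
      using Q0 by (intro linear.IH linear.prems(2)) (simp_all only: cpoly_mult poly_mult mult_zero_right not_False_eq_True)
    moreover have "?X \<noteq> 0" using coeff_diff_op_degree[of Q p] Q0 p(2) by auto
    moreover have "degree ?X \<le> d" using degree_diff_op_le[of Q p] p(3) by simp
    ultimately have "hyperbolic (?X + smult (2 * (- 1 / (2 * r))) (pderiv ?X) + smult 0 (pderiv (pderiv ?X)))"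
      by (rule hyperbolic_quadratic_operator) simp_all
    hence "hyperbolic (smult (- r) (?X + smult (2 * (- 1 / (2 * r))) (pderiv ?X) + smult 0 (pderiv (pderiv ?X))))"
      using r by (intro hyperbolic_smult) auto
    also have "smult (- r) (?X + smult (2 * (- 1 / (2 * r))) (pderiv ?X) + smult 0 (pderiv (pderiv ?X)))
        = diff_op ([:- r, 1, 0:] * Q) p"
      using r by (subst diff_op_quadratic_mult) (simp add: smult_add_right smult_diff_right)
    finally show ?case by simp
  next
    case (quadratic w Q)
    let ?X = "diff_op Q p"
    have w: "cmod w \<noteq> 0" and Q0: "coeff Q 0 \<noteq> 0" using quadratic.prems(1) by auto
    have "poly (cpoly ([:(cmod w)^2, - 2 * Re w, 1:] * Q)) w = 0"
      by (simp only: cpoly_mult poly_mult poly_conjugate_pair_root mult_zero_left)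
    hence cond: "(real d - 1) * (cmod w)^2 \<le> real d * (Re w)^2" by (rule quadratic.prems(2))
    have "hyperbolic ?X"
      using Q0 by (intro quadratic.IH quadratic.prems(2)) (simp_all only: cpoly_mult poly_mult mult_zero_right not_False_eq_True)
    moreover have "?X \<noteq> 0" using coeff_diff_op_degree[of Q p] Q0 p(2) by auto
    moreover have "degree ?X \<le> d" using degree_diff_op_le[of Q p] p(3) by simp
    moreover have "1 / (cmod w)^2 * (real d - 1) \<le> (- Re w / (cmod w)^2)^2 * real d"
    proof -
      have "1 / (cmod w)^2 * (real d - 1) = (real d - 1) * (cmod w)^2 / ((cmod w)^2)^2"
        using w by (simp add: power2_eq_square)
      also have "\<dots> \<le> real d * (Re w)^2 / ((cmod w)^2)^2" using cond by (intro divide_right_mono) auto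
      finally show ?thesis by (simp add: power_divide mult_ac)
    qed
    ultimately have "hyperbolic (?X + smult (2 * (- Re w / (cmod w)^2)) (pderiv ?X) + smult (1 / (cmod w)^2) (pderiv (pderiv ?X)))"
      by (intro hyperbolic_quadratic_operator) simp_all
    hence "hyperbolic (smult ((cmod w)^2) (?X + smult (2 * (- Re w / (cmod w)^2)) (pderiv ?X) + smult (1 / (cmod w)^2) (pderiv (pderiv ?X))))"
      using w by (intro hyperbolic_smult) auto
    also have "smult ((cmod w)^2) (?X + smult (2 * (- Re w / (cmod w)^2)) (pderiv ?X) + smult (1 / (cmod w)^2) (pderiv (pderiv ?X)))
        = diff_op ([:(cmod w)^2, - 2 * Re w, 1:] * Q) p"
      using w by (subst diff_op_quadratic_mult) (simp add: smult_add_right smult_diff_right)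
    finally show ?case .
  qed
qed

text \<open>If p(w) is nonzero, then conjugating sum 1/(w - r_i) = 0 exhibits w as the mean of the
  roots with weights proportional to 1/|w - r_i|^2.\<close>

lemma Gauss_Lucas:
  fixes p :: "complex poly"
  assumes K: "convex K" and roots: "\<And>w. poly p w = 0 \<Longrightarrow> w \<in> K"
    and nz: "pderiv p \<noteq> 0" and w: "poly (pderiv p) w = 0"
  shows "w \<in> K"
proof (cases "poly p w = 0")
  case False
  obtain r where r: "\<And>i. i < degree p \<Longrightarrow> poly p (r i) = 0"
    "\<And>z. poly p z \<noteq> 0 \<Longrightarrow> poly (pderiv p) z = poly p z * (\<Sum>i<degree p. 1 / (z - r i))"
    by (rule complex_poly_derivs_at_nonroot[of p]) (rule that, assumption+)
  define n where "n = degree p"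
  have n: "n > 0" using nz by (auto simp: n_def pderiv_eq_0_iff)
  have ne: "w \<noteq> r i" if "i < n" for i using r(1) that False by (auto simp: n_def)
  define c where "c i = 1 / (cmod (w - r i))^2" for i
  have c: "c i > 0" if "i < n" for i using ne[OF that] by (simp add: c_def)
  define C where "C = (\<Sum>i<n. c i)"
  have C: "C > 0" unfolding C_def using c n by (intro sum_pos) (auto simp: lessThan_empty_iff)
  have "(\<Sum>i<n. 1 / (w - r i)) = 0" using r(2)[OF False] w False by (simp add: n_def)
  hence "cnj (\<Sum>i<n. 1 / (w - r i)) = 0" by simp
  also have "cnj (\<Sum>i<n. 1 / (w - r i)) = (\<Sum>i<n. of_real (c i) * (w - r i))"
    unfolding cnj_sum
  proof (intro sum.cong refl)
    fix i assume "i \<in> {..<n}"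
    hence "w - r i \<noteq> 0" using ne by simp
    moreover have "cnj (1 / u) = of_real (1 / (cmod u)^2) * u" if "u \<noteq> 0" for u
      using that complex_norm_square[of u] by (simp add: field_simps)
    ultimately show "cnj (1 / (w - r i)) = of_real (c i) * (w - r i)" unfolding c_def by blast
  qed
  finally have "of_real C * w = (\<Sum>i<n. of_real (c i) * r i)"
    by (simp add: C_def algebra_simps sum_subtractf sum_distrib_left)
  hence "w = (\<Sum>i<n. of_real (c i) * r i) / of_real C" using C by (simp add: field_simps)
  also have "\<dots> = (\<Sum>i<n. (c i / C) *\<^sub>R r i)"
    by (simp add: sum_divide_distrib scaleR_conv_of_real)
  also have "\<dots> \<in> K"
    by (rule convex_sum[OF _ K])
       (use c C r(1) roots in \<open>auto simp: n_def sum_divide_distrib[symmetric] C_def intro: less_imp_le\<close>)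
  finally show ?thesis .
qed (use roots in auto)

section \<open>Polynomials with all zeros in a parabolic region\<close>

text \<open>
  If \<open>\<bar>Re z\<bar> \<le> 1/2\<close> then \<open>w = z\<^sup>2\<close> satisfies \<open>\<bar>w\<bar> + Re w = 2 (Re z)\<^sup>2 \<le> 1/2\<close>; the second condition comes from
  the absence of zeros with \<open>\<bar>w\<bar> \<le> 9/4\<close>. The region is convex, so Gauss--Lucas keeps the zeros of all
  derivatives in it.
\<close>
definition xi_region :: "complex set" where
  "xi_region = {w. cmod w + Re w \<le> 1 / 2 \<and> Re w \<le> - 7 / 4}"

lemma convex_xi_region: "convex xi_region"
proof (rule convexI)
  fix x y :: complex and u v :: real
  assume x: "x \<in> xi_region" and y: "y \<in> xi_region" and uv: "0 \<le> u" "0 \<le> v" "u + v = 1"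
  have "cmod (u *\<^sub>R x + v *\<^sub>R y) \<le> u * cmod x + v * cmod y"
    using uv norm_triangle_ineq[of "u *\<^sub>R x" "v *\<^sub>R y"] by simp
  moreover have "u * (cmod x + Re x) + v * (cmod y + Re y) \<le> u * (1 / 2) + v * (1 / 2)"
    "u * Re x + v * Re y \<le> u * (- 7 / 4) + v * (- 7 / 4)"
    using x y uv by (intro add_mono mult_left_mono; simp add: xi_region_def)+
  moreover have "u * (1 / 2) + v * (1 / 2) = 1 / 2" "u * (- 7 / 4) + v * (- 7 / 4) = - 7 / 4"
    using uv by linarith+
  ultimately show "u *\<^sub>R x + v *\<^sub>R y \<in> xi_region"
    by (simp add: xi_region_def distrib_left)
qed

text \<open>Here |w| >= 7/4, so 1/2 <= (2/7) |w| and -Re w >= |w| - 1/2 >= (5/7) |w|. The last bound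
  factors (Im w)^2 as (|w| - Re w)(|w| + Re w).\<close>

lemma xi_region_bounds:
  assumes "w \<in> xi_region"
  shows "w \<noteq> 0" "5 / 7 * cmod w \<le> - Re w" "(Im w)^2 \<le> cmod w"
proof -
  have w: "cmod w + Re w \<le> 1 / 2" "Re w \<le> - 7 / 4" using assms by (auto simp: xi_region_def)
  show "w \<noteq> 0" using w by auto
  have "cmod w \<ge> 7 / 4" using w abs_Re_le_cmod[of w] by linarith
  thus "5 / 7 * cmod w \<le> - Re w" using w by linarith
  have "(Im w)^2 = (cmod w - Re w) * (cmod w + Re w)" using cmod_power2[of w] by (simp add: power2_eq_square algebra_simps)
  also have "\<dots> \<le> (2 * cmod w) * (1 / 2)"
    using w abs_Re_le_cmod[of w] by (intro mult_mono) linarith+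
  finally show "(Im w)^2 \<le> cmod w" by simp
qed

text \<open>The constant 5/7 exceeds 1/sqrt 2, so the region lies in the sector |Im w| <= |Re w|,
  where 1/w^2 has nonnegative real part.\<close>

lemma xi_region_inverse:
  assumes "w \<in> xi_region"
  shows "5 / (7 * cmod w) \<le> Re (- 1 / w)" "Re ((1 / w)^2) \<ge> 0"
proof -
  note w = xi_region_bounds[OF assms]
  have c: "cmod w > 0" using w(1) by simp
  have "5 / (7 * cmod w) = (5 / 7 * cmod w) / (cmod w)^2" using c by (simp add: power2_eq_square)
  also have "\<dots> \<le> - Re w / (cmod w)^2" using w(2) by (intro divide_right_mono) auto
  also have "\<dots> = Re (- 1 / w)" by (simp add: Re_divide cmod_power2)
  finally show "5 / (7 * cmod w) \<le> Re (- 1 / w)" .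
  have "(5 / 7 * cmod w)^2 \<le> (- Re w)^2" using w(2) by (intro power_mono) auto
  hence "25 * (Im w)^2 \<le> 24 * (Re w)^2" using cmod_power2[of w] by (simp add: power_mult_distrib power2_eq_square)
  hence "(Im w)^2 \<le> (Re w)^2" using zero_le_power2[of "Re w"] by linarith
  moreover have "Re (1 / w) = Re w / (cmod w)^2" "Im (1 / w) = - Im w / (cmod w)^2"
    by (simp_all add: Re_divide Im_divide cmod_power2)
  ultimately show "Re ((1 / w)^2) \<ge> 0"
    unfolding Re_power2 by (simp add: power_divide divide_right_mono)
qed

text \<open>
  The zeros satisfy \<open>Re (-1/w) > 0\<close> and \<open>Re (1/w\<^sup>2) \<ge> 0\<close>, while \<open>\<Sum> -1/w\<close> and \<open>\<Sum> 1/w\<^sup>2\<close> are read off from the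
  first three coefficients. So each single zero is bounded below by a ratio of coefficients.
\<close>
lemma root_sums_xi_region:
  fixes p :: "real poly"
  assumes roots: "\<And>w. poly (cpoly p) w = 0 \<Longrightarrow> w \<in> xi_region" and p0: "coeff p 0 > 0"
  shows "degree p > 0 \<Longrightarrow> coeff p 1 > 0"
    and "poly (cpoly p) w = 0 \<Longrightarrow> 5 / (7 * cmod w) \<le> coeff p 1 / coeff p 0"
    and "2 * coeff p 2 * coeff p 0 \<le> (coeff p 1)^2"
proof -
  define n where "n = degree p"
  have deg: "degree (cpoly p) = n" by (simp add: degree_map_poly n_def)
  have v: "poly (cpoly p) 0 = of_real (coeff p 0)" by (simp add: poly_0_coeff_0 coeff_map_poly)
  have v1: "poly (pderiv (cpoly p)) 0 = of_real (coeff p 1)"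
    by (simp add: poly_0_coeff_0 coeff_map_poly coeff_pderiv)
  have v2: "poly (pderiv (pderiv (cpoly p))) 0 = of_real (2 * coeff p 2)"
    by (simp add: poly_0_coeff_0 coeff_map_poly coeff_pderiv numeral_2_eq_2)
  have nz: "poly (cpoly p) 0 \<noteq> 0" using p0 v by simp
  obtain r where
    "\<And>z. poly (cpoly p) z = lead_coeff (cpoly p) * (\<Prod>i<degree (cpoly p). z - r i)"
    "\<And>i. i < degree (cpoly p) \<Longrightarrow> poly (cpoly p) (r i) = 0"
    "\<And>z. poly (cpoly p) z \<noteq> 0 \<Longrightarrow> poly (pderiv (cpoly p)) z = poly (cpoly p) z * (\<Sum>i<degree (cpoly p). 1 / (z - r i))"
    "\<And>z. poly (cpoly p) z \<noteq> 0 \<Longrightarrow> poly (pderiv (pderiv (cpoly p))) z =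
        poly (cpoly p) z * ((\<Sum>i<degree (cpoly p). 1 / (z - r i))^2 - (\<Sum>i<degree (cpoly p). (1 / (z - r i))^2))"
    by (rule complex_poly_derivs_at_nonroot[of "cpoly p"]) (rule that, assumption+)
  note r = this[unfolded deg]
  define S where "S = (\<Sum>i<n. - 1 / r i)"
  define T where "T = (\<Sum>i<n. (1 / r i)^2)"
  have rK: "r i \<in> xi_region" if "i < n" for i using roots r(2) that by blast
  have pos: "Re (- 1 / r i) > 0" if "i < n" for i
    using xi_region_inverse(1)[OF rK[OF that]] xi_region_bounds(1)[OF rK[OF that]]
    by (smt (verit) divide_pos_pos zero_less_norm_iff)
  have S1: "of_real (coeff p 1) = of_real (coeff p 0) * S" using r(3)[OF nz] v v1 by (simp add: S_def)
  have S2: "of_real (2 * coeff p 2) = of_real (coeff p 0) * (S^2 - T)"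
    using r(4)[OF nz] v v2 by (simp add: S_def T_def)
  have S: "S = of_real (coeff p 1 / coeff p 0)" using S1 p0 by (simp add: field_simps)
  hence ReS: "coeff p 1 / coeff p 0 = (\<Sum>i<n. Re (- 1 / r i))"
    unfolding S_def by (metis Re_complex_of_real Re_sum)
  show "coeff p 1 > 0" if "degree p > 0"
  proof -
    have "(\<Sum>i<n. Re (- 1 / r i)) > 0" using that pos by (intro sum_pos) (auto simp: n_def lessThan_empty_iff)
    hence "coeff p 1 / coeff p 0 > 0" by (simp only: ReS)
    thus ?thesis using p0 by (simp add: zero_less_divide_iff)
  qed
  show "5 / (7 * cmod w) \<le> coeff p 1 / coeff p 0" if "poly (cpoly p) w = 0"
  proof -
    obtain i where i: "i < n" "w = r i" 
    proof -
      have "coeff (cpoly p) n \<noteq> 0" using p0 by (auto simp: coeff_map_poly n_def)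
      thus ?thesis using r(1)[of w] that \<open>poly (cpoly p) w = 0\<close> by auto
    qed
    have "5 / (7 * cmod w) \<le> Re (- 1 / r i)" using xi_region_inverse(1)[OF rK[OF i(1)]] i by simp
    also have "\<dots> \<le> (\<Sum>i<n. Re (- 1 / r i))"
      using i pos by (intro member_le_sum) (auto intro: less_imp_le)
    finally show ?thesis using ReS by simp
  qed
  \<comment> \<open>At 0 the formula for the second derivative reads
    \<open>2 * coeff p 2 / coeff p 0 = S^2 - T\<close>; discarding \<open>T\<close> leaves the
    Turan-type inequality.\<close>
  have "Re T \<ge> 0" unfolding T_def Re_sum using rK xi_region_inverse(2) by (intro sum_nonneg) auto
  moreover from arg_cong[OF S2, of Re] have "2 * coeff p 2 = coeff p 0 * ((coeff p 1 / coeff p 0)^2 - Re T)"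
    unfolding S by (simp add: power2_eq_square flip: of_real_divide)
  hence "2 * coeff p 2 * coeff p 0 = (coeff p 1 / coeff p 0 * coeff p 0)^2 - (coeff p 0)^2 * Re T"
    by (simp only: power_mult_distrib) (simp add: power2_eq_square algebra_simps)
  hence "2 * coeff p 2 * coeff p 0 = (coeff p 1)^2 - (coeff p 0)^2 * Re T" using p0 by simp
  ultimately show "2 * coeff p 2 * coeff p 0 \<le> (coeff p 1)^2" by simp
qed

section \<open>Taylor coefficients of polynomials with zeros in \<open>xi_region\<close>\<close>

lemma coeff_higher_pderiv_fact:
  fixes P :: "real poly"
  shows "coeff ((pderiv ^^ n) P) j = fact (n + j) * coeff P (n + j) / fact j"
proof (induction n arbitrary: j)
  case (Suc n)
  have "coeff ((pderiv ^^ Suc n) P) j = (1 + real j) * coeff ((pderiv ^^ n) P) (Suc j)"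
    by (simp add: coeff_pderiv)
  also have "\<dots> = (1 + real j) * (fact (n + Suc j) * coeff P (n + Suc j) / fact (Suc j))"
    by (simp only: Suc.IH)
  also have "\<dots> = fact (Suc n + j) * coeff P (Suc n + j) / fact j"
    unfolding fact_Suc[of j] by (simp del: fact_Suc)
  finally show ?case .
qed simp

locale xi_region_poly =
  fixes P :: "real poly"
  assumes roots: "poly (cpoly P) w = 0 \<Longrightarrow> w \<in> xi_region" and coeff0: "coeff P 0 > 0"
begin

text \<open>The \<open>j\<close>-th derivative of \<open>P\<close> at 0, so differentiating
  \<open>P\<close> shifts the sequence.\<close>

definition tay :: "nat \<Rightarrow> real" where "tay j = fact j * coeff P j"

lemma coeff_higher_pderiv_tay: "coeff ((pderiv ^^ n) P) j = tay (n + j) / fact j"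
  by (simp add: coeff_higher_pderiv_fact tay_def)

lemma roots_higher_pderiv:
  assumes "n \<le> degree P" "poly (cpoly ((pderiv ^^ n) P)) w = 0"
  shows "w \<in> xi_region"
  using assms
proof (induction n arbitrary: w)
  case (Suc n)
  have "degree ((pderiv ^^ n) P) \<noteq> 0" using Suc.prems by (simp add: degree_higher_pderiv)
  hence nz: "pderiv (cpoly ((pderiv ^^ n) P)) \<noteq> 0" by (simp add: pderiv_eq_0_iff degree_map_poly)
  show ?case
    by (rule Gauss_Lucas[OF convex_xi_region _ nz]) (use Suc in \<open>auto simp: cpoly_pderiv\<close>)
qed (use roots in simp)

text \<open>Positivity propagates from coefficient 0: the logarithmic derivative at 0 of each
  derivative is a sum of positive numbers Re (-1/w).\<close>

lemma tay_pos: "n \<le> degree P \<Longrightarrow> tay n > 0"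
proof (induction n)
  case (Suc n)
  have "coeff ((pderiv ^^ n) P) 1 > 0"
    by (rule root_sums_xi_region(1)[OF roots_higher_pderiv[of n]])
       (use Suc in \<open>simp_all add: coeff_higher_pderiv_tay degree_higher_pderiv\<close>)
  thus ?case by (simp add: coeff_higher_pderiv_tay)
qed (simp add: tay_def coeff0)

lemma tay_eq_0: "n > degree P \<Longrightarrow> tay n = 0"
  by (simp add: tay_def coeff_eq_0)

lemma tay_nonneg: "tay n \<ge> 0"
  using tay_pos[of n] tay_eq_0[of n] by (cases "n \<le> degree P") auto

lemma tay_log_concave: "tay (n + 2) * tay n \<le> (tay (n + 1))^2"
proof (cases "n \<le> degree P")
  case True
  have "2 * coeff ((pderiv ^^ n) P) 2 * coeff ((pderiv ^^ n) P) 0 \<le> (coeff ((pderiv ^^ n) P) 1)^2"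
    by (rule root_sums_xi_region(3)[OF roots_higher_pderiv[of n]])
       (use True tay_pos[of n] in \<open>simp_all add: coeff_higher_pderiv_tay\<close>)
  thus ?thesis by (simp add: coeff_higher_pderiv_tay)
qed (simp add: tay_eq_0)

text \<open>Chaining of \<open>tay_log_concave\<close>. The cross-multiplied form covers the zero
  coefficients beyond the degree and passes to limits.\<close>

lemma tay_ratio_decreasing: "n \<le> m \<Longrightarrow> tay (m + 1) * tay n \<le> tay m * tay (n + 1)"
proof (induction m rule: dec_induct)
  case (step m)
  show ?case
  proof (cases "m \<le> degree P")
    case True
    have "tay m * (tay (m + 2) * tay n) = (tay (m + 2) * tay m) * tay n" by simp
    also have "\<dots> \<le> (tay (m + 1))^2 * tay n" by (intro mult_right_mono tay_log_concave tay_nonneg)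
    also have "\<dots> = tay (m + 1) * (tay (m + 1) * tay n)" by (simp add: power2_eq_square)
    also have "\<dots> \<le> tay (m + 1) * (tay m * tay (n + 1))" by (intro mult_left_mono step.IH tay_nonneg)
    finally have "tay m * (tay (m + 2) * tay n) \<le> tay m * (tay (m + 1) * tay (n + 1))" by (simp add: mult_ac)
    thus ?thesis using tay_pos[OF True] by simp
  next
    case False
    thus ?thesis using tay_nonneg by (simp add: tay_eq_0)
  qed
qed simp

text \<open>Every zero satisfies 5/(7 |w|) <= \<open>tay (n + 1) / tay n\<close>, so the hypothesis
  yields d <= |w|. Together with (Im w)^2 <= |w| this gives d (Im w)^2 <= |w|^2, which rearranges to
  the condition of \<open>hyperbolic_diff_op\<close>.\<close>

lemma hyperbolic_diff_op_higher_pderiv: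
  assumes n: "tay n > 0" and d: "real d * tay (n + 1) \<le> 5 / 7 * tay n"
  shows "hyperbolic (diff_op ((pderiv ^^ n) P) (monom 1 d))"
proof (rule hyperbolic_diff_op)
  have le: "n \<le> degree P" using n tay_eq_0[of n] by (cases "n \<le> degree P") auto
  show "coeff ((pderiv ^^ n) P) 0 \<noteq> 0" using n by (simp add: coeff_higher_pderiv_tay)
  show "(real d - 1) * (cmod w)^2 \<le> real d * (Re w)^2" if w: "poly (cpoly ((pderiv ^^ n) P)) w = 0" for w
  proof -
    have wK: "w \<in> xi_region" by (rule roots_higher_pderiv[OF le w])
    have c: "cmod w > 0" using xi_region_bounds(1)[OF wK] by simp
    have "5 / (7 * cmod w) \<le> coeff ((pderiv ^^ n) P) 1 / coeff ((pderiv ^^ n) P) 0"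
      by (rule root_sums_xi_region(2)[OF roots_higher_pderiv[OF le]])
         (use n w in \<open>simp_all add: coeff_higher_pderiv_tay\<close>)
    hence "5 * tay n \<le> 7 * cmod w * tay (n + 1)" using n c by (simp add: coeff_higher_pderiv_tay field_simps)
    hence "5 * tay n * real d \<le> 7 * cmod w * (real d * tay (n + 1))"
      using mult_right_mono[of "5 * tay n" "7 * cmod w * tay (n + 1)" "real d"] by (simp add: mult_ac)
    also have "\<dots> \<le> 7 * cmod w * (5 / 7 * tay n)" using d by (intro mult_left_mono) auto
    finally have "5 * tay n * real d \<le> 5 * tay n * cmod w" by (simp add: mult_ac)
    hence dw: "real d \<le> cmod w" using n by simp
    have "real d * (Im w)^2 \<le> cmod w * cmod w"
      using dw xi_region_bounds(3)[OF wK] by (intro mult_mono) auto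
    moreover have "(real d - 1) * (cmod w)^2 = real d * (Re w)^2 + real d * (Im w)^2 - (cmod w)^2"
      unfolding cmod_power2 by (simp add: algebra_simps)
    ultimately show ?thesis by (simp add: power2_eq_square)
  qed
  show "hyperbolic (monom 1 d)"
    by (auto simp: hyperbolic_def map_poly_monom poly_monom)
qed (simp_all add: degree_monom_eq)

end

section \<open>Passage to the limit for hyperbolic polynomials\<close>

lemma hyperbolic_limit:
  fixes T :: "nat \<Rightarrow> real poly"
  assumes hyp: "\<And>N. N \<ge> M \<Longrightarrow> hyperbolic (T N)" and deg: "\<And>N. degree (T N) \<le> d" "degree p \<le> d"
    and lim: "\<And>k. (\<lambda>N. coeff (T N) k) \<longlonglongrightarrow> coeff p k" and lead: "coeff p d \<noteq> 0"
  shows "hyperbolic p"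
  unfolding hyperbolic_def
proof safe
  fix z assume z: "poly (cpoly p) z = 0"
  have ev: "poly (cpoly q) z = (\<Sum>k\<le>d. of_real (coeff q k) * z ^ k)" if "degree q \<le> d" for q
  proof -
    have "poly (cpoly q) z = (\<Sum>k\<le>degree q. of_real (coeff q k) * z ^ k)"
      by (simp add: poly_altdef degree_map_poly coeff_map_poly)
    also have "\<dots> = (\<Sum>k\<le>d. of_real (coeff q k) * z ^ k)"
      using that by (intro sum.mono_neutral_left) (auto simp: coeff_eq_0)
    finally show ?thesis .
  qed
  have lim1: "(\<lambda>N. cmod (poly (cpoly (T N)) z)) \<longlonglongrightarrow> cmod (poly (cpoly p) z)"
    unfolding ev[OF deg(1)] ev[OF deg(2)] by (intro tendsto_intros lim)
  have lim2: "(\<lambda>N. \<bar>coeff (T N) d\<bar> * \<bar>Im z\<bar> ^ d) \<longlonglongrightarrow> \<bar>coeff p d\<bar> * \<bar>Im z\<bar> ^ d"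
    by (intro tendsto_intros lim)
  \<comment> \<open>This takes the place of Hurwitz's theorem: for real zeros each factor has
    modulus at least |Im z|, and such a lower bound survives the limit.\<close>
  have "\<bar>coeff (T N) d\<bar> * \<bar>Im z\<bar> ^ d \<le> cmod (poly (cpoly (T N)) z)" if N: "N \<ge> M" for N
  proof (cases "coeff (T N) d = 0")
    case False
    hence dN: "degree (T N) = d" using deg(1)[of N] by (metis le_antisym le_degree)
    obtain x :: "nat \<Rightarrow> real" where
      x: "poly (cpoly (T N)) z = of_real (lead_coeff (T N)) * (\<Prod>i<degree (T N). z - of_real (x i))"
      by (rule hyperbolic_linear_factors[OF hyp[OF N]]) (rule that, assumption+)
    have "\<bar>Im z\<bar> ^ d = (\<Prod>i<d. \<bar>Im z\<bar>)" by simp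
    also have "\<dots> \<le> (\<Prod>i<d. cmod (z - of_real (x i)))"
      by (intro prod_mono) (auto intro: abs_Im_le_cmod[of "z - of_real _", simplified])
    finally have "\<bar>coeff (T N) d\<bar> * \<bar>Im z\<bar> ^ d \<le> \<bar>coeff (T N) d\<bar> * (\<Prod>i<d. cmod (z - of_real (x i)))"
      by (intro mult_left_mono) auto
    also have "\<dots> = cmod (poly (cpoly (T N)) z)" unfolding x dN by (simp add: norm_mult prod_norm)
    finally show ?thesis .
  qed auto
  hence "eventually (\<lambda>N. \<bar>coeff (T N) d\<bar> * \<bar>Im z\<bar> ^ d \<le> cmod (poly (cpoly (T N)) z)) sequentially"
    unfolding eventually_sequentially by blast
  hence "\<bar>coeff p d\<bar> * \<bar>Im z\<bar> ^ d \<le> 0"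
    using tendsto_le[OF _ lim1 lim2] z by simp
  hence "\<bar>Im z\<bar> ^ d \<le> 0" using lead by (simp add: mult_le_0_iff)
  hence "Im z = 0" by (metis abs_ge_zero abs_le_zero_iff dual_order.antisym power_eq_0_iff zero_le_power)
  thus "z \<in> \<real>" by (simp add: complex_is_Real_iff)
qed

text \<open>Coefficientwise convergence is enough, because each inequality passed to the limit
  involves finitely many coefficients.\<close>

locale xi_region_limit =
  fixes P :: "nat \<Rightarrow> real poly" and g :: "nat \<Rightarrow> real"
  assumes P_roots: "poly (cpoly (P N)) w = 0 \<Longrightarrow> w \<in> xi_region"
    and P_coeff0: "coeff (P N) 0 > 0"
    and P_lim: "(\<lambda>N. coeff (P N) j) \<longlonglongrightarrow> g j / fact j"
begin

sublocale P: xi_region_poly "P N" for N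
  by unfold_locales (fact P_roots P_coeff0)+

lemma tay_lim: "(\<lambda>N. P.tay N j) \<longlonglongrightarrow> g j"
  using tendsto_mult[OF tendsto_const[of "fact j :: real"] P_lim[of j]] by (simp add: P.tay_def)

lemma g_nonneg: "g j \<ge> 0"
  by (rule LIMSEQ_le_const[OF tay_lim]) (use P.tay_nonneg in blast)

lemma g_ratio_decreasing: "n \<le> m \<Longrightarrow> g (m + 1) * g n \<le> g m * g (n + 1)"
  by (rule LIMSEQ_le[OF tendsto_mult[OF tay_lim tay_lim] tendsto_mult[OF tay_lim tay_lim]])
     (use P.tay_ratio_decreasing in blast)

text \<open>The strict hypothesis holds for \<open>P N\<close> with \<open>N\<close> large. The
  limit is taken for the reversed polynomial \<open>p\<close>, whose top coefficient
  \<open>g n\<close> is positive as \<open>hyperbolic_limit\<close> demands; reversing inverts the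
  nonzero zeros.\<close>

lemma hyperbolic_jensen:
  assumes n: "g n > 0" and d: "real d * g (n + 1) < 5 / 7 * g n"
  shows "hyperbolic (\<Sum>j\<le>d. monom (of_nat (d choose j) * g (n + j)) j)"
proof -
  define p where "p = (\<Sum>j\<le>d. monom (of_nat (d choose j) * g (n + (d - j))) j)"
  have cp: "coeff p k = (if k \<le> d then of_nat (d choose k) * g (n + (d - k)) else 0)" for k
    by (simp add: p_def coeff_sum if_distrib sum.delta cong: if_cong)
  have degp: "degree p = d" using n by (intro antisym degree_le le_degree) (auto simp: cp)
  define T where "T N = diff_op ((pderiv ^^ n) (P N)) (monom 1 d)" for N
  have cT: "coeff (T N) k = (if k \<le> d then of_nat (d choose k) * P.tay N (n + (d - k)) else 0)" for N k
    by (auto simp: T_def coeff_diff_op_monom P.coeff_higher_pderiv_tay binomial_fact mult.commute)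
  have "eventually (\<lambda>N. P.tay N n > 0) sequentially"
    by (rule order_tendstoD(1)[OF tay_lim n])
  moreover have "(\<lambda>N. 5 / 7 * P.tay N n - real d * P.tay N (n + 1)) \<longlonglongrightarrow> 5 / 7 * g n - real d * g (n + 1)"
    by (intro tendsto_intros tay_lim)
  hence "eventually (\<lambda>N. 5 / 7 * P.tay N n - real d * P.tay N (n + 1) > 0) sequentially"
    by (rule order_tendstoD(1)) (use d in simp)
  ultimately have "eventually (\<lambda>N. hyperbolic (T N)) sequentially"
    by eventually_elim (auto simp: T_def intro!: P.hyperbolic_diff_op_higher_pderiv)
  then obtain M where M: "\<And>N. N \<ge> M \<Longrightarrow> hyperbolic (T N)" unfolding eventually_sequentially by blast
  have "hyperbolic p"
  proof (rule hyperbolic_limit[where T = T and M = M and d = d])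
    show "(\<lambda>N. coeff (T N) k) \<longlonglongrightarrow> coeff p k" for k
      unfolding cT cp by (auto intro!: tendsto_intros tay_lim)
    show "degree (T N) \<le> d" for N by (intro degree_le) (auto simp: cT)
  qed (use M n degp in \<open>auto simp: cp\<close>)
  have "(\<Sum>j\<le>d. monom (of_nat (d choose j) * g (n + j)) j) = reflect_poly p"
    by (intro poly_eqI)
       (auto simp: coeff_reflect_poly degp cp coeff_sum binomial_symmetric[symmetric] if_distrib sum.delta cong: if_cong)
  moreover have "hyperbolic (reflect_poly p)"
    unfolding hyperbolic_def
  proof safe
    fix z assume z: "poly (cpoly (reflect_poly p)) z = 0"
    have r: "cpoly (reflect_poly p) = reflect_poly (cpoly p)"
      by (intro poly_eqI) (simp add: coeff_map_poly coeff_reflect_poly degree_map_poly)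
    show "z \<in> \<real>"
    proof (cases "z = 0")
      case False
      hence "poly (cpoly p) (inverse z) = 0" using z by (simp add: r poly_reflect_poly_nz)
      hence "inverse z \<in> \<real>" using \<open>hyperbolic p\<close> by (auto simp: hyperbolic_def)
      thus ?thesis by (metis Reals_inverse inverse_inverse_eq)
    qed auto
  qed
  ultimately show ?thesis by simp
qed

end

section \<open>Entire functions as limits of polynomials\<close>

text \<open>The factor 1 - w/a keeps the value at 0, so normalizations at 0 persist through
  divisions.\<close>

lemma holomorphic_divide_root:
  assumes hol: "g holomorphic_on UNIV" and a: "g a = 0" "a \<noteq> 0"
  obtains h where "h holomorphic_on UNIV" "\<And>w. g w = (1 - w / a) * h w"
proof -
  define k where "k = (\<lambda>z. if z = a then deriv g a else (g z - g a) / (z - a))"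
  have k: "k holomorphic_on UNIV" unfolding k_def by (rule pole_lemma_open[OF hol open_UNIV])
  show thesis
  proof (rule that[of "\<lambda>z. - a * k z"])
    show "(\<lambda>z. - a * k z) holomorphic_on UNIV" using k by (intro holomorphic_intros)
    show "g w = (1 - w / a) * (- a * k w)" for w
      using a by (cases "w = a") (auto simp: k_def field_simps)
  qed
qed

text \<open>On the circle |w - r_i| >= 3R - R >= 2 |r_i|, while p(0) = 1 says that the leading
  coefficient times the product of the |r_i| is 1 in modulus.\<close>

lemma norm_poly_ge_power2:
  fixes p :: "complex poly"
  assumes p0: "poly p 0 = 1" and roots: "\<And>w. poly p w = 0 \<Longrightarrow> cmod w \<le> R" and w: "cmod w = 3 * R"
  shows "2 ^ degree p \<le> cmod (poly p w)"
proof -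
  obtain r where r: "\<And>z. poly p z = lead_coeff p * (\<Prod>i<degree p. z - r i)"
    "\<And>i. i < degree p \<Longrightarrow> poly p (r i) = 0"
    by (rule complex_poly_derivs_at_nonroot[of p]) (rule that, assumption+)
  have factor: "2 * cmod (r i) \<le> cmod (w - r i)" if "i < degree p" for i
    using roots[OF r(2)[OF that]] w norm_triangle_ineq2[of w "r i"] by linarith
  have "2 ^ degree p * 1 = 2 ^ degree p * cmod (poly p 0)" using p0 by simp
  also have "\<dots> = cmod (lead_coeff p) * (\<Prod>i<degree p. 2 * cmod (r i))"
    by (subst r(1)) (simp add: norm_mult prod_norm[symmetric] prod.distrib)
  also have "\<dots> \<le> cmod (lead_coeff p) * (\<Prod>i<degree p. cmod (w - r i))"
    using factor by (intro mult_left_mono prod_mono) auto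
  also have "\<dots> = cmod (poly p w)" by (subst r(1)) (simp add: norm_mult prod_norm)
  finally show ?thesis by simp
qed

text \<open>Off the finitely many zeros of \<open>P\<close> the symmetry is a division; continuity
  extends it. It makes non-real zeros of the quotient come in conjugate pairs, which keeps the
  divisors real.\<close>

lemma entire_cnj_symmetric_quotient:
  assumes F: "\<And>w. F (cnj w) = cnj (F w)" and P: "P \<noteq> (0 :: real poly)"
    and g: "g holomorphic_on UNIV" and Fg: "\<And>w. F w = poly (cpoly P) w * g w"
  shows "g (cnj a) = cnj (g a)"
proof -
  have cont: "continuous_on UNIV g" using g by (rule holomorphic_on_imp_continuous_on)
  define \<phi> where "\<phi> w = g (cnj w) - cnj (g w)" for w
  have "continuous_on UNIV \<phi>" unfolding \<phi>_def[abs_def]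
    by (intro continuous_intros continuous_on_compose2[OF cont]) auto
  hence "isCont \<phi> a" by (simp add: continuous_on_eq_continuous_at)
  hence "(\<phi> \<longlongrightarrow> \<phi> a) (at a)" by (simp add: isCont_def)
  moreover have "finite {w. poly (cpoly P) w = 0}" using P by (intro poly_roots_finite) (simp add: map_poly_eq_0_iff)
  hence "eventually (\<lambda>w. w \<notin> {w. poly (cpoly P) w = 0}) (at a)"
    using islimpt_finite islimpt_iff_eventually by blast
  hence "eventually (\<lambda>w. \<phi> w = 0) (at a)"
  proof eventually_elim
    case (elim w)
    have "poly (cpoly P) (cnj w) * g (cnj w) = cnj (poly (cpoly P) w * g w)" using F Fg by metis
    thus ?case using elim by (simp add: poly_cpoly_cnj \<phi>_def)
  qed
  hence "(\<phi> \<longlongrightarrow> 0) (at a)" by (rule tendsto_eventually)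
  ultimately have "\<phi> a = 0" by (rule tendsto_unique[rotated]) simp
  thus ?thesis by (simp add: \<phi>_def)
qed

lemma norm_entire_quotient_le:
  assumes R: "R > 0" and P0: "poly (cpoly P) 0 = 1" and roots: "\<And>w. poly (cpoly P) w = 0 \<Longrightarrow> cmod w \<le> R"
    and g: "g holomorphic_on UNIV" and Fg: "\<And>w. F w = poly (cpoly P) w * g w"
    and bound: "\<And>w. cmod w \<le> 3 * R \<Longrightarrow> cmod (F w) \<le> B" and w: "cmod w \<le> 3 * R"
  shows "cmod (g w) \<le> B / 2 ^ degree P"
proof (rule maximum_modulus_frontier[where S = "cball 0 (3 * R)" and f = g and \<xi> = w])
  show "g holomorphic_on interior (cball 0 (3 * R))" by (rule holomorphic_on_subset[OF g]) auto
  show "continuous_on (closure (cball 0 (3 * R))) g"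
    by (rule holomorphic_on_imp_continuous_on, rule holomorphic_on_subset[OF g]) auto
  show "cmod (g z) \<le> B / 2 ^ degree P" if "z \<in> frontier (cball 0 (3 * R))" for z
  proof -
    have z: "cmod z = 3 * R" using that R by (simp add: frontier_cball)
    have "2 ^ degree P \<le> cmod (poly (cpoly P) z)"
      using norm_poly_ge_power2[OF P0 roots z] by (simp add: degree_map_poly)
    hence "2 ^ degree P * cmod (g z) \<le> cmod (poly (cpoly P) z) * cmod (g z)" by (intro mult_right_mono) auto
    also have "\<dots> = cmod (F z)" by (simp add: Fg norm_mult)
    also have "\<dots> \<le> B" using bound z by simp
    finally show ?thesis by (simp add: field_simps)
  qed
qed (use w in auto)

text \<open>
  A divisor of maximal degree leaves a quotient without zeros in the disc; degrees are bounded because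
  on the circle of radius \<open>3R\<close> each linear factor has modulus at least 2.
\<close>
lemma exists_polynomial_divisor:
  assumes hol: "F holomorphic_on UNIV" and F0: "F 0 = 1" and sym: "\<And>w. F (cnj w) = cnj (F w)"
    and R: "R > 0" and bound: "\<And>w. cmod w \<le> 3 * R \<Longrightarrow> cmod (F w) \<le> B"
  obtains P :: "real poly" and g where "coeff P 0 = 1" "\<And>w. poly (cpoly P) w = 0 \<Longrightarrow> cmod w \<le> R"
    "g holomorphic_on UNIV" "\<And>w. F w = poly (cpoly P) w * g w" "\<And>w. cmod w \<le> R \<Longrightarrow> g w \<noteq> 0"
proof -
  define good where "good P \<longleftrightarrow> coeff P 0 = 1 \<and> (\<forall>w. poly (cpoly P) w = 0 \<longrightarrow> cmod w \<le> R) \<and>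
    (\<exists>g. g holomorphic_on UNIV \<and> (\<forall>w. F w = poly (cpoly P) w * g w))" for P :: "real poly"
  have P0: "poly (cpoly P) 0 = 1" if "coeff P 0 = 1" for P
    using that by (simp add: poly_0_coeff_0 coeff_map_poly)
  obtain b :: nat where b: "B < 2 ^ b" using real_arch_pow[of 2 B] by auto
  have "good 1" using hol unfolding good_def by (intro conjI exI[of _ F]) auto
  moreover have "\<forall>P. good P \<longrightarrow> degree P < b"
  proof safe
    fix P assume "good P"
    then obtain g where g: "coeff P 0 = 1" "\<And>w. poly (cpoly P) w = 0 \<Longrightarrow> cmod w \<le> R"
      "g holomorphic_on UNIV" "\<And>w. F w = poly (cpoly P) w * g w" unfolding good_def by blast
    have "g 0 = 1" using g(4)[of 0] P0[OF g(1)] F0 by simp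
    moreover have "cmod (g 0) \<le> B / 2 ^ degree P"
      by (rule norm_entire_quotient_le[OF R P0[OF g(1)] g(2,3,4) bound]) (use R in auto)
    ultimately have "(2::real) ^ degree P \<le> B" by (simp add: field_simps)
    hence "(2::real) ^ degree P < 2 ^ b" using b by linarith
    thus "degree P < b" by simp
  qed
  ultimately obtain P where P: "good P" "\<And>Q. good Q \<Longrightarrow> degree Q \<le> degree P"
    using ex_has_greatest_nat[of good 1 degree b] by blast
  then obtain g where g: "coeff P 0 = 1" "\<And>w. poly (cpoly P) w = 0 \<Longrightarrow> cmod w \<le> R"
    "g holomorphic_on UNIV" "\<And>w. F w = poly (cpoly P) w * g w" unfolding good_def by blast
  have Pnz: "P \<noteq> 0" using g(1) by auto
  have g0: "g 0 = 1" using g(4)[of 0] P0[OF g(1)] F0 by simp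
  \<comment> \<open>Any further real divisor of \<open>g\<close> could be multiplied into
    \<open>P\<close>, against the choice of \<open>P\<close>.\<close>
  have maximal: False if D: "coeff D 0 = 1" "degree D > 0" "\<And>w. poly (cpoly D) w = 0 \<Longrightarrow> cmod w \<le> R"
    and h: "h holomorphic_on UNIV" "\<And>w. g w = poly (cpoly D) w * h w" for D :: "real poly" and h
  proof -
    have "good (P * D)"
      unfolding good_def
    proof (intro conjI exI[of _ h] allI impI)
      show "coeff (P * D) 0 = 1" using D(1) g(1) by (simp add: coeff_mult_0)
      show "cmod w \<le> R" if "poly (cpoly (P * D)) w = 0" for w
        using that D(3) g(2) by (auto simp: cpoly_mult)
    qed (use h g(4) in \<open>simp_all add: cpoly_mult\<close>)
    hence "degree (P * D) \<le> degree P" by (rule P(2))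
    moreover have "D \<noteq> 0" using D(1) by auto
    ultimately show False using D(2) Pnz by (simp add: degree_mult_eq)
  qed
  have "g w \<noteq> 0" if w: "cmod w \<le> R" for w
  proof
    assume gw: "g w = 0"
    have w0: "w \<noteq> 0" using g0 gw by auto
    obtain h where h: "h holomorphic_on UNIV" "\<And>z. g z = (1 - z / w) * h z"
      by (rule holomorphic_divide_root[OF g(3) gw w0]) (rule that, assumption+)
    show False
    proof (cases "Im w = 0")
      case True
      hence wr: "w = of_real (Re w)" by (simp add: complex_eq_iff)
      define D where "D = [:1, - 1 / Re w:]"
      have Re: "Re w \<noteq> 0" using w0 True by (auto simp: complex_eq_iff)
      have D: "poly (cpoly D) z = 1 - z / w" for z
      proof -
        have "poly (cpoly D) z = 1 - z / of_real (Re w)" by (simp add: D_def map_poly_pCons)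
        thus ?thesis by (simp only: wr[symmetric])
      qed
      show False
      proof (rule maximal[of D h])
        show "cmod z \<le> R" if "poly (cpoly D) z = 0" for z
          using that w w0 by (simp add: D)
      qed (use h D Re in \<open>auto simp: D_def\<close>)
    next
      case False
      hence ne: "cnj w \<noteq> w" by (simp add: complex_eq_iff)
      \<comment> \<open>The conjugate zero is still present in \<open>h\<close>, since the factor 1
        - z/w does not vanish there.\<close>
      have "g (cnj w) = 0" using entire_cnj_symmetric_quotient[OF sym Pnz g(3,4), of w] gw by simp
      hence "h (cnj w) = 0" using h(2)[of "cnj w"] ne w0 by simp
      then obtain k where k: "k holomorphic_on UNIV" "\<And>z. h z = (1 - z / cnj w) * k z"
        by (rule holomorphic_divide_root[OF h(1)]) (use w0 in auto)
      define D where "D = [:1, - 2 * Re w / (cmod w)^2, 1 / (cmod w)^2:]"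
      have nw: "of_real ((cmod w)^2) = w * cnj w" by (rule complex_norm_square)
      have D: "poly (cpoly D) z = (1 - z / w) * (1 - z / cnj w)" for z
      proof -
        have "poly (cpoly D) z = 1 - z * (w + cnj w) / (w * cnj w) + z^2 / (w * cnj w)"
          by (simp add: D_def map_poly_pCons nw[symmetric] complex_add_cnj power2_eq_square)
             (simp add: algebra_simps add_divide_distrib diff_divide_distrib)
        also have "\<dots> = (1 - z / w) * (1 - z / cnj w)"
          using w0 by (simp add: field_simps power2_eq_square)
        finally show ?thesis .
      qed
      show False
      proof (rule maximal[of D k])
        show "cmod z \<le> R" if "poly (cpoly D) z = 0" for z
          using that w w0 by (auto simp: D)
      qed (use h k D w0 in \<open>auto simp: D_def mult_ac\<close>)
    qed
  qed
  thus thesis using that g by blast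
qed

text \<open>Borel--Caratheodory, by applying the Schwarz lemma to \<open>L / (2A - L)\<close>.\<close>
lemma Borel_Caratheodory:
  assumes hol: "L holomorphic_on ball 0 R" and L0: "L 0 = 0" and R: "R > 1" and A: "A > 0"
    and Re: "\<And>w. cmod w < R \<Longrightarrow> Re (L w) < A" and w: "cmod w \<le> 1"
  shows "cmod (L w) \<le> 2 * A / (R - 1)"
proof -
  define \<phi> where "\<phi> z = L (of_real R * z) / (2 * of_real A - L (of_real R * z))" for z
  have in_ball: "of_real R * z \<in> ball 0 R" if "cmod z < 1" for z
    using that R by (simp add: norm_mult)
  have den: "2 * of_real A - L (of_real R * z) \<noteq> 0" if "cmod z < 1" for z
  proof
    assume "2 * of_real A - L (of_real R * z) = 0"
    from arg_cong[OF this, of Re] have "2 * A = Re (L (of_real R * z))" by simp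
    thus False using Re[of "of_real R * z"] in_ball[OF that] A by simp
  qed
  \<comment> \<open>Points with real part below A are closer to 0 than to 2A, so \<phi> maps into
    the unit disc.\<close>
  have lt: "cmod x < cmod (2 * of_real A - x)" if "Re x < A" for x
  proof -
    have "(cmod (2 * of_real A - x))^2 - (cmod x)^2 = 4 * A * (A - Re x)"
      unfolding cmod_power2 by (simp add: power2_eq_square algebra_simps)
    hence "(cmod x)^2 < (cmod (2 * of_real A - x))^2" using that A by (smt (verit) mult_pos_pos)
    thus ?thesis by (rule power_less_imp_less_base) simp
  qed
  have "cmod (\<phi> z) \<le> cmod z" if "cmod z < 1" for z
  proof (rule Schwarz_Lemma(1)[of \<phi>])
    have "(\<lambda>z. L (of_real R * z)) holomorphic_on ball 0 1"
      by (rule holomorphic_on_compose_gen[OF _ hol, unfolded o_def])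
         (use in_ball in \<open>auto intro!: holomorphic_intros\<close>)
    thus "\<phi> holomorphic_on ball 0 1"
      unfolding \<phi>_def[abs_def] by (intro holomorphic_intros) (use den in auto)
    show "cmod (\<phi> z) < 1" if "cmod z < 1" for z
      using lt[OF Re, of "of_real R * z"] in_ball[OF that] den[OF that]
      by (simp add: \<phi>_def norm_divide)
  qed (use that L0 in \<open>auto simp: \<phi>_def\<close>)
  moreover define z where "z = w / of_real R"
  have z: "cmod z < 1" "cmod z \<le> 1 / R" using w R by (auto simp: z_def norm_divide field_simps)
  ultimately have \<phi>z: "cmod (\<phi> z) \<le> 1 / R" by (meson order_trans)
  have zw: "of_real R * z = w" using R by (simp add: z_def)
  have "L w = \<phi> z * (2 * of_real A - L w)" using den[OF z(1)] by (simp add: \<phi>_def zw)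
  hence "cmod (L w) = cmod (\<phi> z) * cmod (2 * of_real A - L w)" by (metis norm_mult)
  also have "\<dots> \<le> 1 / R * (2 * A + cmod (L w))"
  proof (intro mult_mono \<phi>z)
    have "cmod (2 * of_real A - L w) \<le> cmod (2 * of_real A) + cmod (L w)" by (rule norm_triangle_ineq4)
    thus "cmod (2 * of_real A - L w) \<le> 2 * A + cmod (L w)" using A by (simp add: norm_mult)
  qed (use R in auto)
  finally have "R * cmod (L w) \<le> 2 * A + cmod (L w)" using R by (simp add: field_simps)
  thus ?thesis using R by (simp add: field_simps)
qed

lemma higher_deriv_poly: "(deriv ^^ n) (poly p) = poly ((pderiv ^^ n) p)" for p :: "complex poly"
proof (induction n)
  case (Suc n)
  have "deriv (poly q) = poly (pderiv q)" for q :: "complex poly"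
    by (rule ext, rule DERIV_imp_deriv) (rule poly_DERIV)
  thus ?case by (simp add: Suc.IH)
qed simp

text \<open>
  The quotient \<open>g = F/P\<close> is \<open>exp L\<close> with \<open>Re L\<close> of growth \<open>o(R)\<close> on the disc of radius \<open>R\<close>, so \<open>L\<close> tends to 0 on the
  unit disc. This replaces the Hadamard factorization in genus 0.
\<close>
theorem entire_polynomial_approximation:
  assumes hol: "F holomorphic_on UNIV" and F0: "F 0 = 1" and sym: "\<And>w. F (cnj w) = cnj (F w)"
    and bound: "\<And>R w. R \<ge> 1 \<Longrightarrow> cmod w \<le> R \<Longrightarrow> cmod (F w) \<le> exp (M R)"
    and growth: "(\<lambda>N. M (3 * real N) / real N) \<longlonglongrightarrow> 0"
  obtains P :: "nat \<Rightarrow> real poly" where "\<And>N. coeff (P N) 0 = 1"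
    "\<And>N w. poly (cpoly (P N)) w = 0 \<Longrightarrow> F w = 0"
    "\<And>j. (\<lambda>N. of_real (coeff (P N) j)) \<longlonglongrightarrow> (deriv ^^ j) F 0 / fact j"
proof -
  \<comment> \<open>The radius N + 2 exceeds 1 for every N, as \<open>Borel_Caratheodory\<close>
    requires.\<close>
  have "\<exists>P g. coeff P 0 = 1 \<and> (\<forall>w. poly (cpoly P) w = 0 \<longrightarrow> cmod w \<le> real N + 2) \<and>
    g holomorphic_on UNIV \<and> (\<forall>w. F w = poly (cpoly P) w * g w) \<and> (\<forall>w. cmod w \<le> real N + 2 \<longrightarrow> g w \<noteq> 0)" for N
  proof -
    have pos: "real N + 2 > 0" by simp
    have b: "cmod (F w) \<le> exp (M (3 * (real N + 2)))" if "cmod w \<le> 3 * (real N + 2)" for w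
      using bound[OF _ that] by simp
    obtain P :: "real poly" and g where "coeff P 0 = 1" "\<And>w. poly (cpoly P) w = 0 \<Longrightarrow> cmod w \<le> real N + 2"
      "g holomorphic_on UNIV" "\<And>w. F w = poly (cpoly P) w * g w" "\<And>w. cmod w \<le> real N + 2 \<Longrightarrow> g w \<noteq> 0"
      by (rule exists_polynomial_divisor[OF hol F0 sym pos b]) (assumption, rule that, assumption+)
    thus ?thesis by blast
  qed
  then obtain P g where P: "\<And>N. coeff (P N) 0 = 1" "\<And>N w. poly (cpoly (P N)) w = 0 \<Longrightarrow> cmod w \<le> real N + 2"
    and g: "\<And>N. g N holomorphic_on UNIV" "\<And>N w. F w = poly (cpoly (P N)) w * g N w"
      "\<And>N w. cmod w \<le> real N + 2 \<Longrightarrow> g N w \<noteq> 0"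
    by metis
  define C where "C = exp (M 1)"
  \<comment> \<open>The Borel-Caratheodory bound 2A/(R - 1) for R = N + 2 and A = |M (3R)| + 1; the
    added 1 makes A positive and the bound on Re L strict.\<close>
  define \<epsilon> where "\<epsilon> N = 2 * (\<bar>M (3 * real (N + 2))\<bar> + 1) / (real (N + 2) - 1)" for N
  have P0: "poly (cpoly (P N)) 0 = 1" for N using P(1) by (simp add: poly_0_coeff_0 coeff_map_poly)
  have close: "cmod (F w - poly (cpoly (P N)) w) \<le> C * (3 / 2 * \<epsilon> N)"
    if small: "\<epsilon> N \<le> 1 / 2" and w: "cmod w \<le> 1" for N w
  proof -
    define R where "R = real N + 2"
    define A where "A = \<bar>M (3 * R)\<bar> + 1"
    have g0: "g N 0 = 1" using g(2)[of 0 N] P0 F0 by simp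
    have holg: "g N holomorphic_on ball 0 R" by (rule holomorphic_on_subset[OF g(1)]) auto
    obtain L0 where L0: "L0 holomorphic_on ball 0 R" "\<And>z. z \<in> ball 0 R \<Longrightarrow> g N z = exp (L0 z)"
      by (rule simply_connected_imp_holomorphic_log[OF holg])
         (use g(3)[of _ N] in \<open>auto simp: R_def intro!: convex_imp_simply_connected open_imp_locally_path_connected\<close>)
    define L where "L z = L0 z - L0 0" for z
    have "exp (L0 0) = 1" using L0(2)[of 0] g0 by (simp add: R_def)
    hence L: "g N z = exp (L z)" if "cmod z < R" for z
      using L0(2)[of z] that by (simp add: L_def exp_diff)
    have "Re (L z) < A" if z: "cmod z < R" for z
    proof -
      have "cmod (g N z) \<le> exp (M (3 * R)) / 2 ^ degree (P N)"
        by (rule norm_entire_quotient_le[OF _ P0 P(2)[folded R_def] g(1,2)])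
           (use z bound in \<open>auto simp: R_def\<close>)
      also have "\<dots> \<le> exp (M (3 * R)) / 1" by (intro divide_left_mono) auto
      also have "\<dots> < exp A" by (simp add: A_def)
      finally show ?thesis by (simp add: L[OF z])
    qed
    hence Lw: "cmod (L w) \<le> \<epsilon> N"
      using Borel_Caratheodory[of L R A w] L0(1) w
      by (simp add: L_def[abs_def] R_def A_def \<epsilon>_def holomorphic_on_diff add.commute)
    have wR: "cmod w < R" using w by (simp add: R_def)
    have "F w * exp (- L w) = poly (cpoly (P N)) w * (exp (L w) * exp (- L w))"
      using g(2)[of w N] L[OF wR] by (simp add: mult.assoc)
    hence "poly (cpoly (P N)) w = F w * exp (- L w)" by (simp flip: exp_add)
    hence "cmod (F w - poly (cpoly (P N)) w) = cmod (F w * (exp (- L w) - 1))"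
      by (simp add: norm_minus_commute algebra_simps)
    also have "\<dots> = cmod (F w) * cmod (exp (- L w) - 1)" by (simp add: norm_mult)
    also have "\<dots> \<le> C * (3 / 2 * \<epsilon> N)"
    proof (intro mult_mono)
      show "cmod (F w) \<le> C" unfolding C_def using bound[of 1] w by simp
      have "cmod (exp (- L w) - 1) \<le> 3 / 2 * cmod (- L w)"
        by (rule norm_exp_bounds(2)) (use Lw small in simp)
      thus "cmod (exp (- L w) - 1) \<le> 3 / 2 * \<epsilon> N" using Lw by simp
    qed (auto simp: C_def)
    finally show ?thesis .
  qed
  have \<epsilon>0: "\<epsilon> \<longlonglongrightarrow> 0"
  proof -
    have 1: "(\<lambda>N. \<bar>M (3 * real (N + 2)) / real (N + 2)\<bar>) \<longlonglongrightarrow> 0"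
      using tendsto_rabs[OF LIMSEQ_ignore_initial_segment[OF growth, of 2]] by simp
    have 2: "(\<lambda>N. real (N + 2) / (real (N + 2) - 1)) \<longlonglongrightarrow> 1" by real_asymp
    have 3: "(\<lambda>N. 1 / (real (N + 2) - 1)) \<longlonglongrightarrow> 0" by real_asymp
    have "(\<lambda>N. 2 * (\<bar>M (3 * real (N + 2)) / real (N + 2)\<bar> * (real (N + 2) / (real (N + 2) - 1)) + 1 / (real (N + 2) - 1)))
        \<longlonglongrightarrow> 2 * (0 * 1 + 0)"
      by (intro tendsto_intros 1 2 3)
    also have "(\<lambda>N. 2 * (\<bar>M (3 * real (N + 2)) / real (N + 2)\<bar> * (real (N + 2) / (real (N + 2) - 1)) + 1 / (real (N + 2) - 1))) = \<epsilon>"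
    proof (rule ext)
      have "2 * (\<bar>m / x\<bar> * (x / (x - 1)) + 1 / (x - 1)) = 2 * (\<bar>m\<bar> + 1) / (x - 1)" if "x > 1" for m x :: real
        using that by (simp add: abs_divide add_divide_distrib)
      from this[of "real (N + 2)" "M (3 * real (N + 2))" for N]
      show "2 * (\<bar>M (3 * real (N + 2)) / real (N + 2)\<bar> * (real (N + 2) / (real (N + 2) - 1)) + 1 / (real (N + 2) - 1)) = \<epsilon> N" for N
        unfolding \<epsilon>_def by simp
    qed
    finally show ?thesis by simp
  qed
  show thesis
  proof (rule that[of P])
    show "F w = 0" if "poly (cpoly (P N)) w = 0" for N w using that g(2)[of w N] by simp
    show "(\<lambda>N. of_real (coeff (P N) j)) \<longlonglongrightarrow> (deriv ^^ j) F 0 / fact j" for j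
    proof (cases "j = 0")
      case True
      thus ?thesis using P(1) F0 by simp
    next
      case False
      have ev: "eventually (\<lambda>N. \<epsilon> N \<le> 1 / 2) sequentially"
        using order_tendstoD(2)[OF \<epsilon>0, of "1/2"] by (auto elim: eventually_mono)
      \<comment> \<open>\<open>Cauchy_higher_deriv_bound\<close> asks for values in an open ball;
        the term \<open>1 / real (Suc N)\<close> makes the estimate strict and tends to 0.\<close>
      have "eventually (\<lambda>N. cmod (of_real (coeff (P N) j) - (deriv ^^ j) F 0 / fact j) \<le> C * (3 / 2 * \<epsilon> N) + 1 / real (Suc N)) sequentially"
        using ev
      proof eventually_elim
        case (elim N)
        define D where "D w = F w - poly (cpoly (P N)) w" for w
        have holD: "D holomorphic_on UNIV" unfolding D_def[abs_def] using hol by (intro holomorphic_intros)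
        have "cmod ((deriv ^^ j) D 0) \<le> fact j * (C * (3 / 2 * \<epsilon> N) + 1 / real (Suc N)) / 1 ^ j"
        proof (rule Cauchy_higher_deriv_bound[where y = 0])
          show "D holomorphic_on ball 0 1" by (rule holomorphic_on_subset[OF holD]) auto
          show "continuous_on (cball 0 1) D"
            by (rule holomorphic_on_imp_continuous_on, rule holomorphic_on_subset[OF holD]) auto
          show "D w \<in> ball 0 (C * (3 / 2 * \<epsilon> N) + 1 / real (Suc N))" if "w \<in> ball 0 1" for w
          proof -
            have "cmod (D w) \<le> C * (3 / 2 * \<epsilon> N)" using close[OF elim, of w] that by (simp add: D_def)
            moreover have "1 / real (Suc N) > 0" by simp
            ultimately show ?thesis by (simp only: mem_ball dist_0_norm)
          qed
        qed (use False in auto)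
        moreover have "(deriv ^^ j) D 0 = (deriv ^^ j) F 0 - (deriv ^^ j) (poly (cpoly (P N))) 0"
          unfolding D_def[abs_def] by (rule higher_deriv_diff[OF hol]) (auto intro!: holomorphic_intros)
        moreover have "(deriv ^^ j) (poly (cpoly (P N))) 0 = fact j * of_real (coeff (P N) j)"
          by (simp add: higher_deriv_poly poly_0_coeff_0 coeff_higher_pderiv coeff_map_poly pochhammer_fact)
        ultimately have "cmod ((deriv ^^ j) F 0 - fact j * of_real (coeff (P N) j)) \<le> fact j * (C * (3 / 2 * \<epsilon> N) + 1 / real (Suc N))"
          by simp
        moreover have "(deriv ^^ j) F 0 - fact j * of_real (coeff (P N) j) = fact j * ((deriv ^^ j) F 0 / fact j - of_real (coeff (P N) j))"
          by (simp add: right_diff_distrib)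
        ultimately show ?case by (simp add: norm_mult norm_minus_commute)
      qed
      moreover have lim: "(\<lambda>N. C * (3 / 2 * \<epsilon> N) + 1 / real (Suc N)) \<longlonglongrightarrow> C * (3 / 2 * 0) + 0"
        by (intro tendsto_intros \<epsilon>0 LIMSEQ_Suc[OF lim_1_over_n])
      have lim0: "(\<lambda>N. C * (3 / 2 * \<epsilon> N) + 1 / real (Suc N)) \<longlonglongrightarrow> 0" using lim by simp
      ultimately have "(\<lambda>N. of_real (coeff (P N) j) - (deriv ^^ j) F 0 / fact j) \<longlonglongrightarrow> 0"
        by (intro Lim_null_comparison[OF _ lim0])
      thus ?thesis by (rule LIM_zero_cancel)
    qed
  qed (use P in auto)
qed

section \<open>The theta transformation\<close>

lemma sum_cis_multiples:
  fixes d :: int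
  assumes l: "l > 0"
  shows "(\<Sum>v<l. cis (2 * pi * real v * real_of_int d / real l)) = (if int l dvd d then of_nat l else 0)"
proof (cases "int l dvd d")
  case True
  then obtain e where e: "d = int l * e" by blast
  have "cis (2 * pi * real v * real_of_int d / real l) = 1" for v
  proof -
    have "2 * pi * real v * real_of_int d / real l = 2 * pi * (real v * of_int e)" using l by (simp add: e)
    thus ?thesis by (simp only:) (rule cis_multiple_2pi, auto)
  qed
  thus ?thesis using True by simp
next
  case False
  define x where "x = cis (2 * pi * real_of_int d / real l)"
  have pow: "cis (2 * pi * real v * real_of_int d / real l) = x ^ v" for v
    by (simp add: x_def Complex.DeMoivre mult_ac)
  have "x ^ l = cis (2 * pi * of_int d)" using l by (simp add: x_def Complex.DeMoivre)
  hence xl: "x ^ l = 1" by simp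
  have "x \<noteq> 1"
  proof
    assume "x = 1"
    hence "cos (2 * pi * real_of_int d / real l) = 1" by (simp add: x_def complex_eq_iff)
    then obtain n :: int where "2 * pi * real_of_int d / real l = of_int n * 2 * pi" unfolding cos_one_2pi_int by blast
    hence "real_of_int d = real_of_int n * real l" using l by (simp add: field_simps)
    hence "d = n * int l" by (metis of_int_eq_iff of_int_mult of_int_of_nat_eq)
    thus False using False by simp
  qed
  thus ?thesis using False geometric_sum[of x l] xl by (simp add: pow)
qed

lemma two_cos_power_eq_sum_cis:
  "(2 * of_real (cos y)) ^ (2 * m) = (\<Sum>j\<le>2 * m. of_nat (2 * m choose j) * cis (2 * y * (real j - real m)))"
proof -
  have "2 * of_real (cos y) = cis y + cis (- y)" by (simp add: complex_eq_iff)
  hence "(2 * of_real (cos y)) ^ (2 * m) = (\<Sum>j\<le>2 * m. of_nat (2 * m choose j) * cis y ^ j * cis (- y) ^ (2 * m - j))"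
    by (simp only: binomial_ring)
  also have "\<dots> = (\<Sum>j\<le>2 * m. of_nat (2 * m choose j) * cis (2 * y * (real j - real m)))"
  proof (intro sum.cong refl)
    fix j assume "j \<in> {..2 * m}"
    hence "real j * y + real (2 * m - j) * (- y) = 2 * y * (real j - real m)"
      by (simp add: of_nat_diff algebra_simps)
    thus "of_nat (2 * m choose j) * cis y ^ j * cis (- y) ^ (2 * m - j) = of_nat (2 * m choose j) * cis (2 * y * (real j - real m))"
      by (simp add: Complex.DeMoivre mult.assoc cis_mult)
  qed
  finally show ?thesis .
qed

text \<open>The sum folds about the centre m by symmetry of the binomials. The range k < m is
  generous: entries with m + l (k + 1) > 2m are zero.\<close>

lemma sum_binomial_multiples:
  assumes l: "l > 0"
  shows "(\<Sum>j\<le>2 * m. if int l dvd (int j - int m) then real (2 * m choose j) else 0)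
    = real (2 * m choose m) + 2 * (\<Sum>k<m. real (2 * m choose (m + l * Suc k)))"
proof -
  let ?f = "\<lambda>j. if int l dvd (int j - int m) then real (2 * m choose j) else 0"
  have up: "(\<Sum>j\<in>{m<..2 * m}. ?f j) = (\<Sum>k<m. real (2 * m choose (m + l * Suc k)))"
  proof -
    have "(\<Sum>j\<in>{m<..2 * m}. ?f j) = (\<Sum>j\<in>{j\<in>{m<..2 * m}. int l dvd (int j - int m)}. real (2 * m choose j))"
      by (rule sum.inter_filter[symmetric]) simp
    also have "\<dots> = (\<Sum>k\<in>{k. k < m \<and> m + l * Suc k \<le> 2 * m}. real (2 * m choose (m + l * Suc k)))"
    proof (rule sum.reindex_bij_witness[of _ "\<lambda>k. m + l * Suc k" "\<lambda>j. (j - m) div l - 1"])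
      fix j assume "j \<in> {j\<in>{m<..2 * m}. int l dvd (int j - int m)}"
      hence j: "m < j" "j \<le> 2 * m" "int l dvd int (j - m)" by (auto simp: of_nat_diff)
      have "l dvd j - m" using j(3) by (simp only: int_dvd_int_iff)
      then obtain e where e: "j - m = l * e" by blast
      have "e > 0" using e j(1) by (cases e) auto
      then obtain e' where e': "e = Suc e'" by (cases e) auto
      have "(j - m) div l - 1 = e'" using e e' l by simp
      moreover have "j = m + l * Suc e'" using e e' j by simp
      moreover have "e' < m"
      proof -
        have "e \<le> j - m" using e l by simp
        thus ?thesis using e' j by simp
      qed
      ultimately show "m + l * Suc ((j - m) div l - 1) = j" "(j - m) div l - 1 \<in> {k. k < m \<and> m + l * Suc k \<le> 2 * m}"
        "real (2 * m choose (m + l * Suc ((j - m) div l - 1))) = real (2 * m choose j)"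
        using j by auto
    next
      fix k assume "k \<in> {k. k < m \<and> m + l * Suc k \<le> 2 * m}"
      thus "(m + l * Suc k - m) div l - 1 = k" "m + l * Suc k \<in> {j\<in>{m<..2 * m}. int l dvd (int j - int m)}"
        using l by (auto simp del: mult_Suc_right)
    qed
    also have "\<dots> = (\<Sum>k<m. real (2 * m choose (m + l * Suc k)))"
      by (rule sum.mono_neutral_left) (auto simp: not_le binomial_eq_0)
    finally show ?thesis .
  qed
  have down: "(\<Sum>j<m. ?f j) = (\<Sum>j\<in>{m<..2 * m}. ?f j)"
  proof (rule sum.reindex_bij_witness[of _ "\<lambda>j. 2 * m - j" "\<lambda>j. 2 * m - j"])
    fix j assume j: "j \<in> {..<m}"
    have "int (2 * m - j) - int m = - (int j - int m)" using j by (simp add: of_nat_diff)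
    moreover have "2 * m choose (2 * m - j) = 2 * m choose j"
      using j binomial_symmetric[of j "2 * m"] by simp
    ultimately show "?f (2 * m - j) = ?f j" by (simp only: dvd_minus_iff)
  qed auto
  have "{..2 * m} = {..<m} \<union> ({m} \<union> {m<..2 * m})" by auto
  hence "(\<Sum>j\<le>2 * m. ?f j) = (\<Sum>j<m. ?f j) + (\<Sum>j\<in>{m} \<union> {m<..2 * m}. ?f j)"
    by (simp only:) (rule sum.union_disjoint, auto)
  also have "(\<Sum>j\<in>{m} \<union> {m<..2 * m}. ?f j) = ?f m + (\<Sum>j\<in>{m<..2 * m}. ?f j)"
    by (subst sum.union_disjoint) auto
  finally show ?thesis using up down by simp
qed

text \<open>
  Polya's finite form of the theta transformation: the roots of unity filter applied to
  \<open>(2 cos (\<pi>v/l))\<^sup>2\<^sup>m\<close>, with \<open>l\<close> odd so that the terms \<open>v\<close> and \<open>l - v\<close> pair up.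
\<close>
lemma finite_theta_identity:
  fixes q m :: nat
  defines "l \<equiv> 2 * q + 1"
  shows "1 + 2 * (\<Sum>v<q. cos (pi * real (Suc v) / real l) ^ (2 * m)) =
    real l * real (2 * m choose m) / 4 ^ m *
      (1 + 2 * (\<Sum>k<m. real (2 * m choose (m + l * Suc k)) / real (2 * m choose m)))"
proof -
  have l: "l > 0" by (simp add: l_def)
  let ?c = "\<lambda>v. cos (pi * real v / real l) ^ (2 * m)"
  have "of_real (\<Sum>v<l. 4 ^ m * ?c v) = (\<Sum>v<l. (2 * complex_of_real (cos (pi * real v / real l))) ^ (2 * m))"
    by (simp add: power_mult_distrib power_mult)
  also have "\<dots> = (\<Sum>v<l. \<Sum>j\<le>2 * m. of_nat (2 * m choose j) * cis (2 * (pi * real v / real l) * (real j - real m)))"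
    by (simp only: two_cos_power_eq_sum_cis)
  also have "\<dots> = (\<Sum>j\<le>2 * m. of_nat (2 * m choose j) * (\<Sum>v<l. cis (2 * pi * real v * real_of_int (int j - int m) / real l)))"
    by (subst sum.swap) (simp add: sum_distrib_left mult_ac)
  also have "\<dots> = of_real (real l * (\<Sum>j\<le>2 * m. if int l dvd (int j - int m) then real (2 * m choose j) else 0))"
    unfolding sum_cis_multiples[OF l] by (simp add: sum_distrib_left if_distrib mult_ac cong: if_cong)
  finally have "(\<Sum>v<l. 4 ^ m * ?c v) = real l * (\<Sum>j\<le>2 * m. if int l dvd (int j - int m) then real (2 * m choose j) else 0)"
    by (simp only: of_real_eq_iff)
  hence 1: "4 ^ m * (\<Sum>v<l. ?c v) = real l * (real (2 * m choose m) + 2 * (\<Sum>k<m. real (2 * m choose (m + l * Suc k))))"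
    by (simp only: sum_binomial_multiples[OF l] sum_distrib_left)
  have "{..<l} = {0} \<union> (Suc ` {..<q} \<union> (\<lambda>v. l - Suc v) ` {..<q})"
  proof (intro equalityI subsetI)
    fix x assume x: "x \<in> {..<l}"
    consider "x = 0" | "x > 0" "x \<le> q" | "x > q" by linarith
    thus "x \<in> {0} \<union> (Suc ` {..<q} \<union> (\<lambda>v. l - Suc v) ` {..<q})"
    proof cases
      case 2
      hence "x = Suc (x - 1)" "x - 1 < q" by auto
      thus ?thesis by blast
    next
      case 3
      hence "x = l - Suc (l - x - 1)" "l - x - 1 < q" using x by (auto simp: l_def)
      thus ?thesis by blast
    qed auto
  qed (auto simp: l_def)
  hence "(\<Sum>v<l. ?c v) = (\<Sum>v\<in>{0} \<union> (Suc ` {..<q} \<union> (\<lambda>v. l - Suc v) ` {..<q}). ?c v)" by simp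
  also have "\<dots> = ?c 0 + (\<Sum>v\<in>Suc ` {..<q} \<union> (\<lambda>v. l - Suc v) ` {..<q}. ?c v)"
    by (subst sum.union_disjoint) (auto simp: l_def)
  also have "(\<Sum>v\<in>Suc ` {..<q} \<union> (\<lambda>v. l - Suc v) ` {..<q}. ?c v) = (\<Sum>v\<in>Suc ` {..<q}. ?c v) + (\<Sum>v\<in>(\<lambda>v. l - Suc v) ` {..<q}. ?c v)"
    by (rule sum.union_disjoint) (auto simp: l_def)
  also have "(\<Sum>v\<in>Suc ` {..<q}. ?c v) = (\<Sum>v<q. ?c (Suc v))" by (subst sum.reindex) auto
  also have "(\<Sum>v\<in>(\<lambda>v. l - Suc v) ` {..<q}. ?c v) = (\<Sum>v<q. ?c (l - Suc v))"
    by (subst sum.reindex) (auto simp: inj_on_def l_def)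
  also have "(\<Sum>v<q. ?c (l - Suc v)) = (\<Sum>v<q. ?c (Suc v))"
  proof (intro sum.cong refl)
    fix v assume "v \<in> {..<q}"
    hence "pi * real (l - Suc v) / real l = pi - pi * real (Suc v) / real l"
      using l by (simp add: of_nat_diff l_def field_simps)
    hence "cos (pi * real (l - Suc v) / real l) = - cos (pi * real (Suc v) / real l)" by simp
    thus "?c (l - Suc v) = ?c (Suc v)" by simp
  qed
  finally have 2: "(\<Sum>v<l. ?c v) = 1 + 2 * (\<Sum>v<q. ?c (Suc v))" by simp
  have "real (2 * m choose m) \<noteq> 0" by (simp add: binomial_eq_0_iff)
  hence "real (2 * m choose m) + 2 * (\<Sum>k<m. real (2 * m choose (m + l * Suc k)))
     = real (2 * m choose m) * (1 + 2 * (\<Sum>k<m. real (2 * m choose (m + l * Suc k)) / real (2 * m choose m)))"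
    by (simp add: distrib_left sum_distrib_left)
  hence "4 ^ m * (1 + 2 * (\<Sum>v<q. ?c (Suc v))) = real l * real (2 * m choose m) *
    (1 + 2 * (\<Sum>k<m. real (2 * m choose (m + l * Suc k)) / real (2 * m choose m)))"
    using 1 2 by simp
  thus ?thesis by (simp add: field_simps)
qed

section \<open>Limits of the terms in the finite theta identity\<close>

lemma power_one_minus_tendsto_exp:
  fixes a :: "nat \<Rightarrow> real" and m :: "nat \<Rightarrow> nat"
  assumes a: "a \<longlonglongrightarrow> 0" "\<And>n. a n \<ge> 0" and ma: "(\<lambda>n. real (m n) * a n) \<longlonglongrightarrow> c"
  shows "(\<lambda>n. (1 - a n) ^ m n) \<longlonglongrightarrow> exp (- c)"
proof (rule tendsto_sandwich)
  have ev: "eventually (\<lambda>n. a n < 1) sequentially" using order_tendstoD(2)[OF a(1), of 1] by simp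
  show "eventually (\<lambda>n. exp (- (real (m n) * a n / (1 - a n))) \<le> (1 - a n) ^ m n) sequentially"
    using ev
  proof eventually_elim
    case (elim n)
    have "1 + a n / (1 - a n) \<le> exp (a n / (1 - a n))" by (rule exp_ge_add_one_self)
    hence "1 / (1 - a n) \<le> exp (a n / (1 - a n))" using elim by (simp add: field_simps)
    hence "exp (- (a n / (1 - a n))) \<le> 1 - a n" using elim by (simp add: exp_minus field_simps)
    hence "exp (- (a n / (1 - a n))) ^ m n \<le> (1 - a n) ^ m n" by (intro power_mono) auto
    thus ?case by (simp flip: exp_of_nat_mult)
  qed
  show "eventually (\<lambda>n. (1 - a n) ^ m n \<le> exp (- (real (m n) * a n))) sequentially"
    using ev
  proof eventually_elim
    case (elim n)
    have "1 - a n \<le> exp (- a n)" using exp_ge_add_one_self[of "- a n"] by simp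
    hence "(1 - a n) ^ m n \<le> exp (- a n) ^ m n" using elim by (intro power_mono) auto
    thus ?case by (simp flip: exp_of_nat_mult)
  qed
  show "(\<lambda>n. exp (- (real (m n) * a n))) \<longlonglongrightarrow> exp (- c)" by (intro tendsto_intros ma)
  have "(\<lambda>n. exp (- (real (m n) * a n / (1 - a n)))) \<longlonglongrightarrow> exp (- (c / (1 - 0)))"
    by (intro tendsto_intros ma a) auto
  thus "(\<lambda>n. exp (- (real (m n) * a n / (1 - a n)))) \<longlonglongrightarrow> exp (- c)" by simp
qed

text \<open>The 5 is 1 + 4: y cos y <= sin y gives y^2 cos^2 y <= sin^2 y, and y^2 <= 4, so y^2 <= 5
  sin^2 y. The bound dominates the cosine terms uniformly.\<close>

lemma cos_power_le_exp:
  assumes y: "0 \<le> y" "y \<le> pi / 2"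
  shows "cos y ^ (2 * m) \<le> exp (- (real m * y^2 / 5))"
proof -
  have "y * cos y \<le> sin y"
  proof -
    have "(\<lambda>y. sin y - y * cos y) 0 \<le> (\<lambda>y. sin y - y * cos y) y"
    proof (rule DERIV_nonneg_imp_nondecreasing[OF y(1)])
      fix x assume x: "0 \<le> x" "x \<le> y"
      have "((\<lambda>y. sin y - y * cos y) has_field_derivative x * sin x) (at x)"
        by (auto intro!: derivative_eq_intros)
      moreover have "x * sin x \<ge> 0" using x y by (intro mult_nonneg_nonneg sin_ge_zero) auto
      ultimately show "\<exists>z. ((\<lambda>y. sin y - y * cos y) has_real_derivative z) (at x) \<and> 0 \<le> z" by blast
    qed
    thus ?thesis by simp
  qed
  moreover have "cos y \<ge> 0" using y by (intro cos_ge_zero) auto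
  ultimately have "(y * cos y)^2 \<le> (sin y)^2" using y by (intro power_mono) auto
  hence *: "y^2 * (1 - ((sin y)^2)) \<le> (sin y)^2" by (simp add: power_mult_distrib cos_squared_eq)
  have "y * y \<le> 2 * 2" using y pi_half_less_two by (intro mult_mono) auto
  hence "y^2 \<le> 4" by (simp add: power2_eq_square)
  have "y^2 = y^2 * (1 - ((sin y)^2)) + y^2 * (sin y)^2" by (simp add: algebra_simps)
  also have "\<dots> \<le> (sin y)^2 + 4 * (sin y)^2" using * \<open>y^2 \<le> 4\<close> by (intro add_mono mult_right_mono) auto
  finally have s: "y^2 / 5 \<le> (sin y)^2" by simp
  have "cos y ^ (2 * m) = (1 + - ((sin y)^2)) ^ m" by (simp add: power_mult cos_squared_eq)
  also have "\<dots> \<le> exp (- ((sin y)^2)) ^ m"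
    by (intro power_mono exp_ge_add_one_self) (simp flip: cos_squared_eq)
  also have "\<dots> \<le> exp (- (y^2 / 5)) ^ m" using s by (intro power_mono) auto
  also have "\<dots> = exp (- (real m * y^2 / 5))" by (simp flip: exp_of_nat_mult)
  finally show ?thesis .
qed

text \<open>Moving from j to j + 1 multiplies the ratio by 1 - x with x = (2j + 1)/(m + j + 1). Now
  exp (-x/(1 - x)) <= 1 - x <= exp (-x), where x/(1 - x) = (2j + 1)/(m - j), and the odd numbers 2j
  + 1 add up to J^2.\<close>

lemma central_binomial_ratio_bounds:
  assumes J: "J \<le> m"
  shows "J < m \<Longrightarrow> exp (- ((real J)^2) / (real m - real J)) \<le> real (2 * m choose (m + J)) / real (2 * m choose m)"
    and "real (2 * m choose (m + J)) / real (2 * m choose m) \<le> exp (- ((real J)^2) / (real m + real J))"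
proof -
  define r where "r j = real (2 * m choose (m + j)) / real (2 * m choose m)" for j
  have C0: "real (2 * m choose m) > 0" by simp
  have step: "r (Suc j) = r j * ((real m - real j) / (real m + real j + 1))" if "j < m" for j
  proof -
    have eq: "Suc (m + j) * (2 * m choose Suc (m + j)) = (2 * m - (m + j)) * (2 * m choose (m + j))"
      by (metis binomial_absorption binomial_absorb_comp)
    have "(real m + real j + 1) * real (2 * m choose Suc (m + j)) = (real m - real j) * real (2 * m choose (m + j))"
    proof -
      have "real (Suc (m + j)) = real m + real j + 1" "real (2 * m - (m + j)) = real m - real j"
        using that by (simp_all add: of_nat_diff)
      moreover have "real (Suc (m + j)) * real (2 * m choose Suc (m + j)) = real (2 * m - (m + j)) * real (2 * m choose (m + j))"
        using eq by (metis of_nat_mult)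
      ultimately show ?thesis by (simp only:)
    qed
    moreover have "x / C = y / C * (B / A)" if "A * x = B * y" "A > 0" "C > 0" for x y A B C :: real
      using that by (simp add: field_simps)
    ultimately show ?thesis using C0 by (simp add: r_def)
  qed
  have "(J < m \<longrightarrow> exp (- ((real j)^2) / (real m - real J)) \<le> r j) \<and> r j \<le> exp (- ((real j)^2) / (real m + real J))" if "j \<le> J" for j
    using that
  proof (induction j)
    case 0
    thus ?case using C0 by (simp add: r_def)
  next
    case (Suc j)
    have j: "j < m" using Suc.prems J by simp
    define x where "x = (2 * real j + 1) / (real m + real j + 1)"
    have fac: "(real m - real j) / (real m + real j + 1) = 1 - x" by (simp add: x_def field_simps)
    have x1: "x < 1" "x \<ge> 0" using j by (auto simp: x_def)
    have sq: "(real (Suc j))^2 = (real j)^2 + (2 * real j + 1)" by (simp add: power2_eq_square algebra_simps)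
    have up: "1 - x \<le> exp (- (2 * real j + 1) / (real m + real J))"
    proof -
      have "1 - x \<le> exp (- x)" using exp_ge_add_one_self[of "- x"] by simp
      moreover have "(2 * real j + 1) / (real m + real J) \<le> x"
        unfolding x_def using Suc.prems J by (intro divide_left_mono) auto
      ultimately show ?thesis by (smt (verit) exp_le_cancel_iff minus_divide_left)
    qed
    have lo: "exp (- (2 * real j + 1) / (real m - real J)) \<le> 1 - x" if "J < m"
    proof -
      have "1 + x / (1 - x) \<le> exp (x / (1 - x))" by (rule exp_ge_add_one_self)
      hence "1 / (1 - x) \<le> exp (x / (1 - x))" using x1 by (simp add: field_simps)
      hence "exp (- (x / (1 - x))) \<le> 1 - x" using x1 by (simp add: exp_minus field_simps)
      moreover have "x / (1 - x) = (2 * real j + 1) / (real m - real j)"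
      proof -
        have quot: "a / b / (c / b) = a / c" if "b \<noteq> 0" for a b c :: real using that by simp
        have "real m + real j + 1 \<noteq> 0" by linarith
        thus ?thesis unfolding fac[symmetric] unfolding x_def by (rule quot)
      qed
      moreover have "(2 * real j + 1) / (real m - real j) \<le> (2 * real j + 1) / (real m - real J)"
        using Suc.prems that by (intro divide_left_mono) auto
      ultimately show ?thesis by (smt (verit) exp_le_cancel_iff minus_divide_left)
    qed
    have IH: "J < m \<Longrightarrow> exp (- ((real j)^2) / (real m - real J)) \<le> r j" "r j \<le> exp (- ((real j)^2) / (real m + real J))"
      using Suc by auto
    have "exp (- ((real j)^2) / (real m - real J)) * exp (- (2 * real j + 1) / (real m - real J)) \<le> r j * (1 - x)" if "J < m"
      using IH lo that by (intro mult_mono) (auto simp: r_def)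
    moreover have "r j * (1 - x) \<le> exp (- ((real j)^2) / (real m + real J)) * exp (- (2 * real j + 1) / (real m + real J))"
      using IH up x1 by (intro mult_mono) auto
    ultimately show ?case
      unfolding step[OF j] fac sq exp_add[symmetric] add_divide_distrib[symmetric] by simp
  qed
  from this[of J] show "J < m \<Longrightarrow> exp (- ((real J)^2) / (real m - real J)) \<le> real (2 * m choose (m + J)) / real (2 * m choose m)"
    "real (2 * m choose (m + J)) / real (2 * m choose m) \<le> exp (- ((real J)^2) / (real m + real J))"
    by (auto simp: r_def)
qed

text \<open>The expression is exactly the reciprocal of a partial Wallis product.\<close>

lemma central_binomial_asymptotics:
  "(\<lambda>m. (real (2 * m choose m) / 4 ^ m)^2 * real (2 * m + 1)) \<longlonglongrightarrow> 2 / pi"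
proof -
  have "(real (2 * m choose m) / 4 ^ m)^2 * real (2 * m + 1) = inverse (\<Prod>k=1..m. (4 * real k^2) / (4 * real k^2 - 1))" for m
  proof (induction m)
    case (Suc m)
    have "Suc m * (2 * Suc m choose Suc m) = 2 * Suc m * (2 * m + 1 choose m)"
      using Suc_times_binomial_eq[of "2 * m + 1" m] by (simp add: mult.commute)
    moreover have "Suc m * (2 * m + 1 choose m) = (2 * m + 1) * (2 * m choose m)"
      using binomial_absorb_comp[of "2 * m + 1" m] by (simp add: mult.commute)
    ultimately have "Suc m * (Suc m * (2 * Suc m choose Suc m)) = Suc m * (2 * ((2 * m + 1) * (2 * m choose m)))"
      by (metis (no_types, lifting) mult.assoc mult.left_commute)
    hence "Suc m * (2 * Suc m choose Suc m) = 2 * ((2 * m + 1) * (2 * m choose m))"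
      unfolding mult_cancel1 by (simp only: nat.distinct simp_thms)
    hence "real (Suc m) * real (2 * Suc m choose Suc m) = 2 * (real (2 * m + 1) * real (2 * m choose m))"
      by (metis of_nat_mult of_nat_numeral)
    hence c: "real (2 * Suc m choose Suc m) = 2 * (real (2 * m + 1) * real (2 * m choose m)) / real (Suc m)"
      by (simp add: field_simps del: binomial_Suc_Suc)
    have alg: "(2 * (x * c) / s / (4 * p))^2 * y = (c / p)^2 * x * (x * y / (4 * s^2))"
      if "s \<noteq> 0" "p \<noteq> 0" for c p x y s :: real
      using that by (simp add: field_simps power2_eq_square)
    have "(real (2 * Suc m choose Suc m) / 4 ^ Suc m)^2 * real (2 * m + 3)
       = (real (2 * m choose m) / 4 ^ m)^2 * real (2 * m + 1) * (real (2 * m + 1) * real (2 * m + 3) / (4 * real (Suc m)^2))"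
      unfolding c power_Suc[of 4] by (rule alg) auto
    also have "real (2 * m + 1) * real (2 * m + 3) = 4 * real (Suc m)^2 - 1" by (simp add: power2_eq_square algebra_simps)
    finally have "(real (2 * Suc m choose Suc m) / 4 ^ Suc m)^2 * real (2 * m + 3) =
      inverse (\<Prod>k=1..m. (4 * real k^2) / (4 * real k^2 - 1)) * ((4 * real (Suc m)^2 - 1) / (4 * real (Suc m)^2))"
      by (simp only: Suc.IH)
    moreover have "2 * Suc m + 1 = 2 * m + 3" by simp
    moreover have "inverse (\<Prod>k=1..Suc m. F k) = inverse (\<Prod>k=1..m. F k) * inverse (F (Suc m))"
      for F :: "nat \<Rightarrow> real" by simp
    ultimately show ?case by (simp only: inverse_divide)
  qed simp
  thus ?thesis using tendsto_inverse[OF wallis] by simp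
qed

text \<open>Jacobi's theta series, the sum of exp (-pi n^2 x) over all integers n, is 1 + 2
  \<open>psi x\<close>.\<close>

definition psi :: "real \<Rightarrow> real" where
  "psi x = (\<Sum>n. exp (- (pi * (real (Suc n))^2 * x)))"

lemma summable_exp_neg_Suc: "c > 0 \<Longrightarrow> summable (\<lambda>n. exp (- (c * real (Suc n))))"
proof -
  assume "c > (0::real)"
  hence "summable (\<lambda>n. exp (- c) * exp (- c) ^ n)" by (intro summable_mult summable_geometric) auto
  also have "(\<lambda>n. exp (- c) * exp (- c) ^ n) = (\<lambda>n. exp (- (c * real (Suc n))))"
    by (simp add: algebra_simps flip: exp_of_nat_mult exp_add)
  finally show ?thesis .
qed

lemma le_square_Suc: "real (Suc n) \<le> (real (Suc n))^2"
  by (simp add: power2_eq_square)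

text \<open>Limit of \<open>finite_theta_identity\<close> with l = 2q + 1 and m close to x l^2 / pi.
  Then m sin^2 (pi v / l) tends to pi v^2 x, the Gaussian exponent (l k)^2 / m tends to pi k^2 / x,
  and the prefactor tends to 1 / sqrt x. Tannery's theorem exchanges the limits with the
  sums.\<close>

lemma theta_transformation:
  assumes x: "x > 0"
  shows "1 + 2 * psi x = (1 + 2 * psi (1 / x)) / sqrt x"
proof -
  define t where "t = x / pi"
  have t: "t > 0" using x by (simp add: t_def)
  define l :: "nat \<Rightarrow> nat" where "l q = 2 * q + 1" for q
  define m :: "nat \<Rightarrow> nat" where "m q = nat \<lfloor>t * (real (l q))^2\<rfloor>" for q
  have l0: "real (l q) > 0" for q by (simp add: l_def)
  have linv: "(\<lambda>q. c / real (l q)) \<longlonglongrightarrow> 0" for c unfolding l_def by real_asymp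
  have linv2: "(\<lambda>q. 1 / (real (l q))^2) \<longlonglongrightarrow> 0" unfolding l_def by real_asymp
  have m_le: "real (m q) \<le> t * (real (l q))^2" for q
    using t by (simp add: m_def)
  have m_ge: "real (m q) \<ge> t * (real (l q))^2 - 1" for q
    unfolding m_def by linarith
  have ml: "(\<lambda>q. real (m q) / (real (l q))^2) \<longlonglongrightarrow> t"
  proof (rule tendsto_sandwich)
    show "(\<lambda>q. t - 1 / (real (l q))^2) \<longlonglongrightarrow> t"
      using tendsto_diff[OF tendsto_const[of t] linv2] by simp
    show "eventually (\<lambda>q. t - 1 / (real (l q))^2 \<le> real (m q) / (real (l q))^2) sequentially"
    proof (intro always_eventually allI)
      fix q
      have "t - 1 / (real (l q))^2 = (t * (real (l q))^2 - 1) / (real (l q))^2" using l0[of q] by (simp add: diff_divide_distrib)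
      also have "\<dots> \<le> real (m q) / (real (l q))^2" using m_ge by (intro divide_right_mono) auto
      finally show "t - 1 / (real (l q))^2 \<le> real (m q) / (real (l q))^2" .
    qed
    show "eventually (\<lambda>q. real (m q) / (real (l q))^2 \<le> t) sequentially"
      using m_le l0 by (intro always_eventually allI) (simp add: field_simps)
  qed auto
  have ml_ev: "eventually (\<lambda>q. real (m q) / (real (l q))^2 > t / 2) sequentially"
    by (rule order_tendstoD(1)[OF ml]) (use t in simp)
  have l_top: "filterlim (\<lambda>q. real (l q)) at_top sequentially" unfolding l_def by real_asymp
  have m_top: "filterlim m at_top sequentially"
  proof -
    have "filterlim (\<lambda>q. t * (real (l q))^2 - 1) at_top sequentially" unfolding l_def using t by real_asymp
    hence "filterlim (\<lambda>q. real (m q)) at_top sequentially"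
      by (rule filterlim_at_top_mono) (use m_ge in auto)
    thus ?thesis by (simp add: filterlim_sequentially_iff_filterlim_real)
  qed

  define a where "a v q = (if v < q then cos (pi * real (Suc v) / real (l q)) ^ (2 * m q) else 0)" for v q
  define b where "b k q = real (2 * m q choose (m q + l q * Suc k)) / real (2 * m q choose m q)" for k q
  have tan_a: "(\<lambda>q. \<Sum>v. a v q) \<longlonglongrightarrow> (\<Sum>v. exp (- (pi * (real (Suc v))^2 * x)))"
  proof (rule tannerys_theorem[THEN conjunct2, THEN conjunct2])
    show "summable (\<lambda>v. exp (- (t / 2 * real (Suc v))))" using t by (intro summable_exp_neg_Suc) simp
    show "(\<lambda>q. a v q) \<longlonglongrightarrow> exp (- (pi * (real (Suc v))^2 * x))" for v
    proof -
      define c where "c = pi * real (Suc v)"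
      define s where "s q = (sin (c / real (l q)))^2" for q
      have s0: "s \<longlonglongrightarrow> 0"
        using tendsto_power[OF tendsto_sin[OF linv[of c]], of 2] by (simp add: s_def[abs_def])
      have "(\<lambda>q. (real (l q))^2 * s q) \<longlonglongrightarrow> c^2" unfolding s_def l_def c_def by (real_asymp simp: power_divide)
      hence "(\<lambda>q. (real (m q) / (real (l q))^2) * ((real (l q))^2 * s q)) \<longlonglongrightarrow> t * c^2"
        by (intro tendsto_mult ml)
      also have "(\<lambda>q. (real (m q) / (real (l q))^2) * ((real (l q))^2 * s q)) = (\<lambda>q. real (m q) * s q)"
        using l0 by (intro ext) (simp add: less_imp_neq[symmetric])
      finally have "(\<lambda>q. (1 - s q) ^ m q) \<longlonglongrightarrow> exp (- (t * c^2))"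
        by (intro power_one_minus_tendsto_exp s0) (auto simp: s_def)
      moreover have "eventually (\<lambda>q. (1 - s q) ^ m q = a v q) sequentially"
        using eventually_gt_at_top[of v]
        by eventually_elim (simp add: a_def s_def c_def power_mult cos_squared_eq)
      ultimately have "(\<lambda>q. a v q) \<longlonglongrightarrow> exp (- (t * c^2))" by (rule Lim_transform_eventually)
      moreover have "t * c^2 = pi * (real (Suc v))^2 * x"
        by (simp add: t_def c_def power_mult_distrib power2_eq_square)
      ultimately show ?thesis by simp
    qed
    \<comment> \<open>Once m / l^2 > t / 2, the exponent m y^2 / 5 is at least (t / 2)(pi^2 / 5)(v +
      1)^2, and pi^2 >= 9 exceeds 5.\<close>
    have "norm (a v q) \<le> exp (- (t / 2 * real (Suc v)))" if q: "real (m q) / (real (l q))^2 > t / 2" for v q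
    proof (cases "v < q")
      case True
      define y where "y = pi * real (Suc v) / real (l q)"
      have "real (Suc v) / real (l q) \<le> 1 / 2" using True by (simp add: l_def field_simps)
      hence "pi * (real (Suc v) / real (l q)) \<le> pi * (1 / 2)" by (intro mult_left_mono) auto
      hence y: "0 \<le> y" "y \<le> pi / 2" by (simp_all add: y_def)
      have "cos y \<ge> 0" using y by (intro cos_ge_zero) auto
      hence "norm (a v q) = cos y ^ (2 * m q)" using True by (simp add: a_def y_def)
      also have "\<dots> \<le> exp (- (real (m q) * y^2 / 5))" by (rule cos_power_le_exp[OF y])
      also have "\<dots> \<le> exp (- (t / 2 * real (Suc v)))"
      proof -
        have "3 * 3 \<le> pi * pi" using pi_gt3 by (intro mult_mono) auto
        hence "1 * (real (Suc v))^2 \<le> (pi^2 / 5) * (real (Suc v))^2"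
          by (intro mult_right_mono) (auto simp: power2_eq_square)
        hence "real (Suc v) \<le> (pi^2 / 5) * (real (Suc v))^2" using le_square_Suc[of v] by linarith
        hence "t / 2 * real (Suc v) \<le> real (m q) / (real (l q))^2 * ((pi^2 / 5) * (real (Suc v))^2)"
          using q t by (intro mult_mono) auto
        also have "\<dots> = real (m q) * y^2 / 5" by (simp add: y_def power_divide power_mult_distrib)
        finally show ?thesis by simp
      qed
      finally show ?thesis .
    qed (simp add: a_def)
    thus "eventually (\<lambda>(v, q). norm (a v q) \<le> exp (- (t / 2 * real (Suc v)))) (at_top \<times>\<^sub>F sequentially)"
      unfolding eventually_prod_filter using ml_ev
      by (intro exI[of _ "\<lambda>_. True"] exI[of _ "\<lambda>q. real (m q) / (real (l q))^2 > t / 2"]) simp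
  qed simp
  have tan_b: "(\<lambda>q. \<Sum>k. b k q) \<longlonglongrightarrow> (\<Sum>k. exp (- (pi * (real (Suc k))^2 * (1 / x))))"
  proof (rule tannerys_theorem[THEN conjunct2, THEN conjunct2])
    show "summable (\<lambda>k. exp (- (1 / (2 * t) * real (Suc k))))" using t by (intro summable_exp_neg_Suc) simp
    show "(\<lambda>q. b k q) \<longlonglongrightarrow> exp (- (pi * (real (Suc k))^2 * (1 / x)))" for k
    proof (rule tendsto_sandwich)
      let ?J = "\<lambda>q. l q * Suc k"
      let ?r = "\<lambda>q. real (m q) / (real (l q))^2"
      have "(\<lambda>q. ?r q - real (Suc k) / real (l q)) \<longlonglongrightarrow> t - 0" by (intro tendsto_intros ml linv)
      hence ev: "eventually (\<lambda>q. ?r q - real (Suc k) / real (l q) > 0) sequentially"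
        by (rule order_tendstoD(1)) (use t in simp)
      have Jm: "?J q < m q" if "?r q - real (Suc k) / real (l q) > 0" for q
      proof -
        have "real (l q * Suc k) < real (m q)"
          using that l0[of q] by (simp add: field_simps power2_eq_square)
        thus ?thesis by (simp only: of_nat_less_iff)
      qed
      \<comment> \<open>\<sigma> = -1 belongs to the lower and \<sigma> = 1 to the upper bound;
        after division by l^2 both have the same limit.\<close>
      have exps: "- ((real (?J q))^2) / (real (m q) + \<sigma> * real (?J q)) = - ((real (Suc k))^2 / (?r q + \<sigma> * (real (Suc k) / real (l q))))" for q \<sigma>
      proof -
        have "- ((L * K)^2) / (M + \<sigma> * (L * K)) = - (K^2 / (M / L^2 + \<sigma> * (K / L)))" if "L > 0" for L K M :: real
        proof -
          have "M / L^2 + \<sigma> * (K / L) = (M + \<sigma> * (L * K)) / L^2" using that by (simp add: field_simps power2_eq_square)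
          thus ?thesis using that by (simp add: power_mult_distrib mult.commute)
        qed
        from this[OF l0] show ?thesis by (simp only: of_nat_mult)
      qed
      show "eventually (\<lambda>q. exp (- ((real (Suc k))^2 / (?r q + (-1) * (real (Suc k) / real (l q))))) \<le> b k q) sequentially"
        using ev
      proof eventually_elim
        case (elim q)
        have "exp (- ((real (?J q))^2) / (real (m q) + (-1) * real (?J q))) \<le> b k q"
          using central_binomial_ratio_bounds(1)[OF less_imp_le Jm, OF Jm, OF elim elim]
          by (simp add: b_def del: mult_Suc_right of_nat_mult)
        thus ?case by (simp only: exps)
      qed
      show "eventually (\<lambda>q. b k q \<le> exp (- ((real (Suc k))^2 / (?r q + 1 * (real (Suc k) / real (l q)))))) sequentially"
        using ev
      proof eventually_elim
        case (elim q)
        have "b k q \<le> exp (- ((real (?J q))^2) / (real (m q) + 1 * real (?J q)))"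
          using central_binomial_ratio_bounds(2)[OF less_imp_le[OF Jm[OF elim]]]
          by (simp add: b_def del: mult_Suc_right of_nat_mult)
        thus ?case by (simp only: exps)
      qed
      have lim: "(\<lambda>q. exp (- ((real (Suc k))^2 / (?r q + \<sigma> * (real (Suc k) / real (l q)))))) \<longlonglongrightarrow> exp (- (pi * (real (Suc k))^2 * (1 / x)))" for \<sigma>
      proof -
        have "(\<lambda>q. exp (- ((real (Suc k))^2 / (?r q + \<sigma> * (real (Suc k) / real (l q)))))) \<longlonglongrightarrow> exp (- ((real (Suc k))^2 / (t + \<sigma> * 0)))"
          by (intro tendsto_intros ml linv) (use t in auto)
        moreover have "(real (Suc k))^2 / (t + \<sigma> * 0) = pi * (real (Suc k))^2 * (1 / x)" by (simp add: t_def)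
        ultimately show ?thesis by (simp only:)
      qed
      show "(\<lambda>q. exp (- ((real (Suc k))^2 / (?r q + (-1) * (real (Suc k) / real (l q)))))) \<longlonglongrightarrow> exp (- (pi * (real (Suc k))^2 * (1 / x)))"
        "(\<lambda>q. exp (- ((real (Suc k))^2 / (?r q + 1 * (real (Suc k) / real (l q)))))) \<longlonglongrightarrow> exp (- (pi * (real (Suc k))^2 * (1 / x)))"
        by (rule lim)+
    qed
    \<comment> \<open>For J = l (k + 1) <= m one has m + J <= 2m <= 2 t l^2, so J^2 / (m + J) is at
      least (k + 1)^2 / (2 t) for every q; for J > m the term is 0.\<close>
    have "norm (b k q) \<le> exp (- (1 / (2 * t) * real (Suc k)))" for k q
    proof (cases "l q * Suc k \<le> m q")
      case True
      let ?J = "l q * Suc k"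
      have "?J > 0" by (simp add: l_def)
      moreover have "m q > 0" using True \<open>?J > 0\<close> by linarith
      ultimately have m0: "real (m q) > 0" "real ?J > 0" by (simp_all only: of_nat_0_less_iff)
      have "norm (b k q) = b k q" by (simp add: b_def)
      also have "\<dots> \<le> exp (- ((real ?J)^2) / (real (m q) + real ?J))"
        unfolding b_def by (rule central_binomial_ratio_bounds(2)[OF True])
      also have "\<dots> \<le> exp (- (1 / (2 * t) * real (Suc k)))"
      proof -
        have "1 / (2 * t) * real (Suc k) \<le> 1 / (2 * t) * (real (Suc k))^2"
          using t le_square_Suc[of k] by (intro mult_left_mono) auto
        also have "\<dots> = (real ?J)^2 / (2 * (t * (real (l q))^2))"
          using l0[of q] by (simp add: power_mult_distrib del: mult_Suc_right)
        also have "\<dots> \<le> (real ?J)^2 / (real (m q) + real ?J)"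
        proof (rule divide_left_mono)
          have "real ?J \<le> real (m q)" using True by (simp only: of_nat_le_iff)
          thus "real (m q) + real ?J \<le> 2 * (t * (real (l q))^2)" using m_le[of q] by linarith
          show "0 < 2 * (t * (real (l q))^2) * (real (m q) + real ?J)" using t l0[of q] m0 by (intro mult_pos_pos) auto
        qed auto
        finally show ?thesis by simp
      qed
      finally show ?thesis .
    qed (simp add: b_def binomial_eq_0)
    thus "eventually (\<lambda>(k, q). norm (b k q) \<le> exp (- (1 / (2 * t) * real (Suc k)))) (at_top \<times>\<^sub>F sequentially)"
      by (intro always_eventually) auto
  qed simp
  \<comment> \<open>The square of the prefactor is the Wallis expression times l^2 / (2m + 1), and
    the latter tends to 1 / (2t).\<close>
  have const: "(\<lambda>q. real (l q) * real (2 * m q choose m q) / 4 ^ m q) \<longlonglongrightarrow> 1 / sqrt x"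
  proof -
    have "(\<lambda>q. (real (2 * m q choose m q) / 4 ^ m q)^2 * real (2 * m q + 1)) \<longlonglongrightarrow> 2 / pi"
      by (rule filterlim_compose[OF central_binomial_asymptotics m_top])
    moreover have "(\<lambda>q. 1 / (2 * (real (m q) / (real (l q))^2) + 1 / (real (l q))^2)) \<longlonglongrightarrow> 1 / (2 * t + 0)"
      by (intro tendsto_intros ml linv2) (use t in auto)
    ultimately have "(\<lambda>q. sqrt ((real (2 * m q choose m q) / 4 ^ m q)^2 * real (2 * m q + 1) *
        (1 / (2 * (real (m q) / (real (l q))^2) + 1 / (real (l q))^2)))) \<longlonglongrightarrow> sqrt (2 / pi * (1 / (2 * t + 0)))"
      by (intro tendsto_real_sqrt tendsto_mult)
    also have "2 / pi * (1 / (2 * t + 0)) = 1 / x" by (simp add: t_def)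
    also have "sqrt (1 / x) = 1 / sqrt x" by (simp add: real_sqrt_divide)
    also have "(\<lambda>q. sqrt ((real (2 * m q choose m q) / 4 ^ m q)^2 * real (2 * m q + 1) *
        (1 / (2 * (real (m q) / (real (l q))^2) + 1 / (real (l q))^2)))) = (\<lambda>q. real (l q) * real (2 * m q choose m q) / 4 ^ m q)"
    proof
      fix q
      have "(c / p)^2 * (2 * M + 1) * (1 / (2 * (M / L^2) + 1 / L^2)) = (L * c / p)^2" if "L > 0" "M \<ge> 0" for c p L M :: real
      proof -
        have "2 * (M / L^2) + 1 / L^2 = (2 * M + 1) / L^2" by (simp add: add_divide_distrib)
        moreover have "2 * M + 1 \<noteq> 0" using that by linarith
        ultimately show ?thesis by (simp add: power_mult_distrib power_divide)
      qed
      hence sq: "(real (2 * m q choose m q) / 4 ^ m q)^2 * (2 * real (m q) + 1) *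
        (1 / (2 * (real (m q) / (real (l q))^2) + 1 / (real (l q))^2)) = (real (l q) * real (2 * m q choose m q) / 4 ^ m q)^2"
        using l0 by auto
      have odd: "real (2 * m q + 1) = 2 * real (m q) + 1" by simp
      show "sqrt ((real (2 * m q choose m q) / 4 ^ m q)^2 * real (2 * m q + 1) *
        (1 / (2 * (real (m q) / (real (l q))^2) + 1 / (real (l q))^2))) = real (l q) * real (2 * m q choose m q) / 4 ^ m q"
        unfolding odd sq real_sqrt_abs by simp
    qed
    finally show ?thesis .
  qed
  have eq: "1 + 2 * (\<Sum>v. a v q) = real (l q) * real (2 * m q choose m q) / 4 ^ m q * (1 + 2 * (\<Sum>k. b k q))" for q
  proof -
    have "(\<Sum>v. a v q) = (\<Sum>v<q. a v q)" by (rule suminf_finite) (auto simp: a_def)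
    also have "\<dots> = (\<Sum>v<q. cos (pi * real (Suc v) / real (l q)) ^ (2 * m q))" by (intro sum.cong) (auto simp: a_def)
    finally have 1: "(\<Sum>v. a v q) = (\<Sum>v<q. cos (pi * real (Suc v) / real (l q)) ^ (2 * m q))" .
    have "(\<Sum>k. b k q) = (\<Sum>k<m q. b k q)"
    proof (rule suminf_finite)
      fix k assume "k \<notin> {..<m q}"
      hence "1 * Suc k > m q" by simp
      moreover have "1 * Suc k \<le> l q * Suc k" by (intro mult_right_mono) (auto simp: l_def)
      ultimately have "m q < l q * Suc k" by linarith
      thus "b k q = 0" by (simp add: b_def binomial_eq_0 del: mult_Suc_right)
    qed simp
    thus ?thesis using finite_theta_identity[of q "m q"] 1 by (simp add: b_def l_def)
  qed
  have "(\<lambda>q. 1 + 2 * (\<Sum>v. a v q)) \<longlonglongrightarrow> 1 / sqrt x * (1 + 2 * psi (1 / x))"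
    unfolding eq psi_def by (intro tendsto_intros const tan_b)
  moreover have "(\<lambda>q. 1 + 2 * (\<Sum>v. a v q)) \<longlonglongrightarrow> 1 + 2 * psi x"
    unfolding psi_def by (intro tendsto_intros tan_a)
  ultimately show ?thesis using LIMSEQ_unique by fastforce
qed

section \<open>The completed zeta function as a power series\<close>

lemma summable_psi:
  assumes "x > 0"
  shows "summable (\<lambda>n. exp (- (pi * (real (Suc n))^2 * x)))"
proof (rule summable_comparison_test')
  show "summable (\<lambda>n. exp (- (pi * x * real (Suc n))))" using assms by (intro summable_exp_neg_Suc) simp
  fix n :: nat
  have "pi * x * real (Suc n) \<le> pi * x * (real (Suc n))^2"
    using assms by (intro mult_left_mono le_square_Suc) simp
  thus "norm (exp (- (pi * (real (Suc n))^2 * x))) \<le> exp (- (pi * x * real (Suc n)))" by (simp add: mult_ac)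
qed

lemma psi_pos: "x > 0 \<Longrightarrow> psi x > 0"
  unfolding psi_def by (intro suminf_pos summable_psi) auto

lemma ennreal_psi: "x > 0 \<Longrightarrow> ennreal (psi x) = (\<Sum>n. ennreal (exp (- (pi * (real (Suc n))^2 * x))))"
  unfolding psi_def by (intro suminf_ennreal2[symmetric] summable_psi) auto

lemma borel_measurable_psi_exp [measurable]: "(\<lambda>u. psi (exp u)) \<in> borel_measurable borel"
  unfolding psi_def by measurable

text \<open>Euler's integral with t = exp u. In this variable scaling is a translation and x -> 1/x
  is u -> -u; nonnegative integrals allow sums to be exchanged freely.\<close>

lemma nn_integral_Gamma_exp:
  assumes a: "a > 0"
  shows "(\<integral>\<^sup>+u. ennreal (exp (a * u - exp u)) \<partial>lborel) = ennreal (Gamma a)"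
proof -
  define f where "f t = t powr (a - 1) / exp t" for t :: real
  have "(f has_integral Gamma a) {0..}" unfolding f_def by (rule Gamma_integral_real[OF a])
  hence f: "(f has_integral Gamma a) {0<..}"
    by (rule has_integral_spike_set_eq[THEN iffD1, rotated -1])
       (rule negligible_subset[of "{0}"], auto)+
  have "f absolutely_integrable_on {0<..}"
    using f by (intro nonnegative_absolutely_integrable_1) (auto simp: f_def integrable_on_def)
  moreover have "integral {0<..} f = Gamma a" using f by (rule integral_unique)
  moreover have "range exp = {0::real<..}" by (auto simp: image_iff) (metis exp_ln)
  ultimately have "(\<lambda>u. \<bar>exp u\<bar> * f (exp u)) absolutely_integrable_on UNIV \<and> integral UNIV (\<lambda>u. \<bar>exp u\<bar> * f (exp u)) = Gamma a"
    by (subst has_absolute_integral_change_of_variables_1') (auto intro!: derivative_eq_intros simp: inj_on_def)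
  moreover have "\<bar>exp u\<bar> * f (exp u) = exp (a * u - exp u)" for u
    by (simp add: f_def powr_def exp_diff algebra_simps)
  ultimately have "((\<lambda>u. exp (a * u - exp u)) has_integral Gamma a) UNIV"
    by (simp add: absolutely_integrable_on_def has_integral_iff)
  from nn_integral_has_integral_lebesgue[OF _ this] show ?thesis by simp
qed

lemma nn_integral_Gamma_exp_scaled:
  assumes a: "a > 0" and c: "c > 0"
  shows "(\<integral>\<^sup>+u. ennreal (exp (a * u - c * exp u)) \<partial>lborel) = ennreal (Gamma a * c powr (- a))"
proof -
  have "(\<integral>\<^sup>+u. ennreal (exp (a * u - c * exp u)) \<partial>lborel) =
    (\<integral>\<^sup>+u. ennreal (exp (a * (- ln c + 1 * u) - c * exp (- ln c + 1 * u))) \<partial>lborel)"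
    by (subst nn_integral_real_affine[where c = 1 and t = "- ln c"]) auto
  also have "\<dots> = (\<integral>\<^sup>+u. ennreal (c powr (- a)) * ennreal (exp (a * u - exp u)) \<partial>lborel)"
  proof (intro nn_integral_cong)
    fix u
    have "exp (a * (- ln c + 1 * u) - c * exp (- ln c + 1 * u)) = c powr (- a) * exp (a * u - exp u)"
    proof -
      have "c * exp (- ln c + 1 * u) = exp u" using c by (simp only: exp_add) (simp add: exp_minus)
      thus ?thesis using c by (simp only:) (simp add: powr_def algebra_simps flip: exp_add)
    qed
    thus "ennreal (exp (a * (- ln c + 1 * u) - c * exp (- ln c + 1 * u))) = ennreal (c powr (- a)) * ennreal (exp (a * u - exp u))"
      by (simp add: ennreal_mult)
  qed
  also have "\<dots> = ennreal (c powr (- a)) * ennreal (Gamma a)"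
    by (subst nn_integral_cmult) (simp_all add: nn_integral_Gamma_exp[OF a])
  finally show ?thesis using a by (simp add: ennreal_mult Gamma_real_pos less_imp_le mult.commute)
qed

lemma summable_inverse_powr_Suc:
  assumes "s > (1::real)"
  shows "summable (\<lambda>n. 1 / real (Suc n) powr s)"
proof -
  have "summable (\<lambda>n. real n powr (- s))" using assms by (simp add: summable_real_powr_iff)
  hence "summable (\<lambda>n. real (Suc n) powr (- s))" by (subst summable_Suc_iff)
  thus ?thesis by (simp only: powr_minus_divide)
qed

text \<open>Riemann's Mellin transform of \<open>psi\<close> at s/2: the n-th term scales by pi n^2,
  hence the power n^(-s).\<close>

lemma nn_integral_psi_exp:
  assumes s: "s > 1"
  shows "(\<integral>\<^sup>+u. ennreal (psi (exp u) * exp (s / 2 * u)) \<partial>lborel) =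
    ennreal (pi powr (- s / 2) * Gamma (s / 2) * (\<Sum>n. 1 / real (Suc n) powr s))"
proof -
  define C where "C = pi powr (- s / 2) * Gamma (s / 2)"
  have C: "C \<ge> 0" using s by (auto simp: C_def intro!: mult_nonneg_nonneg less_imp_le[OF Gamma_real_pos])
  have sm: "summable (\<lambda>n. 1 / real (Suc n) powr s)"
    by (rule summable_inverse_powr_Suc[OF s])
  have "(\<integral>\<^sup>+u. ennreal (psi (exp u) * exp (s / 2 * u)) \<partial>lborel) =
     (\<integral>\<^sup>+u. (\<Sum>n. ennreal (exp (s / 2 * u - pi * (real (Suc n))^2 * exp u))) \<partial>lborel)"
  proof (intro nn_integral_cong)
    fix u :: real
    have "ennreal (psi (exp u) * exp (s / 2 * u)) = ennreal (psi (exp u)) * ennreal (exp (s / 2 * u))"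
      using psi_pos[of "exp u"] by (intro ennreal_mult) auto
    also have "\<dots> = (\<Sum>n. ennreal (exp (- (pi * (real (Suc n))^2 * exp u))) * ennreal (exp (s / 2 * u)))"
      by (simp only: ennreal_psi[OF exp_gt_zero] ennreal_suminf_multc)
    also have "\<dots> = (\<Sum>n. ennreal (exp (s / 2 * u - pi * (real (Suc n))^2 * exp u)))"
      by (intro suminf_cong, subst ennreal_mult[symmetric]) (simp_all add: mult_exp_exp)
    finally show "ennreal (psi (exp u) * exp (s / 2 * u)) = \<dots>" .
  qed
  also have "\<dots> = (\<Sum>n. \<integral>\<^sup>+u. ennreal (exp (s / 2 * u - pi * (real (Suc n))^2 * exp u)) \<partial>lborel)"
    by (intro nn_integral_suminf) measurable
  also have "\<dots> = (\<Sum>n. ennreal (C * (1 / real (Suc n) powr s)))"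
  proof (intro suminf_cong)
    fix n
    have "(\<integral>\<^sup>+u. ennreal (exp (s / 2 * u - pi * (real (Suc n))^2 * exp u)) \<partial>lborel)
       = ennreal (Gamma (s / 2) * (pi * (real (Suc n))^2) powr (- (s / 2)))"
      using s by (intro nn_integral_Gamma_exp_scaled) auto
    also have "(pi * (real (Suc n))^2) powr (- (s / 2)) = pi powr (- s / 2) * (1 / real (Suc n) powr s)"
    proof -
      have "(real (Suc n))^2 = real (Suc n) powr 2" by simp
      hence "((real (Suc n))^2) powr (- (s / 2)) = real (Suc n) powr (2 * (- (s / 2)))" by (simp only: powr_powr)
      thus ?thesis by (subst powr_mult) (auto simp: powr_minus_divide)
    qed
    finally show "(\<integral>\<^sup>+u. ennreal (exp (s / 2 * u - pi * (real (Suc n))^2 * exp u)) \<partial>lborel) = ennreal (C * (1 / real (Suc n) powr s))"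
      by (simp add: C_def mult_ac)
  qed
  also have "\<dots> = ennreal (C * (\<Sum>n. 1 / real (Suc n) powr s))"
  proof -
    have "(\<Sum>n. ennreal (C * (1 / real (Suc n) powr s))) = ennreal (\<Sum>n. C * (1 / real (Suc n) powr s))"
      by (rule suminf_ennreal2) (use C summable_mult[OF sm] in auto)
    thus ?thesis by (simp only: suminf_mult[OF sm])
  qed
  finally show ?thesis by (simp add: C_def)
qed

lemma cosh_sums: "(\<lambda>j. y ^ (2 * j) / fact (2 * j)) sums cosh y" for y :: real
proof -
  have "(\<lambda>j. (if even (2 * j) then y ^ (2 * j) /\<^sub>R fact (2 * j) else 0)) sums cosh y"
    by (subst sums_mono_reindex) (use cosh_converges[of y] in \<open>auto simp: strict_mono_def elim!: evenE\<close>)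
  thus ?thesis by (simp add: divide_inverse mult.commute)
qed

text \<open>Where \<open>z = s - 1/2\<close>: the theta transformation folds the integral over \<open>u < 0\<close> onto \<open>u > 0\<close>.\<close>
lemma psi_fold:
  fixes u s :: real
  assumes u: "u \<ge> 0"
  shows "psi (exp u) * exp (s / 2 * u) + psi (exp (- u)) * exp (s / 2 * (- u)) =
    2 * psi (exp u) * exp (u / 4) * cosh ((s - 1 / 2) / 2 * u) + (exp (- ((s - 1) / 2) * u) - exp (- (s / 2) * u)) / 2"
proof -
  have sqrt: "sqrt (exp (- u)) = exp (- (u / 2))"
    by (rule real_sqrt_unique) (simp_all flip: exp_double)
  have inv: "1 / exp (- u) = exp u" by (simp only: exp_minus divide_inverse inverse_inverse_eq mult_1_left)
  have "1 + 2 * psi (exp (- u)) = (1 + 2 * psi (exp u)) / exp (- (u / 2))"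
    using theta_transformation[of "exp (- u)"] unfolding sqrt inv by simp
  also have "\<dots> = (1 + 2 * psi (exp u)) * exp (u / 2)"
    by (simp only: exp_minus divide_inverse inverse_inverse_eq)
  finally have "1 + 2 * psi (exp (- u)) = (1 + 2 * psi (exp u)) * exp (u / 2)" .
  hence "1 + 2 * psi (exp (- u)) = exp (u / 2) + 2 * (psi (exp u) * exp (u / 2))"
    by (simp only: distrib_right mult_1_left mult.assoc)
  hence "psi (exp (- u)) = psi (exp u) * exp (u / 2) + (exp (u / 2) - 1) / 2"
  proof -
    have "a = b + (e - 1) / 2" if "1 + 2 * a = e + 2 * b" for a b e :: real using that by (simp add: field_simps)
    from this[OF \<open>1 + 2 * psi (exp (- u)) = exp (u / 2) + 2 * (psi (exp u) * exp (u / 2))\<close>] show ?thesis .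
  qed
  hence f1: "psi (exp (- u)) * exp (s / 2 * (- u)) =
      psi (exp u) * (exp (u / 2) * exp (s / 2 * (- u))) + (exp (u / 2) * exp (s / 2 * (- u)) - exp (s / 2 * (- u))) / 2"
    by (simp add: algebra_simps)
  have f2: "exp (u / 2) * exp (s / 2 * (- u)) = exp (- ((s - 1) / 2) * u)"
    by (simp add: algebra_simps diff_divide_distrib flip: exp_add)
  have f3: "exp (s / 2 * (- u)) = exp (- (s / 2) * u)" by simp
  have f4: "2 * exp (u / 4) * cosh ((s - 1 / 2) / 2 * u) = exp (s / 2 * u) + exp (- ((s - 1) / 2) * u)"
    by (simp add: cosh_def algebra_simps diff_divide_distrib add_divide_distrib flip: exp_add)
  have "P * a + (P * b + D) = 2 * P * e * h + D" if "2 * e * h = a + b" for P a b D e h :: real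
    using that by algebra
  from this[OF f4] show ?thesis unfolding f1 unfolding f2 unfolding f3 .
qed

lemma nn_integral_exp_difference:
  assumes s: "s > 1"
  shows "(\<integral>\<^sup>+u. indicator {0..} u * ennreal ((exp (- ((s - 1) / 2) * u) - exp (- (s / 2) * u)) / 2) \<partial>lborel)
     = ennreal (1 / (s - 1) - 1 / s)"
proof -
  define D where "D u = (exp (- ((s - 1) / 2) * u) - exp (- (s / 2) * u)) / 2" for u
  have int: "((\<lambda>u. (exp (- ((s - 1) / 2) * u) - exp (- (s / 2) * u)) / 2) has_integral
     (exp (- ((s - 1) / 2) * 0) / ((s - 1) / 2) - exp (- (s / 2) * 0) / (s / 2)) / 2) {0..}"
    using s by (intro has_integral_divide has_integral_diff has_integral_exp_minus_to_infinity) auto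
  have val: "(exp (- ((s - 1) / 2) * 0) / ((s - 1) / 2) - exp (- (s / 2) * 0) / (s / 2)) / 2 = 1 / (s - 1) - 1 / s"
    using s by (simp add: field_simps)
  have "(D has_integral 1 / (s - 1) - 1 / s) {0..}" unfolding D_def[abs_def] by (rule int[unfolded val])
  \<comment> \<open>\<open>D\<close> is negative for u < 0; with |u| it is nonnegative on the whole
    line, as the passage to \<open>nn_integral\<close> requires.\<close>
  hence "((\<lambda>u. D \<bar>u\<bar>) has_integral 1 / (s - 1) - 1 / s) {0..}" by (rule has_integral_eq[rotated]) auto
  moreover have "D \<bar>u\<bar> \<ge> 0" for u by (simp add: D_def mult_right_mono)
  ultimately have "(\<integral>\<^sup>+u. indicator {0..} u * ennreal (D \<bar>u\<bar>) \<partial>lborel) = ennreal (1 / (s - 1) - 1 / s)"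
    using nn_integral_has_integral_lebesgue[where f = "\<lambda>u. D \<bar>u\<bar>"] by (simp add: ennreal_mult' ennreal_indicator)
  also have "(\<integral>\<^sup>+u. indicator {0..} u * ennreal (D \<bar>u\<bar>) \<partial>lborel) = (\<integral>\<^sup>+u. indicator {0..} u * ennreal (D u) \<partial>lborel)"
    by (intro nn_integral_cong) (auto simp: indicator_def)
  finally show ?thesis by (simp add: D_def)
qed

text \<open>\<open>c j\<close> is the integral over u >= 0 of 2 psi (exp u) exp (u/4) (u/2)^(2j) /
  (2j)!, from the cosh series in \<open>psi_fold\<close> integrated term by term. All terms are
  nonnegative, so the computation runs in \<open>ennreal\<close>, and finiteness of the zeta side
  yields convergence.\<close>

theorem completed_zeta_expansion:
  obtains c :: "nat \<Rightarrow> real" where "\<And>j. c j > 0"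
    "\<And>s. s > 1 \<Longrightarrow> (\<lambda>j. c j * (s - 1 / 2) ^ (2 * j)) sums
        (pi powr (- s / 2) * Gamma (s / 2) * (\<Sum>n. 1 / real (Suc n) powr s) - (1 / (s - 1) - 1 / s))"
proof -
  define k where "k j u = 2 * psi (exp u) * exp (u / 4) * ((u / 2) ^ (2 * j) / fact (2 * j))" for j and u :: real
  have k_meas [measurable]: "k j \<in> borel_measurable borel" for j unfolding k_def by measurable
  have k_nonneg: "k j u \<ge> 0" for j u
    using psi_pos[of "exp u"] by (auto simp: k_def intro!: mult_nonneg_nonneg divide_nonneg_nonneg)
  define C where "C j = (\<integral>\<^sup>+u. indicator {0..} u * ennreal (k j u) \<partial>lborel)" for j
  define \<Lambda> where "\<Lambda> s = pi powr (- s / 2) * Gamma (s / 2) * (\<Sum>n. 1 / real (Suc n) powr s)" for s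
  have main: "(\<Sum>j. C j * ennreal ((s - 1 / 2) ^ (2 * j))) + ennreal (1 / (s - 1) - 1 / s) = ennreal (\<Lambda> s)" if s: "s > 1" for s
  proof -
    define G where "G u = ennreal (psi (exp u) * exp (s / 2 * u))" for u
    define D where "D u = (exp (- ((s - 1) / 2) * u) - exp (- (s / 2) * u)) / 2" for u
    have G_meas [measurable]: "G \<in> borel_measurable borel" unfolding G_def by measurable
    have G_meas' [measurable]: "(\<lambda>u. G (- u)) \<in> borel_measurable borel" by (rule measurable_compose[OF _ G_meas]) measurable
    have D_meas [measurable]: "D \<in> borel_measurable borel" unfolding D_def by measurable
    have pt: "indicator {0..} u * (G u + G (- u)) =
        (\<Sum>j. indicator {0..} u * (ennreal (k j u) * ennreal ((s - 1 / 2) ^ (2 * j)))) + indicator {0..} u * ennreal (D u)" for u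
    proof (cases "u \<ge> 0")
      case True
      have D0: "D u \<ge> 0" using True by (simp add: D_def mult_right_mono)
      have "(\<lambda>j. (2 * psi (exp u) * exp (u / 4)) * (((s - 1 / 2) / 2 * u) ^ (2 * j) / fact (2 * j))) sums
          (2 * psi (exp u) * exp (u / 4) * cosh ((s - 1 / 2) / 2 * u))"
        by (intro sums_mult cosh_sums)
      also have "(\<lambda>j. (2 * psi (exp u) * exp (u / 4)) * (((s - 1 / 2) / 2 * u) ^ (2 * j) / fact (2 * j))) =
          (\<lambda>j. k j u * (s - 1 / 2) ^ (2 * j))"
      proof
        fix j
        have "((s - 1 / 2) / 2 * u) ^ (2 * j) = (u / 2) ^ (2 * j) * (s - 1 / 2) ^ (2 * j)"
          by (subst power_mult_distrib[symmetric]) (simp add: mult.commute)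
        thus "(2 * psi (exp u) * exp (u / 4)) * (((s - 1 / 2) / 2 * u) ^ (2 * j) / fact (2 * j)) = k j u * (s - 1 / 2) ^ (2 * j)"
          by (simp add: k_def)
      qed
      finally have "(\<Sum>j. ennreal (k j u * (s - 1 / 2) ^ (2 * j))) = ennreal (2 * psi (exp u) * exp (u / 4) * cosh ((s - 1 / 2) / 2 * u))"
        using k_nonneg s by (intro suminf_ennreal_eq) auto
      hence "(\<Sum>j. ennreal (k j u) * ennreal ((s - 1 / 2) ^ (2 * j))) + ennreal (D u) =
         ennreal (2 * psi (exp u) * exp (u / 4) * cosh ((s - 1 / 2) / 2 * u)) + ennreal (D u)"
        using k_nonneg s by (simp add: ennreal_mult)
      also have "\<dots> = ennreal (2 * psi (exp u) * exp (u / 4) * cosh ((s - 1 / 2) / 2 * u) + D u)"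
        using psi_pos[of "exp u"] D0 by (intro ennreal_plus[symmetric]) (auto simp: cosh_real_nonneg)
      also have "\<dots> = ennreal (psi (exp u) * exp (s / 2 * u) + psi (exp (- u)) * exp (s / 2 * (- u)))"
        unfolding psi_fold[OF True] D_def ..
      also have "\<dots> = G u + G (- u)" unfolding G_def
        using psi_pos[of "exp u"] psi_pos[of "exp (- u)"] by (intro ennreal_plus) auto
      finally show ?thesis using True by simp
    qed simp
    have "ennreal (\<Lambda> s) = (\<integral>\<^sup>+u. G u \<partial>lborel)" unfolding G_def \<Lambda>_def by (rule nn_integral_psi_exp[OF s, symmetric])
    also have "\<dots> = (\<integral>\<^sup>+u. indicator {0..} u * G u + indicator {..<0} u * G u \<partial>lborel)"
      by (intro nn_integral_cong) (auto simp: indicator_def)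
    also have "\<dots> = (\<integral>\<^sup>+u. indicator {0..} u * G u \<partial>lborel) + (\<integral>\<^sup>+u. indicator {..<0} u * G u \<partial>lborel)"
      by (intro nn_integral_add) measurable
    also have "(\<integral>\<^sup>+u. indicator {..<0} u * G u \<partial>lborel) = (\<integral>\<^sup>+u. indicator {..<0} (- u) * G (- u) \<partial>lborel)"
      by (subst nn_integral_real_affine[where c = "-1" and t = 0]) auto
    also have "\<dots> = (\<integral>\<^sup>+u. indicator {0..} u * G (- u) \<partial>lborel)"
    proof (rule nn_integral_cong_AE)
      have "AE u in lborel. u \<noteq> (0::real)" by (rule AE_lborel_singleton)
      thus "AE u in lborel. indicator {..<0} (- u) * G (- u) = indicator {0..} u * G (- u)"
        by eventually_elim (auto simp: indicator_def)
    qed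
    also have "(\<integral>\<^sup>+u. indicator {0..} u * G u \<partial>lborel) + \<dots> = (\<integral>\<^sup>+u. indicator {0..} u * (G u + G (- u)) \<partial>lborel)"
      by (simp add: distrib_left nn_integral_add)
    also have "\<dots> = (\<integral>\<^sup>+u. (\<Sum>j. indicator {0..} u * (ennreal (k j u) * ennreal ((s - 1 / 2) ^ (2 * j)))) + indicator {0..} u * ennreal (D u) \<partial>lborel)"
      by (simp only: pt)
    also have "\<dots> = (\<integral>\<^sup>+u. (\<Sum>j. indicator {0..} u * (ennreal (k j u) * ennreal ((s - 1 / 2) ^ (2 * j)))) \<partial>lborel) + (\<integral>\<^sup>+u. indicator {0..} u * ennreal (D u) \<partial>lborel)"
      by (intro nn_integral_add) measurable
    also have "(\<integral>\<^sup>+u. (\<Sum>j. indicator {0..} u * (ennreal (k j u) * ennreal ((s - 1 / 2) ^ (2 * j)))) \<partial>lborel) = (\<Sum>j. \<integral>\<^sup>+u. indicator {0..} u * (ennreal (k j u) * ennreal ((s - 1 / 2) ^ (2 * j))) \<partial>lborel)"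
      by (intro nn_integral_suminf) measurable
    also have "(\<lambda>j. \<integral>\<^sup>+u. indicator {0..} u * (ennreal (k j u) * ennreal ((s - 1 / 2) ^ (2 * j))) \<partial>lborel) = (\<lambda>j. C j * ennreal ((s - 1 / 2) ^ (2 * j)))"
      by (intro ext) (simp add: C_def nn_integral_multc flip: mult.assoc)
    also have "(\<integral>\<^sup>+u. indicator {0..} u * ennreal (D u) \<partial>lborel) = ennreal (1 / (s - 1) - 1 / s)"
      unfolding D_def by (rule nn_integral_exp_difference[OF s])
    finally show ?thesis ..
  qed
  have C_fin: "C j \<noteq> top" for j
  proof
    assume "C j = top"
    hence "C j * ennreal ((2 - 1 / 2) ^ (2 * j)) = top" by (simp add: ennreal_top_mult)
    moreover have "(\<Sum>j. C j * ennreal ((2 - 1 / 2) ^ (2 * j))) \<noteq> top"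
      using main[of 2] by (metis ennreal_add_eq_top ennreal_neq_top one_less_numeral_iff semiring_norm(76))
    hence "(\<Sum>j. C j * ennreal ((2 - 1 / 2) ^ (2 * j))) < top" by (simp add: less_top)
    hence "C j * ennreal ((2 - 1 / 2) ^ (2 * j)) < top" by (rule ennreal_suminf_lessD)
    ultimately show False by simp
  qed
  define c where "c j = enn2real (C j)" for j
  have Cc: "C j = ennreal (c j)" for j using C_fin[of j] by (simp add: c_def less_top)
  have c_nonneg: "c j \<ge> 0" for j by (simp add: c_def)
  have c_pos: "c j > 0" for j
  proof -
    have "C j \<noteq> 0"
    proof
      assume "C j = 0"
      hence "AE u in lborel. indicator {0..} u * ennreal (k j u) = 0"
        unfolding C_def by (subst (asm) nn_integral_0_iff_AE) auto
      hence ae: "AE u in lborel. u \<notin> {0::real<..<1}"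
      proof eventually_elim
        case (elim u)
        show ?case
        proof
          assume u: "u \<in> {0<..<1}"
          hence "k j u > 0" using psi_pos[of "exp u"] by (simp add: k_def)
          thus False using elim u by simp
        qed
      qed
      have set: "{u \<in> space lborel. \<not> u \<notin> {0::real<..<1}} = {0<..<1}" by auto
      have "emeasure lborel {0::real<..<1} = 0" by (rule AE_iff_measurable[THEN iffD1, OF _ set ae]) simp
      thus False by simp
    qed
    thus ?thesis using c_nonneg[of j] Cc[of j] by (cases "c j = 0") auto
  qed
  show thesis
  proof (rule that[of c])
    fix s :: real assume s: "s > 1"
    define b where "b = 1 / (s - 1) - 1 / s"
    have b: "b \<ge> 0" using s by (simp add: b_def field_simps)
    have "(\<Sum>j. ennreal (c j * (s - 1 / 2) ^ (2 * j))) + ennreal b = ennreal (\<Lambda> s)"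
      using main[OF s] c_nonneg s by (simp add: Cc ennreal_mult b_def)
    moreover from this have ne: "(\<Sum>j. ennreal (c j * (s - 1 / 2) ^ (2 * j))) \<noteq> top"
      by (metis ennreal_add_eq_top ennreal_neq_top)
    have nonneg: "c j * (s - 1 / 2) ^ (2 * j) \<ge> 0" for j using c_nonneg s by simp
    have sm: "summable (\<lambda>j. c j * (s - 1 / 2) ^ (2 * j))" by (rule summable_suminf_not_top[OF nonneg ne])
    define S where "S = (\<Sum>j. c j * (s - 1 / 2) ^ (2 * j))"
    have S: "S \<ge> 0" unfolding S_def by (rule suminf_nonneg[OF sm nonneg])
    ultimately have "ennreal (S + b) = ennreal (\<Lambda> s)"
      using suminf_ennreal[OF nonneg ne] b by (simp add: S_def)
    moreover have "\<Lambda> s \<ge> 0"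
      unfolding \<Lambda>_def using s
      by (intro mult_nonneg_nonneg less_imp_le[OF Gamma_real_pos] suminf_nonneg summable_inverse_powr_Suc) auto
    ultimately have "S + b = \<Lambda> s" using S b by (simp add: ennreal_inj del: ennreal_plus)
    hence "S = \<Lambda> s - b" by simp
    thus "(\<lambda>j. c j * (s - 1 / 2) ^ (2 * j)) sums (pi powr (- s / 2) * Gamma (s / 2) * (\<Sum>n. 1 / real (Suc n) powr s) - (1 / (s - 1) - 1 / s))"
      using summable_sums[OF sm] by (simp add: S_def \<Lambda>_def b_def)
  qed (rule c_pos)
qed

section \<open>Continuation of zeta and the coefficients of xi\<close>

text \<open>The formula for \<open>a j\<close> makes coefficients unique, which settles the
  \<open>THE\<close> in \<open>xi_coeff\<close> and identifies limits of polynomial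
  coefficients.\<close>

lemma entire_power_series:
  fixes a :: "nat \<Rightarrow> complex"
  assumes sums: "\<And>w. (\<lambda>j. a j * w ^ j) sums F w"
  shows "F holomorphic_on UNIV" and "a j = (deriv ^^ j) F 0 / fact j"
proof -
  have "F holomorphic_on ball 0 r" for r
    by (rule power_series_holomorphic[where a = a]) (use sums in auto)
  hence "F analytic_on ball 0 r" for r by (simp add: analytic_on_open)
  hence "F analytic_on {z}" for z
    by (rule analytic_on_subset[of _ "ball 0 (norm z + 1)"]) auto
  hence "F analytic_on UNIV" using analytic_on_analytic_at by blast
  thus "F holomorphic_on UNIV" by (rule analytic_imp_holomorphic)
  have "F has_fps_expansion Abs_fps a"
    unfolding has_fps_expansion_def
  proof (intro conjI always_eventually allI)
    have "norm (1 :: complex) \<le> conv_radius a"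
      using sums[of 1] by (intro conv_radius_geI) (auto simp: sums_iff)
    hence "0 < conv_radius a" by (rule less_le_trans[rotated]) simp
    thus "fps_conv_radius (Abs_fps a) > 0" by (simp add: fps_conv_radius_def)
    show "eval_fps (Abs_fps a) w = F w" for w
      using sums_unique[OF sums[of w]] by (simp add: eval_fps_def)
  qed
  from fps_nth_fps_expansion[OF this, of j] show "a j = (deriv ^^ j) F 0 / fact j" by simp
qed

text \<open>Holomorphy of the Dirichlet series lets an identity known for real s > 1 extend to the
  half plane.\<close>

lemma zeta_series_holomorphic:
  obtains D where "D holomorphic_on {s. Re s > 1}"
    "\<And>s. Re s > 1 \<Longrightarrow> (\<lambda>n. 1 / of_nat (Suc n) powr s) sums D s"
proof -
  have op: "open {s. Re s > 1}" by (simp add: open_halfspace_Re_gt)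
  obtain D where D: "\<forall>s\<in>{s. Re s > 1}. ((\<lambda>n. 1 / of_nat (Suc n) powr s) sums D s) \<and> D field_differentiable (at s)"
  proof (rule series_differentiable_comparison_complex[OF op])
    show "(\<lambda>s. 1 / of_nat (Suc n) powr s) field_differentiable at x" if "x \<in> {s. Re s > 1}" for n x
    proof (rule holomorphic_on_imp_differentiable_at[OF _ open_UNIV])
      have "of_nat (Suc n) \<noteq> (0::complex)" by (rule of_nat_neq_0)
      thus "(\<lambda>s. 1 / of_nat (Suc n) powr s :: complex) holomorphic_on UNIV"
        by (intro holomorphic_intros) auto
    qed simp
    fix x :: complex assume x: "x \<in> {s. Re s > 1}"
    \<comment> \<open>Half the distance to the line Re s = 1, so that Re y >= 1 + d on the whole
      ball.\<close>
    define d where "d = (Re x - 1) / 2"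
    define h where "h n = complex_of_real (1 / real (Suc n) powr (1 + d))" for n
    have d: "d > 0" using x by (simp add: d_def)
    have "summable h" unfolding h_def
      by (rule summable_of_real, rule summable_inverse_powr_Suc) (use d in simp)
    moreover have "range h \<subseteq> \<real>\<^sub>\<ge>\<^sub>0" by (auto simp: h_def)
    moreover have "cmod (1 / of_nat (Suc n) powr y) \<le> cmod (h n)" if y: "y \<in> ball x d \<inter> {s. Re s > 1}" for n y
    proof -
      have "Re x - Re y \<le> cmod (x - y)" using complex_Re_le_cmod[of "x - y"] by simp
      moreover have "cmod (x - y) < d" using y by (simp add: dist_norm)
      moreover have "2 * d = Re x - 1" by (simp add: d_def)
      ultimately have "1 + d \<le> Re y" by linarith
      hence "real (Suc n) powr (1 + d) \<le> real (Suc n) powr Re y" by (intro powr_mono) auto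
      moreover have "cmod (of_nat (Suc n) powr y) = real (Suc n) powr Re y"
        by (subst norm_powr_real_powr) auto
      moreover have "real (Suc n) powr (1 + d) > 0" by simp
      ultimately show ?thesis by (simp only: norm_divide h_def norm_of_real norm_one abs_of_pos) (simp add: frac_le)
    qed
    ultimately show "\<exists>d h. 0 < d \<and> summable h \<and> range h \<subseteq> \<real>\<^sub>\<ge>\<^sub>0 \<and>
        (\<forall>\<^sub>F n in sequentially. \<forall>y\<in>ball x d \<inter> {s. Re s > 1}. cmod (1 / of_nat (Suc n) powr y) \<le> cmod (h n))"
      using d by (intro exI[of _ d] exI[of _ h]) auto
  qed
  show thesis
    by (rule that[of D]) (use D op in \<open>auto simp: holomorphic_on_def intro: field_differentiable_at_within\<close>)
qed

locale xi_expansion =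
  fixes c :: "nat \<Rightarrow> real"
  assumes c_pos: "c j > 0"
    and c_sums: "s > 1 \<Longrightarrow> (\<lambda>j. c j * (s - 1 / 2) ^ (2 * j)) sums
        (pi powr (- s / 2) * Gamma (s / 2) * (\<Sum>n. 1 / real (Suc n) powr s) - (1 / (s - 1) - 1 / s))"
begin

lemma c_summable: "summable (\<lambda>j. c j * x ^ j)" if "x \<ge> 0"
proof -
  \<comment> \<open>(s - 1/2)^2 = (x + 3/2)^2 dominates x, so the series at x is compared with one
    known to converge.\<close>
  define s where "s = 2 + x"
  have "summable (\<lambda>j. c j * (s - 1 / 2) ^ (2 * j))" 
    by (rule sums_summable[OF c_sums]) (use that in \<open>simp add: s_def\<close>)
  moreover have "norm (c j * x ^ j) \<le> c j * (s - 1 / 2) ^ (2 * j)" for j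
  proof -
    have "(s - 1 / 2)^2 = 9 / 4 + 3 * x + x * x" unfolding s_def by algebra
    hence "x \<le> (s - 1 / 2)^2" using that by simp
    hence "x ^ j \<le> ((s - 1 / 2)^2) ^ j" using that by (intro power_mono) auto
    hence "c j * x ^ j \<le> c j * (s - 1 / 2) ^ (2 * j)" using c_pos[of j] by (simp add: power_mult)
    moreover have "norm (c j * x ^ j) = c j * x ^ j" using that c_pos[of j] by (simp add: abs_mult)
    ultimately show ?thesis by simp
  qed
  ultimately show ?thesis by (rule summable_comparison_test'[where N = 0])
qed

definition C :: "complex \<Rightarrow> complex" where "C w = (\<Sum>j. of_real (c j) * w ^ j)"

lemma C_sums: "(\<lambda>j. of_real (c j) * w ^ j) sums C w"
proof -
  have "norm (of_real (c j) * w ^ j) = c j * norm w ^ j" for j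
    by (simp add: norm_mult norm_power abs_of_pos[OF c_pos])
  hence "summable (\<lambda>j. norm (of_real (c j) * w ^ j))"
    using c_summable[OF norm_ge_zero, of w] by (simp only:)
  thus ?thesis unfolding C_def by (rule summable_sums[OF summable_norm_cancel])
qed

lemma C_holomorphic: "C holomorphic_on A"
  by (rule holomorphic_on_subset[OF entire_power_series(1)[OF C_sums]]) auto

lemma C_of_real: "C (of_real x) = of_real (\<Sum>j. c j * x ^ j)" if "x \<ge> 0"
proof (rule sums_unique2[OF C_sums])
  have "(\<lambda>j. complex_of_real (c j * x ^ j)) sums of_real (\<Sum>j. c j * x ^ j)"
    by (intro sums_of_real summable_sums c_summable that)
  thus "(\<lambda>j. complex_of_real (c j) * of_real x ^ j) sums of_real (\<Sum>j. c j * x ^ j)"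
    by (simp only: of_real_mult of_real_power)
qed

lemma norm_C_le: "cmod (C w) \<le> Re (C (of_real x))" if "cmod w \<le> x"
proof -
  have x: "x \<ge> 0" using that norm_ge_zero order_trans by blast
  have "cmod (of_real (c j) * w ^ j) \<le> c j * x ^ j" for j
    using that c_pos[of j] by (simp add: norm_mult norm_power power_mono abs_of_pos[OF c_pos])
  hence "cmod (\<Sum>j. of_real (c j) * w ^ j) \<le> (\<Sum>j. c j * x ^ j)"
    by (rule norm_suminf_le) (rule c_summable[OF x])
  thus ?thesis unfolding C_of_real[OF x] by (simp add: C_def)
qed

text \<open>With s = 1/2 + z and w = z^2 one has s (s - 1) = w - 1/4 and s (s - 1) (1/(s - 1) - 1/s)
  = 1, so this is xi (1/2 + z).\<close>

definition F :: "complex \<Rightarrow> complex" where "F w = 1 / 2 + (w - 1 / 4) * C w / 2"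

lemma F_holomorphic: "F holomorphic_on A"
  unfolding F_def[abs_def] by (intro holomorphic_intros C_holomorphic) auto

text \<open>Taylor coefficients of \<open>F\<close>. As differences of positive numbers they show no
  sign; positivity has to come from the zeros of \<open>F\<close>.\<close>

definition f :: "nat \<Rightarrow> real" where
  "f j = (case j of 0 \<Rightarrow> 1 / 2 - c 0 / 8 | Suc i \<Rightarrow> c i / 2 - c (Suc i) / 8)"

lemma F_sums: "(\<lambda>j. of_real (f j) * w ^ j) sums F w"
proof -
  have "(\<lambda>j. of_real (c (Suc j)) * w ^ Suc j) sums (C w - of_real (c 0) * w ^ 0)"
    using C_sums[of w] by (subst sums_Suc_iff) simp
  hence "(\<lambda>j. w / 2 * (of_real (c j) * w ^ j) - 1 / 8 * (of_real (c (Suc j)) * w ^ Suc j)) sums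
      (w / 2 * C w - 1 / 8 * (C w - of_real (c 0) * w ^ 0))"
    by (intro sums_diff sums_mult C_sums)
  also have "(\<lambda>j. w / 2 * (of_real (c j) * w ^ j) - 1 / 8 * (of_real (c (Suc j)) * w ^ Suc j)) =
      (\<lambda>j. of_real (f (Suc j)) * w ^ Suc j)"
    by (intro ext) (simp add: f_def algebra_simps)
  finally have "(\<lambda>j. of_real (f j) * w ^ j) sums (w / 2 * C w - 1 / 8 * (C w - of_real (c 0) * w ^ 0) + of_real (f 0) * w ^ 0)"
    by (subst (asm) sums_Suc_iff) simp
  moreover have "w / 2 * C w - 1 / 8 * (C w - of_real (c 0) * w ^ 0) + of_real (f 0) * w ^ 0 = F w"
    by (simp add: F_def f_def field_simps)
  ultimately show ?thesis by (simp only:)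
qed

text \<open>
  Solves \<open>\<pi>\<^sup>-\<^sup>s\<^sup>/\<^sup>2 \<Gamma>(s/2) Z(s) = C((s - 1/2)\<^sup>2) + 1/(s-1) - 1/s\<close>, with \<open>rGamma (s/2) / s\<close> written as
  \<open>rGamma (s/2 + 1) / 2\<close> to remove the singularity at \<open>0\<close>.
\<close>
definition Z :: "complex \<Rightarrow> complex" where
  "Z s = (if s = 1 then 0 else of_real pi powr (s / 2) *
     (rGamma (s / 2) * (C ((s - 1 / 2)^2) + 1 / (s - 1)) - rGamma (s / 2 + 1) / 2))"

lemma Z_holomorphic: "Z holomorphic_on (- {1})"
proof -
  have "(\<lambda>s. of_real pi powr (s / 2) *
     (rGamma (s / 2) * (C ((s - 1 / 2)^2) + 1 / (s - 1)) - rGamma (s / 2 + 1) / 2)) holomorphic_on (- {1})"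
    by (intro holomorphic_intros holomorphic_on_compose_gen[OF _ C_holomorphic[of UNIV], unfolded o_def]) auto
  thus ?thesis by (rule holomorphic_transform) (auto simp: Z_def)
qed

lemma Z_eq:
  assumes "s / 2 \<notin> \<int>\<^sub>\<le>\<^sub>0" "s \<noteq> 1"
  shows "of_real pi powr (- s / 2) * Gamma (s / 2) * Z s = C ((s - 1 / 2)^2) + 1 / (s - 1) - 1 / s"
proof -
  have s0: "s \<noteq> 0" using assms(1) by auto
  have r: "rGamma (s / 2) \<noteq> 0" using assms(1) by (simp add: rGamma_eq_zero_iff)
  have "rGamma (s / 2 + 1) / 2 = rGamma (s / 2) / s"
    using rGamma_plus1[of "s / 2"] s0 by (simp add: field_simps)
  hence zs: "Z s = of_real pi powr (s / 2) * rGamma (s / 2) * (C ((s - 1 / 2)^2) + 1 / (s - 1) - 1 / s)"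
    using assms(2) by (simp add: Z_def algebra_simps)
  have pp: "of_real pi powr (- s / 2) * of_real pi powr (s / 2) = (1::complex)"
    by (simp add: powr_minus)
  have gg: "Gamma (s / 2) * rGamma (s / 2) = 1" using r by (simp add: Gamma_def)
  have "p * G * (q * r * X) = X" if "p * q = 1" "G * r = 1" for p q G r X :: complex
    using that by algebra
  from this[OF pp gg] show ?thesis unfolding zs .
qed

lemma Z_of_real:
  assumes s: "s > 1"
  shows "(\<lambda>n. 1 / of_nat (Suc n) powr complex_of_real s) sums Z (of_real s)"
proof -
  let ?S = "\<Sum>n. 1 / real (Suc n) powr s"
  have "complex_of_real s / 2 \<notin> \<int>\<^sub>\<le>\<^sub>0"
  proof
    assume "complex_of_real s / 2 \<in> \<int>\<^sub>\<le>\<^sub>0"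
    then obtain n where "complex_of_real s / 2 = of_int n" "n \<le> 0" by (auto elim!: nonpos_Ints_cases)
    from arg_cong[OF this(1), of Re] this(2) s show False by simp
  qed
  moreover have "complex_of_real s \<noteq> 1" using s by simp
  ultimately have "of_real pi powr (- of_real s / 2) * Gamma (of_real s / 2) * Z (of_real s) =
      C ((of_real s - 1 / 2)^2) + 1 / (of_real s - 1) - 1 / of_real s" by (rule Z_eq)
  also have "(of_real s - 1 / 2)^2 = complex_of_real ((s - 1 / 2)^2)" by simp
  also have "C (complex_of_real ((s - 1 / 2)^2)) = of_real (\<Sum>j. c j * ((s - 1 / 2)^2) ^ j)" by (rule C_of_real) simp
  also have "(\<Sum>j. c j * ((s - 1 / 2)^2) ^ j) = pi powr (- s / 2) * Gamma (s / 2) * ?S - (1 / (s - 1) - 1 / s)"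
    using c_sums[OF s] by (simp add: sums_iff power_mult)
  also have "of_real (pi powr (- s / 2) * Gamma (s / 2) * ?S - (1 / (s - 1) - 1 / s)) + 1 / (complex_of_real s - 1) - 1 / of_real s
      = of_real (pi powr (- s / 2)) * of_real (Gamma (s / 2)) * of_real ?S" by simp
  also have "complex_of_real (pi powr (- s / 2)) = of_real pi powr (- of_real s / 2)"
    using powr_of_real[of pi "- s / 2"] by simp
  also have "complex_of_real (Gamma (s / 2)) = Gamma (of_real s / 2)"
    using Gamma_complex_of_real[of "s / 2"] by simp
  finally have e: "of_real pi powr (- of_real s / 2) * Gamma (of_real s / 2) * Z (of_real s) =
      of_real pi powr (- of_real s / 2) * Gamma (of_real s / 2) * of_real ?S" .
  have "of_real pi powr (- of_real s / 2) * Gamma (complex_of_real s / 2) \<noteq> 0"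
    using \<open>complex_of_real s / 2 \<notin> \<int>\<^sub>\<le>\<^sub>0\<close> unfolding mult_eq_0_iff Gamma_eq_zero_iff by simp
  from mult_left_cancel[OF this] e have e3: "Z (of_real s) = of_real ?S" by blast
  have e1: "(\<lambda>n. complex_of_real (1 / real (Suc n) powr s)) sums of_real ?S"
    by (intro sums_of_real summable_sums summable_inverse_powr_Suc s)
  have e2: "complex_of_real (1 / real (Suc n) powr s) = 1 / of_nat (Suc n) powr complex_of_real s" for n
  proof -
    have "complex_of_real (real (Suc n)) powr complex_of_real s = complex_of_real (real (Suc n) powr s)"
      by (rule powr_of_real) (rule of_nat_0_le_iff)
    hence "of_nat (Suc n) powr complex_of_real s = complex_of_real (real (Suc n) powr s)"
      by (simp only: of_real_of_nat_eq)
    thus ?thesis by (simp only: of_real_divide of_real_1)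
  qed
  show ?thesis using e1 unfolding e2 e3 .
qed

lemma Z_sums:
  assumes "Re s > 1"
  shows "(\<lambda>n. 1 / of_nat (Suc n) powr s) sums Z s"
proof -
  obtain D where D: "D holomorphic_on {s. Re s > 1}"
    "\<And>s. Re s > 1 \<Longrightarrow> (\<lambda>n. 1 / of_nat (Suc n) powr s) sums D s"
    by (rule zeta_series_holomorphic) (rule that, assumption+)
  have "D s - Z s = 0"
  proof (rule analytic_continuation[where f = "\<lambda>s. D s - Z s" and S = "{s. Re s > 1}" and \<xi> = 2 and U = "of_real ` {1<..}"])
    show "(\<lambda>s. D s - Z s) holomorphic_on {s. Re s > 1}"
      by (intro holomorphic_on_diff D holomorphic_on_subset[OF Z_holomorphic]) auto
    show "connected {s. Re s > 1}" by (simp add: convex_connected convex_halfspace_Re_gt)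
    show "2 islimpt complex_of_real ` {1<..}"
    proof (rule islimptI)
      fix T :: "complex set" assume "2 \<in> T" "open T"
      then obtain e where e: "e > 0" "ball 2 e \<subseteq> T" by (meson openE)
      define y where "y = complex_of_real (2 + e / 2)"
      have "y - 2 = of_real (e / 2)" by (simp add: y_def)
      hence "norm (y - 2) = \<bar>e / 2\<bar>" by (simp only: norm_of_real)
      hence "norm (y - 2) = e / 2" using e(1) by simp
      hence "y \<in> ball 2 e" "y \<noteq> 2" using e(1) by (auto simp: dist_norm norm_minus_commute)
      moreover have "y \<in> complex_of_real ` {1<..}" unfolding y_def using e(1) by (intro imageI) simp
      ultimately show "\<exists>y\<in>complex_of_real ` {1<..}. y \<in> T \<and> y \<noteq> 2" using e(2) by blast
    qed
    show "D z - Z z = 0" if "z \<in> complex_of_real ` {1<..}" for z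
      using that sums_unique2[OF D(2) Z_of_real] by auto
  qed (use assms in \<open>auto simp: open_halfspace_Re_gt\<close>)
  thus ?thesis using D(2)[OF assms] by simp
qed

text \<open>Uniqueness holds because the punctured plane is connected; the clause
  \<open>f 1 = 0\<close> fixes the remaining value.\<close>

lemma riemann_zeta_eq_Z: "riemann_zeta = Z"
  unfolding riemann_zeta_def
proof (rule the_equality)
  show "Z holomorphic_on - {1} \<and> (\<forall>s. 1 < Re s \<longrightarrow> (\<lambda>n. 1 / of_nat (Suc n) powr s) sums Z s) \<and> Z 1 = 0"
    using Z_holomorphic Z_sums by (auto simp: Z_def)
  fix g assume g: "g holomorphic_on - {1} \<and> (\<forall>s. 1 < Re s \<longrightarrow> (\<lambda>n. 1 / of_nat (Suc n) powr s) sums g s) \<and> g 1 = 0"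
  show "g = Z"
  proof
    fix s show "g s = Z s"
    proof (cases "s = 1")
      case False
      show ?thesis
      proof (rule analytic_continuation_open[where s = "{s. Re s > 1}" and s' = "- {1}" and f = g and g = Z])
        show "{s. Re s > 1} \<noteq> {}" by (auto intro: exI[of _ 2])
        show "connected (- {1::complex})" by (rule connected_punctured_universe) simp
        show "g z = Z z" if "z \<in> {s. Re s > 1}" for z using that g Z_sums[of z] sums_unique2 by blast
      qed (use g Z_holomorphic False in \<open>auto simp: open_halfspace_Re_gt\<close>)
    qed (use g in \<open>simp add: Z_def\<close>)
  qed
qed

section \<open>Identification of xi and of its coefficients\<close>

lemma completed_zeta_eq_F:
  assumes "s / 2 \<notin> \<int>\<^sub>\<le>\<^sub>0" "s \<noteq> 1"
  shows "1 / 2 * s * (s - 1) * of_real pi powr (- s / 2) * Gamma (s / 2) * Z s = F ((s - 1 / 2)^2)"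
proof -
  have s0: "s \<noteq> 0" using assms(1) by auto
  have "1 / 2 * s * (s - 1) * of_real pi powr (- s / 2) * Gamma (s / 2) * Z s =
      1 / 2 * s * (s - 1) * (C ((s - 1 / 2)^2) + 1 / (s - 1) - 1 / s)"
    using Z_eq[OF assms] by (simp add: mult.assoc)
  also have "\<dots> = F ((s - 1 / 2)^2)" using s0 assms(2)
    by (simp add: F_def field_simps power2_eq_square)
  finally show ?thesis .
qed

lemma eventually_not_half_nonpos_Ints: "eventually (\<lambda>s::complex. s / 2 \<notin> \<int>\<^sub>\<le>\<^sub>0) (at s0)"
proof -
  define A where "A = {n. of_int n \<noteq> s0 / 2}"
  have "open (- (of_int ` A :: complex set))" by (rule open_Compl[OF closed_of_int_image])
  moreover have "s0 / 2 \<in> - (of_int ` A)" by (auto simp: A_def)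
  moreover have "((\<lambda>s. s / 2) \<longlongrightarrow> s0 / 2) (at s0)" by (intro tendsto_intros) auto
  ultimately have "eventually (\<lambda>s. s / 2 \<in> - (of_int ` A)) (at s0)" using topological_tendstoD by blast
  moreover have "eventually (\<lambda>s. s \<noteq> s0) (at s0)" by (simp add: eventually_at_filter)
  ultimately show ?thesis
  proof eventually_elim
    case (elim s)
    thus ?case by (auto simp: A_def elim!: nonpos_Ints_cases)
  qed
qed

text \<open>\<open>remove_sings\<close> sees only a punctured neighbourhood, and there the product
  formula agrees with the continuous right-hand side.\<close>

lemma riemann_xi_eq_F: "riemann_xi s = F ((s - 1 / 2)^2)"
  unfolding riemann_xi_def riemann_zeta_eq_Z
proof (rule remove_sings_eqI)
  have "(\<lambda>s. F ((s - 1 / 2)^2)) holomorphic_on UNIV"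
    by (intro holomorphic_on_compose_gen[OF _ F_holomorphic[of UNIV], unfolded o_def] holomorphic_intros) auto
  hence "isCont (\<lambda>s. F ((s - 1 / 2)^2)) s"
    by (meson UNIV_I continuous_on_eq_continuous_at holomorphic_on_imp_continuous_on open_UNIV)
  hence "(\<lambda>s. F ((s - 1 / 2)^2)) \<midarrow>s\<rightarrow> F ((s - 1 / 2)^2)" by (simp add: isCont_def)
  moreover have "eventually (\<lambda>s. s \<noteq> 1) (at s)"
    by (cases "s = 1") (auto simp: eventually_at_filter intro: eventually_mono[OF t1_space_nhds])
  hence "eventually (\<lambda>s. F ((s - 1 / 2)^2) = 1 / 2 * s * (s - 1) * of_real pi powr (- s / 2) * Gamma (s / 2) * Z s) (at s)"
    using eventually_not_half_nonpos_Ints[of s] by eventually_elim (rule completed_zeta_eq_F[symmetric])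
  ultimately show "(\<lambda>s. 1 / 2 * s * (s - 1) * of_real pi powr (- s / 2) * Gamma (s / 2) * Z s) \<midarrow>s\<rightarrow> F ((s - 1 / 2)^2)"
    by (rule Lim_transform_eventually)
qed

lemma xi_coeff_eq: "xi_coeff j = fact j * f j"
proof -
  have "xi_coeff = (\<lambda>j. fact j * f j)"
    unfolding xi_coeff_def
  proof (rule the_equality)
    show "\<forall>z::complex. (\<lambda>j. of_real (fact j * f j) / fact j * z ^ (2 * j)) sums riemann_xi (1 / 2 + z)"
      using F_sums by (simp add: riemann_xi_eq_F power_mult)
    fix g assume g: "\<forall>z::complex. (\<lambda>j. of_real (g j) / fact j * z ^ (2 * j)) sums riemann_xi (1 / 2 + z)"
    \<comment> \<open>Taking z = \<open>csqrt w\<close> turns the even series in z into a power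
      series in w.\<close>
    have "(\<lambda>j. of_real (g j) / fact j * w ^ j) sums F w" for w :: complex
      using g[rule_format, of "csqrt w"] by (simp add: riemann_xi_eq_F power_mult)
    from entire_power_series(2)[OF this] entire_power_series(2)[OF F_sums]
    have eq: "of_real (g j) / fact j = complex_of_real (f j)" for j by metis
    have "complex_of_real (g j) = of_real (fact j * f j)" for j
      using eq[of j] by (simp add: field_simps)
    thus "g = (\<lambda>j. fact j * f j)" unfolding of_real_eq_iff by blast
  qed
  from fun_cong[OF this] show ?thesis .
qed

end

section \<open>Zeros and growth of xi\<close>

text \<open>
  If the sum vanishes, so does the sum over the integers \<open>S k\<close> without prime factor \<open>\<le> k\<close>, by sieving out one
  prime at a time; but that sum tends to its term \<open>1\<close>.
\<close>
lemma zeta_nonzero: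
  assumes s: "Re s > 1" and sums: "(\<lambda>n. 1 / of_nat (Suc n) powr s) sums z"
  shows "z \<noteq> 0"
proof
  assume "z = 0"
  define a where "a n = 1 / of_nat n powr s" for n :: nat
  \<comment> \<open>Division by zero gives 0 here, so all naturals may serve as index set.\<close>
  have a0: "a 0 = 0" by (simp add: a_def)
  have a_mult: "a (m * n) = a m * a n" for m n
  proof -
    have "complex_of_real (real m * real n) powr s = of_real (real m) powr s * of_real (real n) powr s"
      using powr_times_real_left[of "real m" "real n" s] by simp
    thus ?thesis by (simp add: a_def)
  qed
  have norm_a: "norm (a (Suc n)) = 1 / real (Suc n) powr Re s" for n
  proof -
    have "cmod (of_nat (Suc n) powr s) = real (Suc n) powr Re s" by (subst norm_powr_real_powr) auto
    thus ?thesis by (simp only: a_def norm_divide norm_one)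
  qed
  have "summable (\<lambda>n. norm (a (Suc n)))"
    unfolding norm_a by (rule summable_inverse_powr_Suc[OF s])
  hence sm: "summable (\<lambda>n. norm (a n))" by (subst (asm) summable_Suc_iff)
  have "(\<lambda>n. a (Suc n)) sums (z - a 0)" using sums by (simp add: a_def a0[unfolded a_def])
  hence "a sums z" by (subst (asm) sums_Suc_iff) (simp add: a0)
  hence "(a has_sum z) UNIV" by (rule norm_summable_imp_has_sum[OF sm])
  hence tot: "infsum a UNIV = 0" using \<open>z = 0\<close> by (simp add: infsumI)
  have sa: "a summable_on A" for A
    using norm_summable_imp_summable_on[OF sm] summable_on_subset_banach by blast
  have "(\<lambda>n. norm (a n)) summable_on UNIV"
    by (rule norm_summable_imp_summable_on) (use sm in simp)
  hence san: "(\<lambda>n. norm (a n)) summable_on A" for A using summable_on_subset_banach by blast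
  define S where "S k = {n. \<forall>p. prime p \<and> p \<le> k \<longrightarrow> \<not> p dvd n}" for k :: nat
  have T: "infsum a (S k) = 0" for k
  proof (induction k)
    case 0
    have "S 0 = UNIV" by (auto simp: S_def)
    thus ?case using tot by simp
  next
    case (Suc k)
    define p where "p = Suc k"
    show ?case
    proof (cases "prime p")
      case False
      hence "S (Suc k) = S k" unfolding S_def p_def by (auto simp: le_Suc_eq)
      thus ?thesis using Suc by simp
    next
      case True
      have pk: "p > k" by (simp add: p_def)
      have p0: "p > 0" by (simp add: p_def)
      have img: "(\<lambda>n. p * n) ` S k \<subseteq> S k"
      proof safe
        fix n assume n: "n \<in> S k"
        show "p * n \<in> S k" unfolding S_def
        proof safe
          fix q assume q: "prime q" "q \<le> k" "q dvd p * n"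
          hence "q dvd p \<or> q dvd n" using prime_dvd_mult_iff by blast
          moreover have "\<not> q dvd n" using n q by (auto simp: S_def)
          ultimately have "q = p" using True q(1) primes_dvd_imp_eq by blast
          thus False using q pk by simp
        qed
      qed
      have eq: "S (Suc k) = S k - (\<lambda>n. p * n) ` S k"
      proof (intro equalityI subsetI)
        fix n assume n: "n \<in> S (Suc k)"
        have "n \<in> S k" using n by (auto simp: S_def)
        moreover have "\<not> p dvd n" using n True by (auto simp: S_def p_def)
        ultimately show "n \<in> S k - (\<lambda>n. p * n) ` S k" by auto
      next
        fix n assume n: "n \<in> S k - (\<lambda>n. p * n) ` S k"
        have "\<not> p dvd n"
        proof
          assume "p dvd n"
          then obtain m where m: "n = p * m" by blast
          have "m \<in> S k" using n m by (auto simp: S_def)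
          thus False using n m by auto
        qed
        thus "n \<in> S (Suc k)" using n by (auto simp: S_def p_def le_Suc_eq)
      qed
      \<comment> \<open>The removed multiples of p contribute \<open>a p\<close> times the sum over
        \<open>S k\<close>, which is 0 by induction.\<close>
      have "infsum a (S (Suc k)) = infsum a (S k) - infsum a ((\<lambda>n. p * n) ` S k)"
        unfolding eq by (rule infsum_Diff[OF sa sa img])
      also have "infsum a ((\<lambda>n. p * n) ` S k) = infsum (\<lambda>n. a p * a n) (S k)"
        using p0 by (subst infsum_reindex) (auto simp: inj_on_def o_def a_mult)
      also have "\<dots> = a p * infsum a (S k)" by (rule infsum_cmult_right) (rule sa)
      finally show ?thesis using Suc by simp
    qed
  qed
  have hs: "((\<lambda>n. norm (a n)) has_sum infsum (\<lambda>n. norm (a n)) UNIV) UNIV" using san by (rule has_sum_infsum)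
  \<comment> \<open>Outside the finite set \<open>A\<close> the absolute values sum to less than
    1/2. For k beyond \<open>A\<close> the elements of \<open>S k\<close> other than 1 lie outside
    \<open>A\<close>, yet their sum would have to be -1.\<close>
  obtain A where A: "finite A" "norm (sum (\<lambda>n. norm (a n)) A - infsum (\<lambda>n. norm (a n)) UNIV) < 1 / 2"
  proof -
    have "eventually (\<lambda>A. dist (sum (\<lambda>n. norm (a n)) A) (infsum (\<lambda>n. norm (a n)) UNIV) < 1 / 2) (finite_subsets_at_top UNIV)"
      using hs unfolding has_sum_def by (rule tendstoD) simp
    then obtain A where "finite A" "dist (sum (\<lambda>n. norm (a n)) A) (infsum (\<lambda>n. norm (a n)) UNIV) < 1 / 2"
      unfolding eventually_finite_subsets_at_top by blast
    thus ?thesis using that by (simp add: dist_norm)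
  qed
  obtain k where k: "k \<ge> 2" "\<And>n. n \<in> A \<Longrightarrow> n \<le> k"
    using finite_nat_set_iff_bounded_le A(1) by (metis max.cobounded1 max.cobounded2 order_trans)
  have one: "1 \<in> S k" by (auto simp: S_def)
  have sub: "S k - {1} \<subseteq> UNIV - A"
  proof
    fix n assume n: "n \<in> S k - {1}"
    have "n > k"
    proof (rule ccontr)
      assume "\<not> n > k"
      have "n \<noteq> 0"
      proof
        assume "n = 0"
        hence "\<not> 2 dvd (0::nat)" using n k(1) two_is_prime_nat by (auto simp: S_def)
        thus False by simp
      qed
      obtain p where p: "prime p" "p dvd n" using n prime_factor_nat[of n] by auto
      hence "p \<le> n" using \<open>n \<noteq> 0\<close> by (simp add: dvd_imp_le)
      thus False using p n \<open>\<not> n > k\<close> by (auto simp: S_def)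
    qed
    thus "n \<in> UNIV - A" using k(2)[of n] by auto
  qed
  have "infsum a (S k) = infsum a {1} + infsum a (S k - {1})"
    using infsum_Un_disjoint[OF sa[of "{1}"] sa[of "S k - {1}"]] one by (simp add: insert_absorb)
  hence "norm (infsum a (S k - {1})) = 1" using T[of k] by (simp add: a_def add_eq_0_iff)
  moreover have "norm (infsum a (S k - {1})) \<le> infsum (\<lambda>n. norm (a n)) (S k - {1})"
    by (rule norm_infsum_bound) (rule san)
  moreover have "\<dots> \<le> infsum (\<lambda>n. norm (a n)) (UNIV - A)"
    by (rule infsum_mono_neutral[OF san san]) (use sub in auto)
  moreover have "infsum (\<lambda>n. norm (a n)) (UNIV - A) = infsum (\<lambda>n. norm (a n)) UNIV - infsum (\<lambda>n. norm (a n)) A"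
    by (rule infsum_Diff[OF san san]) simp
  moreover have "infsum (\<lambda>n. norm (a n)) A = sum (\<lambda>n. norm (a n)) A" using A(1) by (rule infsum_finite)
  ultimately show False using A(2) by (simp add: real_norm_def)
qed

lemma fact_le_power_self: "fact m \<le> real m ^ m"
  using fact_le_power[of m] by simp

section \<open>Growth of \<open>F\<close> and location of its zeros\<close>

context xi_expansion
begin

definition cs :: "real \<Rightarrow> real" where "cs x = (\<Sum>j. c j * x ^ j)"

lemma cs_mono: "0 \<le> x \<Longrightarrow> x \<le> y \<Longrightarrow> cs x \<le> cs y"
  unfolding cs_def
  by (intro suminf_le c_summable) (auto intro!: mult_left_mono power_mono less_imp_le[OF c_pos])

lemma c_le_cs: "x \<ge> 0 \<Longrightarrow> c j * x ^ j \<le> cs x"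
  unfolding cs_def using sum_le_suminf[OF c_summable, of x "{j}"] less_imp_le[OF c_pos] by simp

lemma norm_C_le_cs: "cmod w \<le> x \<Longrightarrow> cmod (C w) \<le> cs x"
  using norm_C_le[of w x] C_of_real[of x] norm_ge_zero[of w] by (simp add: cs_def)

lemma cs_eq:
  assumes "s > 1"
  shows "cs ((s - 1 / 2)^2) = pi powr (- s / 2) * Gamma (s / 2) * (\<Sum>n. 1 / real (Suc n) powr s) - (1 / (s - 1) - 1 / s)"
  using c_sums[OF assms] by (simp add: cs_def sums_iff power_mult)

text \<open>9/4 = (2 - 1/2)^2, and at s = 2 the expansion has the explicit value pi/6 - 1/2, below
  1/6 since pi < 4.\<close>

lemma cs_9_4: "cs (9 / 4) < 1 / 6"
proof -
  have "(\<lambda>n. 1 / real (Suc n) powr 2) sums (pi^2 / 6)"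
    using inverse_squares_sums by (simp add: powr_numeral add.commute)
  hence z: "(\<Sum>n. 1 / real (Suc n) powr 2) = pi^2 / 6" by (simp add: sums_iff)
  have "cs ((2 - 1 / 2)^2) = pi powr (- 1) * Gamma 1 * (pi^2 / 6) - (1 - 1 / 2)"
    using cs_eq[of 2] unfolding z by simp
  also have "(2 - 1 / 2)^2 = (9 / 4 :: real)" by (simp add: power2_eq_square)
  also have "pi powr (- 1) * Gamma 1 * (pi^2 / 6) - (1 - 1 / 2) = pi / 6 - 1 / 2"
    by (simp add: powr_minus_divide power2_eq_square)
  finally show ?thesis using pi_less_4 by simp
qed

text \<open>The point is (s - 1/2)^2 for s = 2m + 2, where Gamma (s/2) = m!. The other factors are
  at most pi^(-1) and zeta(2), whose product pi/6 is below 1.\<close>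

lemma cs_le_fact: "cs ((2 * real m + 3 / 2)^2) \<le> fact m"
proof -
  define s where "s = 2 * real m + 2"
  have s: "s > 1" "s \<ge> 2" by (simp_all add: s_def)
  have sq: "(\<lambda>n. 1 / real (Suc n) powr 2) sums (pi^2 / 6)"
    using inverse_squares_sums by (simp add: powr_numeral add.commute)
  have "(\<Sum>n. 1 / real (Suc n) powr s) \<le> (\<Sum>n. 1 / real (Suc n) powr 2)"
    by (intro suminf_le summable_inverse_powr_Suc divide_left_mono powr_mono s) auto
  hence z: "(\<Sum>n. 1 / real (Suc n) powr s) \<le> pi^2 / 6" using sq by (simp add: sums_iff)
  have "(2 * real m + 3 / 2)^2 = (s - 1 / 2)^2" by (simp add: s_def)
  hence "cs ((2 * real m + 3 / 2)^2) = pi powr (- s / 2) * Gamma (s / 2) * (\<Sum>n. 1 / real (Suc n) powr s) - (1 / (s - 1) - 1 / s)"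
    using cs_eq[OF s(1)] by simp
  also have "\<dots> \<le> pi powr (- s / 2) * Gamma (s / 2) * (\<Sum>n. 1 / real (Suc n) powr s)"
    using s by (simp add: field_simps)
  also have "\<dots> \<le> pi powr (- 1) * Gamma (s / 2) * (pi^2 / 6)"
  proof (intro mult_mono z)
    show "pi powr (- s / 2) \<le> pi powr (- 1)" using s pi_gt3 by (intro powr_mono) auto
    show "0 \<le> Gamma (s / 2)" using s by (intro less_imp_le[OF Gamma_real_pos]) auto
    thus "0 \<le> pi powr (- 1) * Gamma (s / 2)" by simp
    show "0 \<le> (\<Sum>n. 1 / real (Suc n) powr s)"
      by (intro suminf_nonneg summable_inverse_powr_Suc s) auto
  qed auto
  also have "Gamma (s / 2) = fact m"
  proof -
    have "s / 2 = 1 + real m" by (simp add: s_def)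
    show ?thesis unfolding \<open>s / 2 = 1 + real m\<close> by (rule Gamma_fact)
  qed
  also have "pi powr (- 1) * fact m * (pi^2 / 6) = fact m * (pi / 6)"
    by (simp add: powr_minus_divide power2_eq_square)
  also have "\<dots> \<le> fact m * 1" using pi_less_4 by (intro mult_left_mono) auto
  finally show ?thesis by simp
qed

text \<open>\<open>cs_le_fact\<close> with m the ceiling of sqrt R, and m! <= m^m: this is where the
  order 1/2 comes from.\<close>

lemma cs_le_exp:
  assumes "R \<ge> 1"
  shows "cs R \<le> exp ((sqrt R + 1) * ln (sqrt R + 1))"
proof -
  define m where "m = nat \<lceil>sqrt R\<rceil>"
  have m: "sqrt R \<le> real m" "real m \<le> sqrt R + 1" using assms by (auto simp: m_def)
  have "R = (sqrt R)^2" using assms by simp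
  also have "\<dots> \<le> (2 * real m + 3 / 2)^2" using m(1) assms by (intro power_mono) auto
  finally have "cs R \<le> cs ((2 * real m + 3 / 2)^2)" using assms by (intro cs_mono) auto
  also have "\<dots> \<le> fact m" by (rule cs_le_fact)
  also have "\<dots> \<le> real m ^ m" by (rule fact_le_power_self)
  also have "\<dots> \<le> (sqrt R + 1) ^ m" using m by (intro power_mono) auto
  also have "\<dots> = (sqrt R + 1) powr real m" using assms by (intro powr_realpow[symmetric]) (smt (verit) real_sqrt_ge_zero)
  also have "\<dots> \<le> (sqrt R + 1) powr (sqrt R + 1)" using assms m by (intro powr_mono) auto
  also have "\<dots> = exp ((sqrt R + 1) * ln (sqrt R + 1))"
    using assms by (simp add: powr_def add_nonneg_eq_0_iff)
  finally show ?thesis .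
qed

lemma norm_F_le:
  assumes R: "R \<ge> 1" and w: "cmod w \<le> R"
  shows "cmod (F w) \<le> exp (ln (R + 1) + (sqrt R + 1) * ln (sqrt R + 1))"
proof -
  define E where "E = exp ((sqrt R + 1) * ln (sqrt R + 1))"
  have E: "E \<ge> 1" using R by (simp add: E_def)
  have C: "cmod (C w) \<le> E" using norm_C_le_cs[OF w] cs_le_exp[OF R] by (simp add: E_def)
  have "cmod ((w - 1 / 4) * C w / 2) = cmod (w - 1 / 4) * cmod (C w) / 2" by (simp add: norm_mult norm_divide)
  also have "\<dots> \<le> (R + 1 / 4) * E / 2"
    using C w norm_triangle_ineq4[of w "1/4"] R by (intro divide_right_mono mult_mono) auto
  finally have "cmod ((w - 1 / 4) * C w / 2) \<le> (R + 1 / 4) * E / 2" .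
  moreover have "cmod (F w) \<le> cmod (1 / 2) + cmod ((w - 1 / 4) * C w / 2)" unfolding F_def by (rule norm_triangle_ineq)
  moreover have "cmod (1 / 2) = 1 / 2" by simp
  ultimately have "cmod (F w) \<le> 1 / 2 + (R + 1 / 4) * E / 2" by linarith
  also have "\<dots> \<le> 1 / 2 * E + (R + 1 / 4) * E / 2" using E by simp
  also have "\<dots> \<le> (R + 1) * E" 
  proof -
    have "E * R \<ge> 0" using R E by simp
    moreover have "1 / 2 * E + (R + 1 / 4) * E / 2 = 5 / 8 * E + 1 / 2 * (E * R)" by (simp add: field_simps)
    moreover have "(R + 1) * E = E * R + E" by (simp add: algebra_simps)
    ultimately show ?thesis using E by linarith
  qed
  also have "\<dots> = exp (ln (R + 1) + (sqrt R + 1) * ln (sqrt R + 1))" using R by (simp add: exp_add E_def)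
  finally show ?thesis .
qed

lemma f_0_pos: "f 0 > 0"
  using c_le_cs[of "9/4" 0] cs_9_4 by (simp add: f_def)

lemma F_0: "F 0 = of_real (f 0)"
  using F_sums[of 0] by (simp add: powser_sums_zero_iff) 

lemma F_cnj: "F (cnj w) = cnj (F w)"
proof -
  have "(\<lambda>j. cnj (of_real (f j) * w ^ j)) sums cnj (F w)" using F_sums by (simp only: sums_cnj)
  hence "(\<lambda>j. of_real (f j) * cnj w ^ j) sums cnj (F w)" by simp
  thus ?thesis by (rule sums_unique2[OF F_sums])
qed

text \<open>A zero needs (w - 1/4) C(w) = -1, but in this disc the factors are at most 5/2 and 1/6
  in modulus.\<close>

lemma F_nonzero_near_0:
  assumes "cmod w \<le> 9 / 4"
  shows "F w \<noteq> 0"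
proof
  assume "F w = 0"
  hence "(w - 1 / 4) * C w = - 1" by (simp add: F_def field_simps)
  hence "1 = cmod (w - 1 / 4) * cmod (C w)" by (metis norm_minus_cancel norm_mult norm_one)
  also have "\<dots> \<le> (5 / 2) * (1 / 6)"
    using norm_C_le_cs[OF assms] cs_9_4 norm_triangle_ineq4[of w "1/4"] assms by (intro mult_mono) auto
  finally show False by simp
qed

text \<open>Only the half plane Re s > 1 of absolute convergence enters. The mirror half plane is
  covered because the value depends on z^2.\<close>

lemma F_nonzero_half_plane:
  assumes "Re z > 1 / 2"
  shows "F (z^2) \<noteq> 0"
proof -
  define s where "s = 1 / 2 + z"
  have s: "Re s > 1" using assms by (simp add: s_def)
  have half: "s / 2 \<notin> \<int>\<^sub>\<le>\<^sub>0"
  proof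
    assume "s / 2 \<in> \<int>\<^sub>\<le>\<^sub>0"
    then obtain n where "s / 2 = of_int n" "n \<le> 0" by (auto elim!: nonpos_Ints_cases)
    from arg_cong[OF this(1), of Re] this(2) s show False by simp
  qed
  have "s \<noteq> 1" "s \<noteq> 0" using s by auto
  moreover have "Z s \<noteq> 0" by (rule zeta_nonzero[OF s Z_sums[OF s]])
  moreover have "Gamma (s / 2) \<noteq> 0" using half by (simp add: Gamma_eq_zero_iff)
  ultimately have "1 / 2 * s * (s - 1) * of_real pi powr (- s / 2) * Gamma (s / 2) * Z s \<noteq> 0" by simp
  hence "F ((s - 1 / 2)^2) \<noteq> 0" unfolding completed_zeta_eq_F[OF half \<open>s \<noteq> 1\<close>] .
  thus ?thesis by (simp add: s_def)
qed

lemma F_zero_in_xi_region: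
  assumes "F w = 0"
  shows "w \<in> xi_region"
proof -
  define z where "z = csqrt w"
  have w: "w = z^2" by (simp add: z_def)
  have "Re z \<ge> 0" unfolding z_def by (rule Re_csqrt)
  moreover have "Re z \<le> 1 / 2" using F_nonzero_half_plane[of z] assms w by force
  ultimately have "Re z * Re z \<le> (1 / 2) * (1 / 2)" by (intro mult_mono) auto
  moreover have "cmod w + Re w = 2 * (Re z * Re z)"
    using cmod_power2[of z] by (simp add: w norm_power Re_power2) (simp add: power2_eq_square)
  ultimately have "cmod w + Re w \<le> 1 / 2" by simp
  \<comment> \<open>Together with |w| + Re w <= 1/2 this gives Re w <= 1/2 - 9/4 = -7/4.\<close>
  moreover have "cmod w > 9 / 4" using F_nonzero_near_0[of w] assms by force
  ultimately show ?thesis by (simp add: xi_region_def)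
qed

text \<open>If \<open>f\<close> vanished from some index on, then c (j + 1) = 4 c j from there,
  against \<open>c\<close> tending to 0. So \<open>F\<close> is not a polynomial, which later
  excludes zero coefficients.\<close>

lemma f_eventually_nonzero: "\<exists>j\<ge>k. f j \<noteq> 0"
proof (rule ccontr)
  assume "\<not> (\<exists>j\<ge>k. f j \<noteq> 0)"
  hence "f (Suc (k + i)) = 0" for i by (metis le_SucI le_add1)
  hence step: "c (Suc (k + i)) = 4 * c (k + i)" for i by (simp add: f_def)
  have "c k \<le> c (k + i)" for i
  proof (induction i)
    case (Suc i)
    thus ?case using step[of i] c_pos[of "k + i"] by simp
  qed simp
  moreover have "(\<lambda>j. c j) \<longlonglongrightarrow> 0" using summable_LIMSEQ_zero[OF c_summable[of 1]] by simp
  hence "(\<lambda>i. c (i + k)) \<longlonglongrightarrow> 0" by (rule LIMSEQ_ignore_initial_segment)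
  ultimately have "c k \<le> 0" by (intro LIMSEQ_le_const[of "\<lambda>i. c (i + k)" 0]) (auto simp: add.commute)
  thus False using c_pos[of k] by simp
qed

text \<open>Positivity of \<open>c\<close> replaces Cauchy's estimate: a single term
  \<open>c n * R ^ n\<close> is at most the whole sum \<open>cs R\<close>.\<close>

lemma f_Suc_le:
  assumes "R \<ge> 1"
  shows "f (Suc n) \<le> exp ((sqrt R + 1) * ln (sqrt R + 1)) / R ^ n"
proof -
  have "c n * R ^ n \<le> exp ((sqrt R + 1) * ln (sqrt R + 1))"
    using c_le_cs[of R n] cs_le_exp[OF assms] assms by simp
  hence "c n \<le> exp ((sqrt R + 1) * ln (sqrt R + 1)) / R ^ n" using assms by (simp add: field_simps)
  thus ?thesis using c_pos[of n] c_pos[of "Suc n"] by (simp add: f_def)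
qed

text \<open>\<open>entire_polynomial_approximation\<close> is normalized to value 1 at 0, hence the
  division by \<open>f 0\<close> and the \<open>- ln (f 0)\<close> in \<open>M\<close>.\<close>

lemma approximating_polynomials:
  obtains P :: "nat \<Rightarrow> real poly" where "xi_region_limit P (\<lambda>j. fact j * f j / f 0)"
proof -
  define G where "G w = F w / of_real (f 0)" for w
  define M where "M R = ln (R + 1) + (sqrt R + 1) * ln (sqrt R + 1) - ln (f 0)" for R
  have f0: "f 0 > 0" "f 0 \<noteq> 0" using f_0_pos by auto
  have hol: "G holomorphic_on UNIV" unfolding G_def by (intro holomorphic_intros F_holomorphic) (use f0 in auto)
  have G0: "G 0 = 1" using f0 by (simp add: G_def F_0)
  have sym: "G (cnj w) = cnj (G w)" for w by (simp add: G_def F_cnj)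
  have bound: "cmod (G w) \<le> exp (M R)" if "R \<ge> 1" "cmod w \<le> R" for R w
    using norm_F_le[OF that] f0 by (simp add: G_def M_def norm_divide exp_diff divide_right_mono)
  have growth: "(\<lambda>N. M (3 * real N) / real N) \<longlonglongrightarrow> 0"
  proof -
    have "(\<lambda>N. (ln (3 * real N + 1) + (sqrt (3 * real N) + 1) * ln (sqrt (3 * real N) + 1) - K) / real N) \<longlonglongrightarrow> 0" for K
      by real_asymp
    thus ?thesis unfolding M_def by blast
  qed
  obtain P :: "nat \<Rightarrow> real poly" where P: "\<And>N. coeff (P N) 0 = 1"
    "\<And>N w. poly (cpoly (P N)) w = 0 \<Longrightarrow> G w = 0"
    "\<And>j. (\<lambda>N. of_real (coeff (P N) j)) \<longlonglongrightarrow> (deriv ^^ j) G 0 / fact j"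
    by (rule entire_polynomial_approximation[OF hol G0 sym bound growth]) (assumption, assumption, rule that, assumption+)
  have G_sums: "(\<lambda>j. of_real (f j / f 0) * w ^ j) sums G w" for w
    using sums_divide[OF F_sums[of w], of "of_real (f 0)"] by (simp add: G_def)
  show thesis
  proof (rule that[of P], unfold_locales)
    fix N w j
    show "w \<in> xi_region" if "poly (cpoly (P N)) w = 0"
      using P(2)[OF that] f0 by (intro F_zero_in_xi_region) (simp add: G_def)
    show "coeff (P N) 0 > 0" using P(1) by simp
    have "(\<lambda>N. complex_of_real (coeff (P N) j)) \<longlonglongrightarrow> of_real (f j / f 0)"
      using P(3)[of j] entire_power_series(2)[OF G_sums, of j] by simp
    hence "(\<lambda>N. coeff (P N) j) \<longlonglongrightarrow> f j / f 0" by (simp only: tendsto_of_real_iff)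
    thus "(\<lambda>N. coeff (P N) j) \<longlonglongrightarrow> fact j * f j / f 0 / fact j" by simp
  qed
qed

end

section \<open>Decay of the coefficient ratios and choice of the constant\<close>

theorem theorem1p1:
  "\<exists>c::real. c > 0 \<and>
     (\<forall>d n :: nat. d \<ge> 1 \<longrightarrow> real n \<ge> c * exp (real d / 2) \<longrightarrow> hyperbolic (jensen_poly d n))"
proof -
  obtain c where "xi_expansion c"
    by (rule completed_zeta_expansion) (rule that, unfold_locales, assumption+)
  then interpret xi_expansion c .
  obtain P where "xi_region_limit P (\<lambda>j. fact j * f j / f 0)" by (rule approximating_polynomials)
  then interpret L: xi_region_limit P "\<lambda>j. fact j * f j / f 0" .
  define g where "g j = fact j * f j / f 0" for j
  have f0: "f 0 > 0" by (rule f_0_pos)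
  have g_nonneg: "g j \<ge> 0" for j unfolding g_def by (rule L.g_nonneg)
  have ratio: "g (m + 1) * g n \<le> g m * g (n + 1)" if "n \<le> m" for m n
    unfolding g_def by (rule L.g_ratio_decreasing[OF that])
  \<comment> \<open>A first zero g (n + 1) = 0 would, by monotone ratios, force all later values to
    vanish, against \<open>f_eventually_nonzero\<close>.\<close>
  have g_pos: "g n > 0" for n
  proof (induction n)
    case 0
    thus ?case using f0 by (simp add: g_def)
  next
    case (Suc n)
    show ?case
    proof (rule ccontr)
      assume "\<not> g (Suc n) > 0"
      hence "g (n + 1) = 0" using g_nonneg[of "Suc n"] by simp
      hence "g (m + 1) * g n \<le> 0" if "m \<ge> n" for m using ratio[OF that] by simp
      hence z: "g (m + 1) = 0" if "m \<ge> n" for m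
        using Suc that g_nonneg[of "m + 1"] by (metis dual_order.antisym mult_le_0_iff not_le)
      obtain j where "j \<ge> n + 1" "f j \<noteq> 0" using f_eventually_nonzero by blast
      have "g (j - 1 + 1) = 0" by (rule z) (use \<open>j \<ge> n + 1\<close> in simp)
      thus False using \<open>j \<ge> n + 1\<close> \<open>f j \<noteq> 0\<close> f0 by (simp add: g_def)
    qed
  qed
  define \<rho> where "\<rho> n = g (n + 1) / g n" for n
  have \<rho>_pos: "\<rho> n > 0" for n using g_pos by (simp add: \<rho>_def)
  have \<rho>_decreasing: "\<rho> m \<le> \<rho> n" if "n \<le> m" for m n
    using ratio[OF that] g_pos[of n] g_pos[of m] by (simp add: \<rho>_def field_simps)
  \<comment> \<open>\<open>g m\<close> is the product of \<rho> 0, ..., \<rho> (m - 1), because g 0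
    = 1, and each factor is at least \<rho> n. Taking m = n bounds \<rho> n by the n-th root of g
    n.\<close>
  have \<rho>_power: "\<rho> n ^ m \<le> g m" if "m \<le> n" for m n
    using that
  proof (induction m)
    case 0
    thus ?case using f0 by (simp add: g_def)
  next
    case (Suc m)
    have "\<rho> n * \<rho> n ^ m \<le> \<rho> m * g m"
      using Suc \<rho>_decreasing[of m n] \<rho>_pos[of n] \<rho>_pos[of m] by (intro mult_mono) auto
    also have "\<rho> m * g m = g (m + 1)" using g_pos[of m] by (simp add: \<rho>_def)
    finally show ?case by simp
  qed
  \<comment> \<open>1/n times the logarithm of the bound for \<open>g n\<close> obtained at R =
    n^(3/2). Any exponent strictly between 1 and 2 would do: above 1 so that R^n beats n!, below 2
    so that the growth term sqrt R ln (sqrt R) is o(n). With 3/2, L n behaves like -(1/2) ln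
    n.\<close>
  define L where "L n = (real n * ln (real n) + (real n powr (3 / 4) + 1) * ln (real n powr (3 / 4) + 1)
      - 3 / 2 * (real n - 1) * ln (real n) - ln (f 0)) / real n" for n :: nat
  text \<open>The growth of \<open>\<xi>\<close> on the circle of radius \<open>n\<^bsup>3/2\<^esup>\<close> bounds the \<open>n\<close>-th coefficient.\<close>
  have \<rho>_le: "\<rho> n \<le> exp (L n)" if n: "n \<ge> 1" for n
  proof -
    define R where "R = real n powr (3 / 2)"
    have R: "R \<ge> 1" using n by (simp add: R_def ge_one_powr_ge_zero)
    have sqrtR: "sqrt R = real n powr (3 / 4)" by (simp add: R_def powr_half_sqrt[symmetric] powr_powr)
    define E where "E = (real n powr (3 / 4) + 1) * ln (real n powr (3 / 4) + 1)"
    have "fact n \<le> real n ^ n" by (rule fact_le_power_self)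
    also have "\<dots> = exp (real n * ln (real n))" using n by (simp add: exp_of_nat_mult)
    finally have fct: "fact n \<le> exp (real n * ln (real n))" .
    have Rn: "R ^ (n - 1) = exp (3 / 2 * (real n - 1) * ln (real n))"
    proof -
      have "R = exp (3 / 2 * ln (real n))" using n by (simp add: R_def powr_def)
      hence "R ^ (n - 1) = exp (real (n - 1) * (3 / 2 * ln (real n)))" by (simp only: exp_of_nat_mult)
      also have "real (n - 1) * (3 / 2 * ln (real n)) = 3 / 2 * (real n - 1) * ln (real n)"
        using n by (simp add: of_nat_diff)
      finally show ?thesis .
    qed
    have "f n \<le> exp E / R ^ (n - 1)"
      using f_Suc_le[OF R, of "n - 1"] n unfolding sqrtR E_def by simp
    also have "\<dots> = exp (E - 3 / 2 * (real n - 1) * ln (real n))" by (simp only: Rn exp_diff)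
    finally have fn: "f n \<le> exp (E - 3 / 2 * (real n - 1) * ln (real n))" .
    have "f n \<ge> 0" using g_pos[of n] f0 by (simp add: g_def zero_less_divide_iff zero_less_mult_iff)
    have "\<rho> n ^ n \<le> g n" by (rule \<rho>_power) simp
    also have "\<dots> \<le> exp (real n * ln (real n)) * exp (E - 3 / 2 * (real n - 1) * ln (real n)) / f 0"
      unfolding g_def using fct fn \<open>f n \<ge> 0\<close> f0 by (intro divide_right_mono mult_mono) auto
    also have "\<dots> = exp (real n * ln (real n) + (E - 3 / 2 * (real n - 1) * ln (real n)) - ln (f 0))"
      using f0 by (simp add: exp_add exp_diff)
    also have "\<dots> = exp (real n * L n)" using n by (simp add: L_def E_def)
    also have "\<dots> = exp (L n) ^ n" by (rule exp_of_nat_mult)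
    finally show ?thesis using n by (simp add: power_mono_iff less_imp_le[OF \<rho>_pos])
  qed
  \<comment> \<open>The hypothesis on n gives d <= 2 ln n, so \<open>d * \<rho> n\<close> is at most
    this quantity; 5/7 is the threshold in \<open>hyperbolic_jensen\<close>.\<close>
  have "(\<lambda>n::nat. 2 * ln (real n) * exp ((real n * ln (real n) + (real n powr (3 / 4) + 1) * ln (real n powr (3 / 4) + 1)
      - 3 / 2 * (real n - 1) * ln (real n) - K) / real n)) \<longlonglongrightarrow> 0" for K
    by real_asymp
  hence "(\<lambda>n. 2 * ln (real n) * exp (L n)) \<longlonglongrightarrow> 0" unfolding L_def by blast
  hence "eventually (\<lambda>n. 2 * ln (real n) * exp (L n) < 5 / 7) sequentially" by (rule order_tendstoD) simp
  then obtain N where N: "\<And>n. n \<ge> N \<Longrightarrow> 2 * ln (real n) * exp (L n) < 5 / 7"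
    unfolding eventually_sequentially by blast
  \<comment> \<open>At least 1, so that n >= exp (d/2); at least N, so that the eventual bound
    applies to n.\<close>
  define K where "K = max 1 (real N)"
  have "hyperbolic (jensen_poly d n)" if d: "d \<ge> 1" and n: "real n \<ge> K * exp (real d / 2)" for d n
  proof -
    have K: "K \<ge> 1" "K \<ge> real N" by (auto simp: K_def)
    have "exp (real d / 2) \<le> K * exp (real d / 2)" using K(1) by simp
    hence nd: "exp (real d / 2) \<le> real n" using n by linarith
    have "K * 1 \<le> K * exp (real d / 2)" using K(1) by (intro mult_left_mono) auto
    hence nK: "real n \<ge> K" using n by linarith
    have n1: "n \<ge> 1" "n \<ge> N" using nK K by linarith+
    have "real d / 2 \<le> ln (real n)" by (subst ln_ge_iff) (use nd n1 in auto)
    hence "real d * \<rho> n \<le> 2 * ln (real n) * exp (L n)"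
      using \<rho>_le[OF n1(1)] \<rho>_pos[of n] n1 by (intro mult_mono) auto
    also have "\<dots> < 5 / 7" by (rule N[OF n1(2)])
    finally have "real d * g (n + 1) < 5 / 7 * g n" using g_pos[of n] by (simp add: \<rho>_def field_simps)
    hence "hyperbolic (\<Sum>j\<le>d. monom (of_nat (d choose j) * g (n + j)) j)"
      unfolding g_def using g_pos[of n] unfolding g_def by (intro L.hyperbolic_jensen)
    hence "hyperbolic (smult (f 0) (\<Sum>j\<le>d. monom (of_nat (d choose j) * g (n + j)) j))"
      using f0 by (intro hyperbolic_smult) auto
    also have "smult (f 0) (\<Sum>j\<le>d. monom (of_nat (d choose j) * g (n + j)) j) = jensen_poly d n"
      unfolding jensen_poly_def atLeast0AtMost using f0
      by (intro poly_eqI) (auto simp: coeff_sum sum_distrib_left g_def xi_coeff_eq intro!: sum.cong)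
    finally show ?thesis .
  qed
  moreover have "K > 0" by (simp add: K_def)
  ultimately show ?thesis by blast
qed

end
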